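(* Let $k\ge2$. For any nonzero symmetric tensors $f\in(\mathbb{C}^d)^{\otimes k}$ and $g\in(\mathbb{C}^e)^{\otimes k}$, and any integer $r\ge1$, the symmetric quantum functional $F$ satisfies: 1. $F(\langle r\rangle)=r$; 2. $F(f\oplus g)=F(f)+F(g)$; 3. $F(f\otimes g)=F(f)F(g)$; 4. if $f\le_{\mathrm{s}} g$, then $F(f)\le F(g)$.
   Context: A tensor in $(\mathbb{C}^d)^{\otimes k}$ is symmetric if it is invariant under all permutations of the $k$ tensor factors. The unit tensor is $\langle r\rangle=\sum_{i=1}^r e_i^{\otimes k}\in(\mathbb{C}^r)^{\otimes k}$. The direct sum $f\oplus g\in(\mathbb{C}^d\oplus\mathbb{C}^e)^{\otimes k}$ is the block-diagonal $k$-tensor, and $f\otimes g$ is regarded as a $k$-tensor in $(\mathbb{C}^d\otimes\mathbb{C}^e)^{\otimes k}$. Write $f\le_{\mathrm{s}} g$ if there is a linear map $A:\mathbb{C}^e\to\mathbb{C}^d$ with $f=A^{\otimes k}g$. Let $\mathcal{H}=\mathbb{C}^d$ with the standard inner product. For nonzero $s\in\mathcal{H}^{\otimes k}$ let $\rho(s)=ss^\dagger/\|s\|^2$ and let $\rho_j(s)$ be its $j$th marginal, i.e. the positive semidefinite trace-one operator on $\mathcal{H}$ obtained from $\rho(s)$ by taking the partial trace over all tensor factors except the $j$th. For a positive semidefinite operator $\rho$ with trace $1$, $\mathrm{spec}(\rho)$ is its non-increasingly ordered sequence of eigenvalues, a probability distribution. For a probability distribution $p=(p_1,\dots,p_d)$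 let $H(p)=-\sum_jp_j\log_2p_j$. The symmetric quantum functional of a nonzero $f\in\mathcal{H}^{\otimes k}$ is $F(f)=2^{E(f)}$ with $E(f)=\max\{H(p):p\in\Delta(f)\}$, where $$\Delta(f)=\Bigl\{\mathrm{spec}\Bigl(\tfrac{\rho_1(s)+\cdots+\rho_k(s)}{k}\Bigr): s\in\overline{\mathrm{GL}(d)\cdot f}\setminus\{0\}\Bigr\},$$ and $\overline{\mathrm{GL}(d)\cdot f}$ is the Euclidean (equivalently Zariski) closure of $\{(a\otimes\cdots\otimes a)f:a\in\mathrm{GL}(d)\}$. *)

theory Defs
  imports "HOL-Analysis.Analysis" "HOL-Computational_Algebra.Polynomial"
begin

text \<open>
  The \<open>k\<close> tensor factors are indexed by a finite type \<open>'k\<close> and the standard basis of the local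
  space by a finite type \<open>'d\<close>, so \<open>k = CARD('k)\<close> and \<open>d = CARD('d)\<close>. A tensor is its family of
  coordinates, one for each multi-index \<open>\<iota> :: 'k \<Rightarrow> 'd\<close>; the norm and topology of \<open>complex ^ _\<close> are
  the Euclidean ones. \<open>\<complex>\<^sup>d \<oplus> \<complex>\<^sup>e\<close> and \<open>\<complex>\<^sup>d \<otimes> \<complex>\<^sup>e\<close> have the index types
  \<open>'d + 'e\<close> and \<open>'d \<times> 'e\<close>.
\<close>

type_synonym ('k, 'd) tensor = "complex ^ ('k \<Rightarrow> 'd)"

definition symmetric_tensor :: "('k::finite, 'd::finite) tensor \<Rightarrow> bool" where
  "symmetric_tensor f \<longleftrightarrow> (\<forall>\<pi> :: 'k \<Rightarrow> 'k. bij \<pi> \<longrightarrow> (\<chi> \<iota>. f $ (\<iota> \<circ> \<pi>)) = f)"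

text \<open>\<open>v \<otimes> \<dots> \<otimes> v\<close>\<close>

definition vec_tensor_power :: "complex ^ 'd \<Rightarrow> ('k::finite, 'd::finite) tensor" where
  "vec_tensor_power v = (\<chi> \<iota>. \<Prod>j\<in>UNIV. v $ \<iota> j)"

text \<open>\<open>(A \<otimes> \<dots> \<otimes> A) f\<close>; the matrix \<open>A\<close> stands for a linear map \<open>\<complex>\<^sup>e \<rightarrow> \<complex>\<^sup>d\<close>.\<close>

definition tensor_power_map ::
    "complex ^ 'e ^ 'd \<Rightarrow> ('k::finite, 'e::finite) tensor \<Rightarrow> ('k, 'd::finite) tensor" where
  "tensor_power_map A f = (\<chi> \<iota>. \<Sum>\<kappa>\<in>UNIV. (\<Prod>j\<in>UNIV. A $ \<iota> j $ \<kappa> j) * f $ \<kappa>)"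

text \<open>The unit tensor \<open>\<langle>r\<rangle>\<close> with \<open>r = CARD('r)\<close>.\<close>

definition unit_tensor :: "('k::finite, 'r::finite) tensor" where
  "unit_tensor = (\<Sum>i\<in>UNIV. vec_tensor_power (axis i 1))"

definition tensor_direct_sum ::
    "('k::finite, 'd::finite) tensor \<Rightarrow> ('k, 'e::finite) tensor \<Rightarrow> ('k, 'd + 'e) tensor" where
  "tensor_direct_sum f g =
     (\<chi> \<iota>. if \<forall>j. isl (\<iota> j) then f $ (projl \<circ> \<iota>)
          else if \<forall>j. \<not> isl (\<iota> j) then g $ (projr \<circ> \<iota>)
          else 0)"

definition tensor_kronecker ::
    "('k::finite, 'd::finite) tensor \<Rightarrow> ('k, 'e::finite) tensor \<Rightarrow> ('k, 'd \<times> 'e) tensor" where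
  "tensor_kronecker f g = (\<chi> \<iota>. f $ (fst \<circ> \<iota>) * g $ (snd \<circ> \<iota>))"

definition sym_restriction ::
    "('k::finite, 'd::finite) tensor \<Rightarrow> ('k, 'e::finite) tensor \<Rightarrow> bool" (infix "\<le>\<^sub>s" 50) where
  "f \<le>\<^sub>s g \<longleftrightarrow> (\<exists>A :: complex ^ 'e ^ 'd. f = tensor_power_map A g)"

text \<open>\<open>\<rho>(s) = s s\<^sup>\<dagger> / \<parallel>s\<parallel>\<^sup>2\<close>\<close>

definition density ::
    "('k::finite, 'd::finite) tensor \<Rightarrow> complex ^ ('k \<Rightarrow> 'd) ^ ('k \<Rightarrow> 'd)" where
  "density s = (\<chi> \<iota> \<kappa>. s $ \<iota> * cnj (s $ \<kappa>) / complex_of_real ((norm s)\<^sup>2))"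

text \<open>
  The \<open>(a, b)\<close> entry of the partial trace over all factors except \<open>j\<close>: the row and column
  multi-indices have \<open>j\<close>th components \<open>a\<close> and \<open>b\<close> and agree in all the others.
\<close>

definition partial_trace_except ::
    "'k \<Rightarrow> complex ^ ('k::finite \<Rightarrow> 'd::finite) ^ ('k \<Rightarrow> 'd) \<Rightarrow> complex ^ 'd ^ 'd" where
  "partial_trace_except j R = (\<chi> a b. \<Sum>\<iota> | \<iota> j = a. R $ \<iota> $ (\<iota>(j := b)))"

definition marginal ::
    "'k \<Rightarrow> ('k::finite, 'd::finite) tensor \<Rightarrow> complex ^ 'd ^ 'd" where
  "marginal j s = partial_trace_except j (density s)"

definition average_marginal :: "('k::finite, 'd::finite) tensor \<Rightarrow> complex ^ 'd ^ 'd" where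
  "average_marginal s = (\<Sum>j\<in>UNIV. marginal j s) /\<^sub>R real CARD('k)"

definition charpoly :: "complex ^ 'd ^ 'd \<Rightarrow> complex poly" where
  "charpoly A = det (mat [:0, 1:] - map_matrix (\<lambda>x. [:x:]) A)"

text \<open>
  The non-increasing list of eigenvalues, with multiplicity, of a matrix whose eigenvalues are all
  real, in particular of a positive semidefinite one (unspecified for other matrices).
\<close>

definition spec :: "complex ^ 'd ^ 'd \<Rightarrow> real list" where
  "spec A = (THE p. sorted_wrt (\<ge>) p \<and> charpoly A = (\<Prod>x\<leftarrow>p. [:- complex_of_real x, 1:]))"

text \<open>The summand of a zero entry is \<open>0\<close>, as usual.\<close>

definition shannon_entropy :: "real list \<Rightarrow> real" where
  "shannon_entropy p = - (\<Sum>x\<leftarrow>p. x * log 2 x)"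

definition sym_orbit :: "('k::finite, 'd::finite) tensor \<Rightarrow> ('k, 'd) tensor set" where
  "sym_orbit f = {tensor_power_map a f | a. invertible a}"

definition spectra :: "('k::finite, 'd::finite) tensor \<Rightarrow> real list set" where
  "spectra f = {spec (average_marginal s) | s. s \<in> closure (sym_orbit f) - {0}}"

text \<open>
  The set of entropies is infinite in general, so \<open>Max\<close> does not apply. \<open>Greatest\<close> is the maximum
  in the strict sense: it is an element of the set, and unspecified if the supremum is not attained.
\<close>

definition log_sym_quantum_functional :: "('k::finite, 'd::finite) tensor \<Rightarrow> real" where
  "log_sym_quantum_functional f = (GREATEST h. h \<in> shannon_entropy ` spectra f)"

definition sym_quantum_functional :: "('k::finite, 'd::finite) tensor \<Rightarrow> real" where
  "sym_quantum_functional f = 2 powr log_sym_quantum_functional f"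

end

theory Submission imports Defs begin

text \<open>
  The proof rests on a duality. Call \<open>(B, q, w)\<close> feasible for \<open>f\<close> if \<open>B\<close> is invertible, \<open>q\<close> is a
  probability vector and \<open>\<Prod>\<^sub>j q (\<iota> j) \<ge> w > 0\<close> on the support of \<open>B f\<close>. Then \<open>E(f)\<close> is the
  minimum of \<open>- log w / k\<close> over all feasible triples, that is, Strassen's upper support functional
  in its dual form. Sums and products of optimal vectors bound \<open>F\<close> from below, sums and products
  of optimal feasible triples bound it from above, and the bounds agree. For monotonicity, \<open>A g \<oplus> 0\<close> is
  a degeneration of \<open>0 \<oplus> g\<close>, for which a feasible triple of \<open>g\<close> is still feasible.

  Weak duality: for \<open>s\<close> in the orbit closure, Gram--Schmidt along the order given by \<open>q\<close> rotates \<open>s\<close>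
  by a unitary to a tensor supported where \<open>\<Prod>\<^sub>j q (\<iota> j) \<ge> w\<close>; Gibbs' inequality against \<open>q\<close> then
  bounds the entropy by \<open>- log w / k\<close>.

  Strong duality: take \<open>(B, q, w)\<close> with \<open>w\<close> maximal, and let \<open>t\<close> be the part of \<open>B f\<close> on
  \<open>\<Prod>\<^sub>j q (\<iota> j) = w\<close>, which is a limit of points of the orbit. Maximality of \<open>w\<close> makes \<open>t\<close>
  semistable, for the character determined by \<open>q\<close>, under the group of matrices that are
  block-diagonal with respect to the level sets of \<open>q\<close>. A vector of minimal norm in its orbit closure has
  marginal \<open>diag q\<close> by the Kempf--Ness argument, and its entropy is exactly \<open>- log w / k\<close>.
\<close>

subsection \<open>Linear maps acting on tensors and marginals\<close>

text \<open>The pair (q, w) comes from minimax. For a fixed support, the largest entropy of the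
  average marginal of a distribution on it equals the minimum over q of the worst cross entropy, the
  maximum over \<iota> of - (1/k) \<Sum>_j log q(\<iota> j). Writing w for the smallest product on
  the support turns this into - log w / k. The obstacle is that the group is not compact, so group
  elements along a sequence may diverge. Limits are therefore always taken of unitaries, of
  normalised tensors, or of (q, w) with the support fixed. On the slice where the product equals w,
  marginals are automatically block-diagonal for the levels of q. Hence a first-order condition
  along the block-diagonal group, usually much smaller than GL(d), already fixes the whole marginal.
  That there are two factors or more is what keeps the blocks of a direct sum, and the basis vectors
  of a unit tensor, from interfering in the marginals. Symmetry is used for products: the average of
  products of marginals is the product of the averages once the marginals of each tensor
  coincide.\<close>

lemma prod_sum_fun:
  fixes h :: "'k::finite \<Rightarrow> 'd::finite \<Rightarrow> 'a::comm_semiring_1"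
  shows "(\<Prod>j\<in>UNIV. \<Sum>m\<in>UNIV. h j m) = (\<Sum>\<kappa>\<in>UNIV. \<Prod>j\<in>UNIV. h j (\<kappa> j))"
  using prod_sum_PiE[of UNIV "\<lambda>_. UNIV" h] by simp

text \<open>A separate matrix for each factor, so that an operator on the single factor
  \<open>j\<close> belongs to the same calculus. This is how marginals become inner
  products.\<close>

definition local_map ::
    "('k \<Rightarrow> complex ^ 'e ^ 'd) \<Rightarrow> ('k::finite, 'e::finite) tensor \<Rightarrow> ('k, 'd::finite) tensor" where
  "local_map A f = (\<chi> \<iota>. \<Sum>\<kappa>\<in>UNIV. (\<Prod>j\<in>UNIV. A j $ \<iota> j $ \<kappa> j) * f $ \<kappa>)"

lemma tensor_power_map_local: "tensor_power_map A = local_map (\<lambda>_. A)"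
  by (simp add: fun_eq_iff tensor_power_map_def local_map_def)

lemma local_map_compose: "local_map A (local_map B f) = local_map (\<lambda>j. A j ** B j) f"
proof -
  have "(\<Sum>\<kappa>\<in>UNIV. (\<Prod>j\<in>UNIV. A j $ \<iota> j $ \<kappa> j) * (\<Sum>\<mu>\<in>UNIV. (\<Prod>j\<in>UNIV. B j $ \<kappa> j $ \<mu> j) * f $ \<mu>))
      = (\<Sum>\<mu>\<in>UNIV. (\<Prod>j\<in>UNIV. (A j ** B j) $ \<iota> j $ \<mu> j) * f $ \<mu>)" for \<iota>
  proof -
    have "(\<Sum>\<mu>\<in>UNIV. (\<Prod>j\<in>UNIV. (A j ** B j) $ \<iota> j $ \<mu> j) * f $ \<mu>)
        = (\<Sum>\<mu>\<in>UNIV. \<Sum>\<kappa>\<in>UNIV. (\<Prod>j\<in>UNIV. A j $ \<iota> j $ \<kappa> j) * ((\<Prod>j\<in>UNIV. B j $ \<kappa> j $ \<mu> j) * f $ \<mu>))"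
      unfolding matrix_matrix_mult_def
      by (simp add: prod_sum_fun prod.distrib sum_distrib_right mult.assoc)
    also have "\<dots> = (\<Sum>\<kappa>\<in>UNIV. \<Sum>\<mu>\<in>UNIV. (\<Prod>j\<in>UNIV. A j $ \<iota> j $ \<kappa> j) * ((\<Prod>j\<in>UNIV. B j $ \<kappa> j $ \<mu> j) * f $ \<mu>))"
      by (rule sum.swap)
    finally show ?thesis by (simp add: sum_distrib_left)
  qed
  then show ?thesis by (simp add: local_map_def)
qed

lemma tensor_power_map_compose:
  "tensor_power_map A (tensor_power_map B f) = tensor_power_map (A ** B) f"
  by (simp add: tensor_power_map_local local_map_compose)

abbreviation diag_mat :: "('d \<Rightarrow> complex) \<Rightarrow> complex ^ 'd ^ 'd" where
  "diag_mat l \<equiv> (\<chi> a b. if a = b then l a else 0)"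

lemma tensor_power_map_diag:
  "tensor_power_map (diag_mat l) f = (\<chi> \<iota>. (\<Prod>j\<in>UNIV. l (\<iota> j)) * f $ \<iota>)"
proof -
  have "(\<Prod>j\<in>UNIV. if \<iota> j = \<kappa> j then l (\<iota> j) else 0) * f $ \<kappa>
      = (if \<kappa> = \<iota> then (\<Prod>j\<in>UNIV. l (\<iota> j)) * f $ \<iota> else 0)" for \<iota> \<kappa>
  proof (cases "\<kappa> = \<iota>")
    case False
    then obtain j where "\<iota> j \<noteq> \<kappa> j" by (metis ext)
    then have "(\<Prod>j\<in>UNIV. if \<iota> j = \<kappa> j then l (\<iota> j) else 0) = 0"
      by (intro prod_zero) auto
    with False show ?thesis by simp
  qed simp
  then show ?thesis by (simp add: tensor_power_map_def vec_eq_iff)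
qed

lemma tensor_power_map_one [simp]: "tensor_power_map (mat 1) f = f"
  for f :: "('k::finite, 'd::finite) tensor"
proof -
  have "(mat 1 :: complex ^ 'd ^ 'd) = (\<chi> a b. if a = b then (\<lambda>_. 1) a else (0::complex))"
    by (simp add: mat_def)
  then show ?thesis by (simp only: tensor_power_map_diag) (simp add: vec_eq_iff)
qed

lemma tensor_power_map_zero [simp]: "tensor_power_map A 0 = 0"
  by (simp add: tensor_power_map_def vec_eq_iff)

lemma tensor_power_map_scaleC:
  "tensor_power_map A (\<chi> \<iota>. c * f $ \<iota>) = (\<chi> \<iota>. c * tensor_power_map A f $ \<iota>)"
  by (simp add: tensor_power_map_def vec_eq_iff sum_distrib_left mult_ac)

lemma tendsto_tensor_power_map:
  assumes "(A \<longlongrightarrow> A0) F" "(f \<longlongrightarrow> f0) F"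
  shows "((\<lambda>x. tensor_power_map (A x) (f x)) \<longlongrightarrow> tensor_power_map A0 f0) F"
  unfolding tensor_power_map_def
  by (intro tendsto_vec_lambda tendsto_sum tendsto_mult tendsto_prod tendsto_vec_nth assms)

lemma continuous_on_tensor_power_map:
  "continuous_on S (\<lambda>f. tensor_power_map A f)"
  unfolding continuous_on_def by (intro ballI tendsto_tensor_power_map tendsto_intros)

section \<open>Adjoints, the Hermitian inner product and unitary matrices\<close>

definition cadj :: "complex ^ 'n ^ 'm \<Rightarrow> complex ^ 'm ^ 'n" where
  "cadj A = (\<chi> i j. cnj (A $ j $ i))"

lemma cadj_nth [simp]: "cadj A $ i $ j = cnj (A $ j $ i)"
  by (simp add: cadj_def)

lemma cadj_cadj [simp]: "cadj (cadj A) = A"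
  by (simp add: vec_eq_iff)

lemma cadj_mult: "cadj (A ** B) = cadj B ** cadj A"
  by (simp add: vec_eq_iff matrix_matrix_mult_def mult.commute)

lemma cadj_mat_1 [simp]: "cadj (mat 1) = mat 1"
  by (simp add: vec_eq_iff mat_def)

definition cinner :: "complex ^ 'n \<Rightarrow> complex ^ 'n \<Rightarrow> complex" where
  "cinner f g = (\<Sum>i\<in>UNIV. f $ i * cnj (g $ i))"

lemma norm_vec_sq: "(norm (v :: complex ^ 'n))\<^sup>2 = (\<Sum>i\<in>UNIV. (cmod (v $ i))\<^sup>2)"
  by (simp add: norm_vec_def L2_set_def sum_nonneg)

lemma cinner_self: "cinner f f = of_real ((norm f)\<^sup>2)"
  by (simp add: cinner_def norm_vec_sq flip: complex_norm_square)

lemma cinner_local_map: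
  "cinner (local_map A f) g = cinner f (local_map (\<lambda>j. cadj (A j)) g)"
proof -
  have "cinner (local_map A f) g
      = (\<Sum>\<iota>\<in>UNIV. \<Sum>\<kappa>\<in>UNIV. (\<Prod>j\<in>UNIV. A j $ \<iota> j $ \<kappa> j) * f $ \<kappa> * cnj (g $ \<iota>))"
    by (simp add: cinner_def local_map_def sum_distrib_right)
  also have "\<dots> = (\<Sum>\<kappa>\<in>UNIV. \<Sum>\<iota>\<in>UNIV. (\<Prod>j\<in>UNIV. A j $ \<iota> j $ \<kappa> j) * f $ \<kappa> * cnj (g $ \<iota>))"
    by (rule sum.swap)
  also have "\<dots> = cinner f (local_map (\<lambda>j. cadj (A j)) g)"
    by (simp add: cinner_def local_map_def sum_distrib_left mult_ac)
  finally show ?thesis .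
qed

definition unitary :: "complex ^ 'n ^ 'n \<Rightarrow> bool" where
  "unitary U \<longleftrightarrow> cadj U ** U = mat 1"

lemma unitaryD:
  fixes U :: "complex ^ 'n ^ 'n"
  assumes "unitary U"
  shows "cadj U ** U = mat 1" "U ** cadj U = mat 1"
  using assms matrix_left_right_inverse[of U "cadj U"] by (auto simp: unitary_def)

lemma unitary_cadj: "unitary U \<Longrightarrow> unitary (cadj U)"
  using unitaryD[of U] by (simp add: unitary_def)

lemma unitary_mult: "unitary U \<Longrightarrow> unitary V \<Longrightarrow> unitary (U ** V)"
  by (metis unitary_def cadj_mult matrix_mul_assoc matrix_mul_lid)

lemma unitary_one: "unitary (mat 1)"
  by (simp add: unitary_def)

lemma unitary_invertible: "unitary U \<Longrightarrow> invertible U"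
  using unitaryD invertible_def by blast

lemma norm_tensor_power_map_unitary:
  assumes "unitary U"
  shows "norm (tensor_power_map U f) = norm f"
proof -
  have "cinner (tensor_power_map U f) (tensor_power_map U f)
      = cinner f (tensor_power_map (cadj U) (tensor_power_map U f))"
    by (simp add: tensor_power_map_local cinner_local_map)
  also have "\<dots> = cinner f f"
    by (simp add: tensor_power_map_compose unitaryD[OF assms])
  finally have "cinner (tensor_power_map U f) (tensor_power_map U f) = cinner f f" .
  then have "(norm (tensor_power_map U f))\<^sup>2 = (norm f)\<^sup>2"
    unfolding cinner_self of_real_eq_iff .
  then show ?thesis by simp
qed

section \<open>Marginals as inner products\<close>

definition site :: "'k \<Rightarrow> complex ^ 'd ^ 'd \<Rightarrow> 'k \<Rightarrow> complex ^ 'd ^ 'd" where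
  "site j X = (\<lambda>i. if i = j then X else mat 1)"

text \<open>All factors except \<open>j\<close> carry Kronecker deltas, so only the multi-indices
  that agree with \<iota> away from \<open>j\<close> contribute.\<close>

lemma local_map_site:
  "local_map (site j X) s $ \<iota> = (\<Sum>b\<in>UNIV. X $ \<iota> j $ b * s $ (\<iota>(j := b)))"
proof -
  let ?P = "\<lambda>\<kappa>. (\<Prod>i\<in>UNIV. site j X i $ \<iota> i $ \<kappa> i)"
  have inj: "inj (\<lambda>b. \<iota>(j := b))"
    by (rule injI) (metis fun_upd_same)
  have 0: "?P \<kappa> = 0" if "\<kappa> \<notin> range (\<lambda>b. \<iota>(j := b))" for \<kappa>
  proof -
    have "\<kappa> \<noteq> \<iota>(j := \<kappa> j)" using that by blast
    then obtain i where "\<kappa> i \<noteq> (\<iota>(j := \<kappa> j)) i" by blast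
    then have "site j X i $ \<iota> i $ \<kappa> i = 0"
      by (cases "i = j") (auto simp: site_def mat_def)
    then show ?thesis by (intro prod_zero) auto
  qed
  have 1: "?P (\<iota>(j := b)) = X $ \<iota> j $ b" for b
    by (subst prod.remove[of _ j]) (auto simp: site_def mat_def)
  have "(\<Sum>\<kappa>\<in>UNIV. ?P \<kappa> * s $ \<kappa>) = (\<Sum>\<kappa>\<in>range (\<lambda>b. \<iota>(j := b)). ?P \<kappa> * s $ \<kappa>)"
    by (rule sum.mono_neutral_right) (auto simp: 0)
  also have "\<dots> = (\<Sum>b\<in>UNIV. X $ \<iota> j $ b * s $ (\<iota>(j := b)))"
    by (simp add: sum.reindex[OF inj] 1 del: fun_upd_apply)
  finally show ?thesis by (simp add: local_map_def)
qed

lemma marginal_nth: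
  "marginal j s $ a $ b = (\<Sum>\<iota> | \<iota> j = a. s $ \<iota> * cnj (s $ (\<iota>(j := b)))) / of_real ((norm s)\<^sup>2)"
  by (simp add: marginal_def partial_trace_except_def density_def sum_divide_distrib)

lemma cnj_marginal: "cnj (marginal j s $ a $ b) = marginal j s $ b $ a"
proof -
  have "(\<Sum>\<iota> | \<iota> j = a. cnj (s $ \<iota>) * s $ (\<iota>(j := b)))
      = (\<Sum>\<iota> | \<iota> j = b. s $ \<iota> * cnj (s $ (\<iota>(j := a))))"
    by (rule sum.reindex_bij_witness[where i = "\<lambda>\<iota>. \<iota>(j := a)" and j = "\<lambda>\<iota>. \<iota>(j := b)"]) auto
  then show ?thesis by (simp add: marginal_nth)
qed

text \<open>The duality that characterises the partial trace: X on factor \<open>j\<close> has the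
  same expectation in the full state as in its marginal. The sum on the right is the trace of X
  times the marginal.\<close>

lemma cinner_site:
  "cinner (local_map (site j X) s) s
    = (\<Sum>a\<in>UNIV. \<Sum>b\<in>UNIV. X $ a $ b * marginal j s $ b $ a) * of_real ((norm s)\<^sup>2)"
proof (cases "s = 0")
  case True
  then show ?thesis by (simp add: cinner_def)
next
  case False
  then have n: "of_real ((norm s)\<^sup>2) \<noteq> (0::complex)" by simp
  have m: "marginal j s $ b $ a * of_real ((norm s)\<^sup>2)
      = (\<Sum>\<iota> | \<iota> j = a. s $ (\<iota>(j := b)) * cnj (s $ \<iota>))" for a b
  proof -
    have "marginal j s $ b $ a = cnj (marginal j s $ a $ b)" by (simp add: cnj_marginal)
    then show ?thesis using False by (simp add: marginal_nth mult.commute)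
  qed
  have "cinner (local_map (site j X) s) s
      = (\<Sum>\<iota>\<in>UNIV. \<Sum>b\<in>UNIV. X $ \<iota> j $ b * (s $ (\<iota>(j := b)) * cnj (s $ \<iota>)))"
    by (simp add: cinner_def local_map_site sum_distrib_left sum_distrib_right mult_ac)
  also have "\<dots> = (\<Sum>a\<in>UNIV. \<Sum>\<iota> | \<iota> j = a. \<Sum>b\<in>UNIV. X $ \<iota> j $ b * (s $ (\<iota>(j := b)) * cnj (s $ \<iota>)))"
    using sum.group[of UNIV UNIV "\<lambda>\<iota>. \<iota> j"
        "\<lambda>\<iota>. \<Sum>b\<in>UNIV. X $ \<iota> j $ b * (s $ (\<iota>(j := b)) * cnj (s $ \<iota>))"] by simp
  also have "\<dots> = (\<Sum>a\<in>UNIV. \<Sum>\<iota> | \<iota> j = a. \<Sum>b\<in>UNIV. X $ a $ b * (s $ (\<iota>(j := b)) * cnj (s $ \<iota>)))"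
    by (intro sum.cong refl) auto
  also have "\<dots> = (\<Sum>a\<in>UNIV. \<Sum>b\<in>UNIV. \<Sum>\<iota> | \<iota> j = a. X $ a $ b * (s $ (\<iota>(j := b)) * cnj (s $ \<iota>)))"
    by (intro sum.cong refl sum.swap)
  also have "\<dots> = (\<Sum>a\<in>UNIV. \<Sum>b\<in>UNIV. X $ a $ b * (marginal j s $ b $ a * of_real ((norm s)\<^sup>2)))"
    unfolding m by (simp add: sum_distrib_left)
  finally show ?thesis by (simp add: sum_distrib_right mult.assoc)
qed

text \<open>The preceding duality, tested on the matrix unit at (a, b), reads off a single
  entry.\<close>

lemma marginal_cinner:
  assumes "s \<noteq> 0"
  shows "marginal j s $ b $ a
    = cinner (local_map (site j (\<chi> c d. if c = a \<and> d = b then 1 else 0)) s) s / of_real ((norm s)\<^sup>2)"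
proof -
  have "(\<Sum>c\<in>UNIV. \<Sum>d\<in>UNIV. (if c = a \<and> d = b then 1 else 0) * marginal j s $ d $ c)
      = (\<Sum>c\<in>UNIV. if c = a then (\<Sum>d\<in>UNIV. if d = b then marginal j s $ d $ c else 0) else 0)"
    by (intro sum.cong refl) (simp add: mult_if_delta)
  also have "\<dots> = marginal j s $ b $ a" by simp
  finally show ?thesis using assms by (simp add: cinner_site)
qed

text \<open>Moving U to the other side of the inner product cancels it against its adjoint in every
  factor except \<open>j\<close>, where X is replaced by its conjugate.\<close>

lemma marginal_unitary:
  fixes s :: "('k::finite, 'd::finite) tensor"
  assumes U: "unitary U"
  shows "marginal j (tensor_power_map U s) = U ** marginal j s ** cadj U"
proof (cases "s = 0")
  case True
  have "marginal j 0 = (0 :: complex ^ 'd ^ 'd)" for j :: 'k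
    by (simp add: vec_eq_iff marginal_nth)
  then show ?thesis unfolding True tensor_power_map_zero
    by (simp add: matrix_matrix_mult_def vec_eq_iff)
next
  case False
  let ?t = "tensor_power_map U s"
  have n: "norm ?t = norm s" by (rule norm_tensor_power_map_unitary[OF U])
  then have t: "?t \<noteq> 0" using False by (metis norm_eq_zero)
  have "marginal j ?t $ b $ a = (U ** marginal j s ** cadj U) $ b $ a" for a b
  proof -
    define E :: "complex ^ 'd ^ 'd" where "E = (\<chi> c d. if c = a \<and> d = b then 1 else 0)"
    have e: "(\<lambda>i. cadj U ** (site j E i ** U)) = site j (cadj U ** (E ** U))"
      using unitaryD[OF U] by (auto simp: site_def fun_eq_iff)
    have adj: "cinner x (local_map (\<lambda>j. U) y) = cinner (local_map (\<lambda>j. cadj U) x) y" for x y :: "('k, 'd) tensor"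
      by (simp add: cinner_local_map)
    have c: "cinner (local_map (site j E) ?t) ?t = cinner (local_map (site j (cadj U ** (E ** U))) s) s"
      by (simp add: tensor_power_map_local adj local_map_compose e)
    have "marginal j ?t $ b $ a = cinner (local_map (site j E) ?t) ?t / of_real ((norm ?t)\<^sup>2)"
      unfolding E_def by (rule marginal_cinner[OF t])
    also have "\<dots> = (\<Sum>c\<in>UNIV. \<Sum>d\<in>UNIV. (cadj U ** (E ** U)) $ c $ d * marginal j s $ d $ c)"
      unfolding c n using False by (simp add: cinner_site)
    also have "\<dots> = (\<Sum>c\<in>UNIV. \<Sum>d\<in>UNIV. cnj (U $ a $ c) * U $ b $ d * marginal j s $ d $ c)"
    proof -
      have "(E ** U) $ c $ d = (if c = a then U $ b $ d else 0)" for c d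
      proof -
        have "(E ** U) $ c $ d = (\<Sum>m\<in>UNIV. if m = b then (if c = a then U $ b $ d else 0) else 0)"
          by (simp add: E_def matrix_matrix_mult_def mult_if_delta)
        then show ?thesis by simp
      qed
      then have "(cadj U ** (E ** U)) $ c $ d = cnj (U $ a $ c) * U $ b $ d" for c d
        by (simp add: matrix_matrix_mult_def[of "cadj U"] if_distrib[of "\<lambda>x. _ * x"] cong: if_cong)
      then show ?thesis by simp
    qed
    also have "\<dots> = (U ** marginal j s ** cadj U) $ b $ a"
      by (simp add: matrix_matrix_mult_def sum_distrib_right sum_distrib_left mult_ac)
    finally show ?thesis .
  qed
  then show ?thesis by (simp add: vec_eq_iff)
qed

lemma average_marginal_nth:
  "average_marginal s $ a $ b = (\<Sum>j\<in>UNIV. marginal j s $ a $ b) / of_nat CARD('k)"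
  for s :: "('k::finite, 'd::finite) tensor"
  unfolding average_marginal_def vector_scaleR_component sum_component
  by (simp add: scaleR_conv_of_real divide_inverse mult.commute)

lemma average_marginal_unitary:
  fixes s :: "('k::finite, 'd::finite) tensor"
  assumes "unitary U"
  shows "average_marginal (tensor_power_map U s) = U ** average_marginal s ** cadj U"
proof -
  have "(\<Sum>j\<in>UNIV. (U ** marginal j s ** cadj U) $ a $ b) / of_nat CARD('k)
      = (U ** average_marginal s ** cadj U) $ a $ b" for a b
  proof -
    have "(U ** average_marginal s ** cadj U) $ a $ b
       = (\<Sum>c\<in>UNIV. \<Sum>d\<in>UNIV. \<Sum>j\<in>UNIV. U $ a $ d * marginal j s $ d $ c * cnj (U $ b $ c) / of_nat CARD('k))"
      by (simp add: matrix_matrix_mult_def average_marginal_nth sum_distrib_left sum_distrib_right sum_divide_distrib)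
    also have "\<dots> = (\<Sum>c\<in>UNIV. \<Sum>j\<in>UNIV. \<Sum>d\<in>UNIV. U $ a $ d * marginal j s $ d $ c * cnj (U $ b $ c) / of_nat CARD('k))"
      by (intro sum.cong refl sum.swap)
    also have "\<dots> = (\<Sum>j\<in>UNIV. \<Sum>c\<in>UNIV. \<Sum>d\<in>UNIV. U $ a $ d * marginal j s $ d $ c * cnj (U $ b $ c) / of_nat CARD('k))"
      by (rule sum.swap)
    finally show ?thesis
      by (simp add: matrix_matrix_mult_def sum_distrib_left sum_distrib_right sum_divide_distrib)
  qed
  then show ?thesis
    unfolding vec_eq_iff average_marginal_nth[of "tensor_power_map U s"] marginal_unitary[OF assms]
    by blast
qed

lemma cnj_average_marginal: "cnj (average_marginal s $ a $ b) = average_marginal s $ b $ a"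
  by (simp add: average_marginal_nth cnj_marginal)

text \<open>The diagonal of the average marginal is the average marginal of the distribution
  \<open>\<bar>s \<iota>\<bar>\<^sup>2 / \<parallel>s\<parallel>\<^sup>2\<close> on multi-indices.\<close>

definition diag_weight :: "('k::finite, 'd::finite) tensor \<Rightarrow> 'd \<Rightarrow> real" where
  "diag_weight s a = (\<Sum>\<iota>\<in>UNIV. (cmod (s $ \<iota>))\<^sup>2 * real (card {j. \<iota> j = a})) / (real CARD('k) * (norm s)\<^sup>2)"

lemma average_marginal_diag: "average_marginal s $ a $ a = of_real (diag_weight s a)"
  for s :: "('k::finite, 'd::finite) tensor"
proof -
  have "(\<Sum>j\<in>UNIV. \<Sum>\<iota> | \<iota> j = a. s $ \<iota> * cnj (s $ (\<iota>(j := a))))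
      = (\<Sum>j\<in>UNIV. \<Sum>\<iota>\<in>UNIV. if \<iota> j = a then of_real ((cmod (s $ \<iota>))\<^sup>2) else 0)"
    by (rule sum.cong) (auto simp: sum.If_cases fun_upd_idem_iff complex_norm_square simp del: of_real_power intro!: sum.cong)
  also have "\<dots> = (\<Sum>\<iota>\<in>UNIV. \<Sum>j\<in>UNIV. if \<iota> j = a then of_real ((cmod (s $ \<iota>))\<^sup>2) else 0)"
    by (rule sum.swap)
  also have "\<dots> = (\<Sum>\<iota>\<in>UNIV. of_real ((cmod (s $ \<iota>))\<^sup>2 * real (card {j. \<iota> j = a})))"
    by (rule sum.cong) (auto simp: sum.If_cases)
  finally show ?thesis
    by (simp add: average_marginal_nth marginal_nth diag_weight_def flip: sum_divide_distrib)
qed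

lemma sum_card_fibres:
  fixes \<iota> :: "'k::finite \<Rightarrow> 'd::finite" and y :: "'d \<Rightarrow> real"
  shows "(\<Sum>a\<in>UNIV. real (card {j. \<iota> j = a}) * y a) = (\<Sum>j\<in>UNIV. y (\<iota> j))"
proof -
  have "(\<Sum>j\<in>UNIV. y (\<iota> j)) = (\<Sum>a\<in>UNIV. \<Sum>j | \<iota> j = a. y (\<iota> j))"
    using sum.group[of UNIV UNIV \<iota> "\<lambda>j. y (\<iota> j)"] by simp
  also have "\<dots> = (\<Sum>a\<in>UNIV. real (card {j. \<iota> j = a}) * y a)"
    by (intro sum.cong) auto
  finally show ?thesis by simp
qed

text \<open>An expectation under the average marginal is pulled back to multi-indices. With y = log
  q this links cross entropies to the products of q over a multi-index.\<close>

lemma sum_diag_weight: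
  fixes s :: "('k::finite, 'd::finite) tensor" and y :: "'d \<Rightarrow> real"
  shows "(\<Sum>a\<in>UNIV. diag_weight s a * y a)
    = (\<Sum>\<iota>\<in>UNIV. (cmod (s $ \<iota>))\<^sup>2 * (\<Sum>j\<in>UNIV. y (\<iota> j))) / (real CARD('k) * (norm s)\<^sup>2)"
proof -
  have "(\<Sum>a\<in>UNIV. diag_weight s a * y a)
      = (\<Sum>a\<in>UNIV. \<Sum>\<iota>\<in>UNIV. (cmod (s $ \<iota>))\<^sup>2 * (real (card {j. \<iota> j = a}) * y a) / (real CARD('k) * (norm s)\<^sup>2))"
    by (simp add: diag_weight_def sum_distrib_left sum_divide_distrib mult_ac)
  also have "\<dots> = (\<Sum>\<iota>\<in>UNIV. \<Sum>a\<in>UNIV. (cmod (s $ \<iota>))\<^sup>2 * (real (card {j. \<iota> j = a}) * y a) / (real CARD('k) * (norm s)\<^sup>2))"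
    by (rule sum.swap)
  finally show ?thesis
    by (simp add: sum_card_fibres[symmetric] sum_distrib_left sum_divide_distrib)
qed

lemma diag_weight_nonneg: "diag_weight s a \<ge> 0"
  by (simp add: diag_weight_def sum_nonneg)

lemma sum_diag_weight_one: "s \<noteq> 0 \<Longrightarrow> (\<Sum>a\<in>UNIV. diag_weight s a) = 1"
  using sum_diag_weight[of s "\<lambda>_. 1"] by (simp add: norm_vec_sq[of s, symmetric] flip: sum_distrib_right)

subsection \<open>Unitary, block-diagonal and triangular matrices\<close>

text \<open>The values of \<open>q\<close> serve as labels of the blocks. For constant
  \<open>q\<close> the condition is empty, so the unrestricted statements are the special case
  \<open>\<lambda>_. 0\<close>.\<close>

definition level_block :: "('d \<Rightarrow> real) \<Rightarrow> complex ^ 'd ^ 'd \<Rightarrow> bool" where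
  "level_block q A \<longleftrightarrow> (\<forall>a b. A $ a $ b \<noteq> 0 \<longrightarrow> q a = q b)"

lemma level_blockD: "level_block q A \<Longrightarrow> q a \<noteq> q b \<Longrightarrow> A $ a $ b = 0"
  by (auto simp: level_block_def)

lemma level_block_mult: "level_block q A \<Longrightarrow> level_block q B \<Longrightarrow> level_block q (A ** B)"
  unfolding level_block_def matrix_matrix_mult_def
  by (auto elim!: sum.not_neutral_contains_not_neutral)

lemma level_block_cadj: "level_block q A \<Longrightarrow> level_block q (cadj A)"
  unfolding level_block_def cadj_nth complex_cnj_zero_iff by metis

lemma level_block_one: "level_block q (mat 1)"
  by (simp add: level_block_def mat_def)

lemma level_block_diag: "level_block q (diag_mat l)"
  by (simp add: level_block_def)

lemma closed_unitary: "closed {U :: complex ^ 'd ^ 'd. unitary U \<and> level_block q U}"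
proof -
  have "{U :: complex ^ 'd ^ 'd. unitary U \<and> level_block q U}
      = {U. cadj U ** U = mat 1} \<inter> (\<Inter>a. \<Inter>b. {U. (if q a = q b then 0 else U $ a $ b) = 0})"
    by (auto simp: unitary_def level_block_def)
  moreover have "closed {U :: complex ^ 'd ^ 'd. cadj U ** U = mat 1}"
    unfolding cadj_def matrix_matrix_mult_def
    by (intro closed_Collect_eq continuous_intros)
  moreover have "closed {U :: complex ^ 'd ^ 'd. (if q a = q b then 0 else U $ a $ b) = 0}" for a b
    by (cases "q a = q b") (auto intro!: closed_Collect_eq continuous_intros)
  ultimately show ?thesis by (simp only:) (intro closed_Int closed_INT ballI)
qed

lemma unitary_row_norm:
  assumes "unitary U"
  shows "norm (U $ i) = 1"
proof -
  have "(U ** cadj U) $ i $ i = 1"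
    by (simp add: unitaryD[OF assms] mat_def)
  moreover have "(U ** cadj U) $ i $ i = cinner (U $ i) (U $ i)"
    by (simp add: matrix_matrix_mult_def cinner_def)
  ultimately have "(norm (U $ i))\<^sup>2 = 1"
    by (metis cinner_self of_real_eq_1_iff)
  then show ?thesis using norm_ge_zero[of "U $ i"] by (simp add: power2_eq_1_iff)
qed

lemma compact_unitary: "compact {U :: complex ^ 'd ^ 'd. unitary U \<and> level_block q U}"
proof -
  have "norm U \<le> real CARD('d)" if "unitary U" for U :: "complex ^ 'd ^ 'd"
  proof -
    have "norm U \<le> (\<Sum>i\<in>UNIV. norm (U $ i))"
      by (simp add: norm_vec_def[of U] L2_set_le_sum)
    with unitary_row_norm[OF that] show ?thesis by simp
  qed
  then have "bounded {U :: complex ^ 'd ^ 'd. unitary U \<and> level_block q U}"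
    unfolding bounded_iff by blast
  with closed_unitary show ?thesis by (simp add: compact_eq_bounded_closed)
qed

lemma sum_two_point:
  fixes X :: "'d::finite \<Rightarrow> complex"
  assumes "a \<noteq> b"
  shows "(\<Sum>m\<in>UNIV. (if m = a then c else if m = b then d else 0) * X m) = c * X a + d * X b"
proof -
  have "(\<Sum>m\<in>UNIV. (if m = a then c else if m = b then d else 0) * X m)
      = (\<Sum>m\<in>UNIV. (if m = a then c * X m else 0) + (if m = b then d * X m else 0))"
    using assms by (intro sum.cong) auto
  then show ?thesis by (simp add: sum.distrib)
qed

text \<open>Jacobi's argument: a unitary conjugation maximising the sum of squares of the diagonal
  annihilates the off-diagonal part, for otherwise a rotation in the plane of two coordinates
  improves it.\<close>

lemma hermitian_diagonalisable:
  fixes M :: "complex ^ 'd ^ 'd"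
  assumes herm: "cadj M = M" and blk: "level_block q M"
  obtains U where "unitary U" "level_block q U"
    "\<And>a b. a \<noteq> b \<Longrightarrow> (U ** M ** cadj U) $ a $ b = 0"
proof -
  let ?K = "{U :: complex ^ 'd ^ 'd. unitary U \<and> level_block q U}"
  let ?\<phi> = "\<lambda>U. \<Sum>a\<in>UNIV. (Re ((U ** M ** cadj U) $ a $ a))\<^sup>2"
  have "continuous_on ?K ?\<phi>"
    unfolding cadj_def matrix_matrix_mult_def by (intro continuous_intros)
  moreover have "mat 1 \<in> ?K" by (simp add: unitary_one level_block_one)
  ultimately obtain U where U: "unitary U" "level_block q U"
    and max: "\<And>V. unitary V \<Longrightarrow> level_block q V \<Longrightarrow> ?\<phi> V \<le> ?\<phi> U"
    using continuous_attains_sup[OF compact_unitary, of q ?\<phi>] by blast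
  define N where "N = U ** M ** cadj U"
  have Nh: "cadj N = N" by (simp add: N_def cadj_mult herm matrix_mul_assoc)
  then have Nc: "cnj (N $ a $ b) = N $ b $ a" for a b
    by (metis cadj_nth)
  then have Nd: "N $ a $ a = of_real (Re (N $ a $ a))" for a
    by (metis complex_is_Real_iff Reals_cnj_iff of_real_Re)
  have Nb: "level_block q N"
    unfolding N_def by (intro level_block_mult level_block_cadj U blk)
  have False if ab: "a \<noteq> b" and nz: "N $ a $ b \<noteq> 0" and ge: "Re (N $ a $ a) \<ge> Re (N $ b $ b)" for a b
  proof -
    define x y z r where "x = Re (N $ a $ a)" "y = Re (N $ b $ b)" "z = N $ a $ b" "r = cmod z"
    note defs = this
    have r: "r > 0" "x \<ge> y" using nz ge by (simp_all add: defs)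
    \<comment> \<open>The rotation need not annihilate the entry; a strict gain is enough. The
      tangent r / (x - y + r) gives \<delta> = s r (x - y + 2 r) / R > 0 without solving the
      quadratic equation for the optimal angle.\<close>
    define R where "R = sqrt ((x - y + r)\<^sup>2 + r\<^sup>2)"
    have R: "R > 0" "R\<^sup>2 = (x - y + r)\<^sup>2 + r\<^sup>2"
      using r by (simp_all add: R_def add_nonneg_pos)
    define c s where "c = (x - y + r) / R" "s = r / R"
    have cs: "c\<^sup>2 + s\<^sup>2 = 1"
      unfolding c_s_def power_divide add_divide_distrib[symmetric] R(2)[symmetric]
      using R(1) by simp
    \<comment> \<open>The phase of the off-diagonal entry, built into the rotation so that the cross
      terms become the real number 2 c s r.\<close>
    define u where "u = z / of_real r"
    have u: "u * cnj u = 1" "z * cnj u = of_real r"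
      using r by (simp_all add: u_def complex_norm_square[symmetric] defs power2_eq_square)
    define G :: "complex ^ 'd ^ 'd" where "G = (\<chi> i m.
        if i = a then (if m = a then of_real c else if m = b then of_real s * u else 0)
        else if i = b then (if m = a then - of_real s * cnj u else if m = b then of_real c else 0)
        else if m = i then 1 else 0)"
    have row: "(\<Sum>m\<in>UNIV. G $ a $ m * X m) = of_real c * X a + of_real s * u * X b"
      "(\<Sum>m\<in>UNIV. G $ b $ m * X m) = - of_real s * cnj u * X a + of_real c * X b"
      "i \<noteq> a \<Longrightarrow> i \<noteq> b \<Longrightarrow> (\<Sum>m\<in>UNIV. G $ i $ m * X m) = X i" for X :: "'d \<Rightarrow> complex" and i
      using ab sum_two_point[OF ab, of _ _ X] by (auto simp: G_def mult_if_delta)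
    have c2: "c\<^sup>2 = 1 - s\<^sup>2" using cs by simp
    have cs': "of_real c * of_real c + of_real s * of_real s = (1::complex)"
      using cs by (metis of_real_1 of_real_add of_real_mult power2_eq_square)
    have G1: "(G ** cadj G) $ i $ j = mat 1 $ i $ j" for i j
    proof -
      have "(G ** cadj G) $ i $ j = (\<Sum>m\<in>UNIV. G $ i $ m * cnj (G $ j $ m))"
        by (simp add: matrix_matrix_mult_def)
      also have "\<dots> = mat 1 $ i $ j"
      proof -
        have us1: "X * u * (X * cnj u) = X * X" for X :: complex
        proof -
          have "X * u * (X * cnj u) = X * X * (u * cnj u)" by (simp only: mult_ac)
          then show ?thesis by (simp add: u(1))
        qed
        have us2: "X * cnj u * (X * u) = X * X" for X :: complex
          using us1[of X] by (simp only: mult_ac)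
        show ?thesis
          using ab cs' by (cases "i = a"; cases "i = b"; cases "j = a"; cases "j = b")
           (auto simp: row us1 us2, auto simp: G_def mat_def us1 us2 add.commute)
      qed
      finally show ?thesis .
    qed
    then have "G ** cadj G = mat 1" by (simp add: vec_eq_iff)
    then have Gu: "unitary G" by (metis cadj_cadj unitary_cadj unitary_def)
    have qab: "q a = q b" using Nb nz by (auto simp: level_block_def)
    have "m = i \<or> i = a \<and> m = b \<or> i = b \<and> m = a" if "G $ i $ m \<noteq> 0" for i m
      using that by (simp add: G_def split: if_splits)
    then have Gb: "level_block q G"
      unfolding level_block_def using qab by metis
    define P where "P = G ** N ** cadj G"
    define \<delta> where "\<delta> = s\<^sup>2 * (y - x) + 2 * c * s * r"
    have P: "P $ i $ j = (\<Sum>m\<in>UNIV. G $ i $ m * cnj (\<Sum>n\<in>UNIV. G $ j $ n * N $ n $ m))" for i j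
    proof -
      have "P = G ** (N ** cadj G)" by (simp add: P_def matrix_mul_assoc)
      then show ?thesis by (simp add: matrix_matrix_mult_def Nc mult.commute)
    qed
    have Nxyz: "N $ a $ a = of_real x" "N $ b $ b = of_real y" "N $ a $ b = z" "N $ b $ a = cnj z"
      using Nd Nc by (auto simp: defs)
    have u': "u * cnj z = of_real r" using u(2) by (metis complex_cnj_cnj complex_cnj_complex_of_real complex_cnj_mult mult.commute)
    have "P $ a $ a = of_real c * of_real c * of_real x + of_real s * of_real s * (u * cnj u) * of_real y
        + of_real c * of_real s * (z * cnj u + u * cnj z)"
      unfolding P row(1) by (simp add: Nxyz algebra_simps)
    also have "\<dots> = of_real (c\<^sup>2 * x + s\<^sup>2 * y + 2 * c * s * r)"
      by (simp add: u u' power2_eq_square algebra_simps)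
    also have "c\<^sup>2 * x + s\<^sup>2 * y + 2 * c * s * r = x + \<delta>"
      unfolding c2 \<delta>_def by (simp add: algebra_simps)
    finally have Pa: "P $ a $ a = of_real (x + \<delta>)" .
    have "P $ b $ b = of_real s * of_real s * (u * cnj u) * of_real x + of_real c * of_real c * of_real y
        - of_real c * of_real s * (z * cnj u + u * cnj z)"
      unfolding P row(2) by (simp add: Nxyz algebra_simps)
    also have "\<dots> = of_real (s\<^sup>2 * x + c\<^sup>2 * y - 2 * c * s * r)"
      by (simp add: u u' power2_eq_square algebra_simps)
    also have "s\<^sup>2 * x + c\<^sup>2 * y - 2 * c * s * r = y - \<delta>"
      unfolding c2 \<delta>_def by (simp add: algebra_simps)
    finally have Pb: "P $ b $ b = of_real (y - \<delta>)" .
    have Pi: "P $ i $ i = N $ i $ i" if "i \<noteq> a" "i \<noteq> b" for i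
      using that Nc by (simp add: P row)
    have "G ** U ** M ** cadj (G ** U) = P"
      by (simp add: P_def N_def cadj_mult matrix_mul_assoc)
    \<comment> \<open>The trace of the two-by-two block is preserved, so its diagonal moves from (x,
      y) to (x + \<delta>, y - \<delta>). Since x \<ge> y and \<delta> > 0, the entries move apart
      and the sum of squares grows.\<close>
    then have "?\<phi> (G ** U) - ?\<phi> U = (\<Sum>i\<in>UNIV. (Re (P $ i $ i))\<^sup>2 - (Re (N $ i $ i))\<^sup>2)"
      by (simp add: sum_subtractf N_def)
    also have "\<dots> = (\<Sum>i\<in>{a, b}. (Re (P $ i $ i))\<^sup>2 - (Re (N $ i $ i))\<^sup>2)"
      by (rule sum.mono_neutral_right) (auto simp: Pi)
    also have "\<dots> = ((x + \<delta>)\<^sup>2 - x\<^sup>2) + ((y - \<delta>)\<^sup>2 - y\<^sup>2)"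
      using ab by (simp add: Pa Pb Nxyz)
    also have "\<dots> = 2 * \<delta> * (x - y + \<delta>)" by (simp add: power2_eq_square algebra_simps)
    also have "\<dots> > 0"
    proof -
      have "\<delta> = s * (2 * c * r - s * (x - y))" by (simp add: \<delta>_def power2_eq_square algebra_simps)
      also have "2 * c * r - s * (x - y) = r * (x - y + 2 * r) / R"
        using R by (simp add: c_s_def field_simps)
      finally have "\<delta> > 0" using r R by (simp add: c_s_def)
      with r show ?thesis by simp
    qed
    finally show False using max[of "G ** U"] Gu Gb U by (simp add: unitary_mult level_block_mult)
  qed
  then have "N $ a $ b = 0" if "a \<noteq> b" for a b
    using that Nc by (metis complex_cnj_zero_iff linear)
  then show ?thesis using U that unfolding N_def by blast
qed

lemma cinner_simps:
  "cinner (x + y) z = cinner x z + cinner y z"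
  "cinner (x - y) z = cinner x z - cinner y z"
  "cinner (c *s x) z = c * cinner x z"
  "cinner z (c *s x) = cnj c * cinner z x"
  "cinner (sum f S) z = (\<Sum>i\<in>S. cinner (f i) z)"
proof -
  show "cinner (sum f S) z = (\<Sum>i\<in>S. cinner (f i) z)"
    by (induction S rule: infinite_finite_induct) (simp_all add: cinner_def algebra_simps sum.distrib)
qed (simp_all add: cinner_def algebra_simps sum.distrib sum_subtractf sum_distrib_left)

lemma cnj_cinner: "cnj (cinner x y) = cinner y x"
  by (simp add: cinner_def mult.commute)

lemma matrix_vector_mult_sum_right: "A *v (\<Sum>i\<in>S. f i) = (\<Sum>i\<in>S. A *v f i)"
  by (induction S rule: infinite_finite_induct) (simp_all add: matrix_vector_right_distrib)

text \<open>Gram--Schmidt for the rows of the inverse: a matrix is a unitary times a matrix that is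
  triangular with respect to the preorder given by \<open>q\<close>.\<close>

lemma unitary_triangular:
  fixes M :: "complex ^ 'd ^ 'd" and q :: "'d \<Rightarrow> real"
  assumes "invertible M"
  obtains U where "unitary U" "\<And>b a. (U ** M) $ b $ a \<noteq> 0 \<Longrightarrow> q a \<le> q b"
proof -
  obtain W where W: "W ** M = mat 1" "M ** W = mat 1" using assms by (auto simp: invertible_def)
  \<comment> \<open>Row b of R W is the transpose of W applied to row b of R. Orthonormal rows of
    the unitary therefore mean orthonormal vectors \<open>V *v r b\<close>.\<close>
  define V where "V = transpose W"
  have inj: "x = 0" if "V *v x = 0" for x
  proof -
    have "transpose M ** V = mat 1"
      by (simp add: V_def W flip: matrix_transpose_mul)
    with that show ?thesis by (metis matrix_vector_mul_assoc matrix_vector_mul_lid matrix_vector_mult_0_right)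
  qed
  have "\<exists>r. (\<forall>b\<in>A. \<forall>b'\<in>A. cinner (V *v r b) (V *v r b') = (if b = b' then 1 else 0)) \<and>
      (\<forall>b\<in>A. \<forall>a. r b $ a \<noteq> 0 \<longrightarrow> a \<in> A \<and> q a \<le> q b)" (is "\<exists>r. ?P r A") for A :: "'d set"
    using finite[of A]
  \<comment> \<open>Indices enter in nondecreasing order of q. The corrections subtracted from a new
    row involve only earlier indices, which is exactly the triangular shape required.\<close>
  proof (induction A rule: finite_ranking_induct[where f = q])
    case (insert x A)
    show ?case
    proof (cases "x \<in> A")
      case True
      with insert show ?thesis by (simp add: insert_absorb)
    next
      case False
      obtain r where r: "?P r A" using insert by blast
      define w where "w = axis x 1 - (\<Sum>b\<in>A. cinner (V *v axis x 1) (V *v r b) *s r b)"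
      have Vw: "V *v w = V *v axis x 1 - (\<Sum>b\<in>A. cinner (V *v axis x 1) (V *v r b) *s (V *v r b))"
        by (simp add: w_def matrix_vector_mult_diff_distrib matrix_vector_mult_sum_right vector_scalar_commute)
      have "w $ x = 1" using r False by (auto simp: w_def axis_def intro!: sum.neutral)
      then have "w \<noteq> 0" by auto
      then have n: "norm (V *v w) \<noteq> 0" using inj by auto
      have orth: "cinner (V *v w) (V *v r b) = 0" if "b \<in> A" for b
      proof -
        have "(\<Sum>b'\<in>A. cinner (V *v axis x 1) (V *v r b') * cinner (V *v r b') (V *v r b))
            = (\<Sum>b'\<in>A. if b' = b then cinner (V *v axis x 1) (V *v r b') else 0)"
          using r that by (intro sum.cong) auto
        then show ?thesis using that insert(1) by (simp add: Vw cinner_simps)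
      qed
      then have orth': "cinner (V *v r b) (V *v w) = 0" if "b \<in> A" for b
        using that by (metis cnj_cinner complex_cnj_zero)
      let ?c = "of_real (1 / norm (V *v w)) :: complex"
      define r' where "r' = r (x := ?c *s w)"
      have self: "cinner (V *v (?c *s w)) (V *v (?c *s w)) = 1"
        unfolding vector_scalar_commute cinner_simps unfolding cinner_self using n
        by (simp add: power2_eq_square)
      have ws: "a \<in> insert x A \<and> q a \<le> q x" if "w $ a \<noteq> 0" for a
      proof (cases "a = x")
        case False
        then have "(\<Sum>b\<in>A. cinner (V *v axis x 1) (V *v r b) * r b $ a) \<noteq> 0"
          using that by (auto simp: w_def axis_def)
        then obtain b where "b \<in> A" "r b $ a \<noteq> 0"
          by (metis (no_types, lifting) mult_zero_right sum.neutral)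
        then have "a \<in> A" using r by blast
        then show ?thesis using insert(2) by auto
      qed simp
      have "?P r' (insert x A)"
        using r False self orth orth' ws
        by (auto simp: r'_def vector_scalar_commute cinner_simps)
      then show ?thesis by blast
    qed
  qed auto
  from this[of UNIV] obtain r where
    r: "\<And>b b'. cinner (V *v r b) (V *v r b') = (if b = b' then 1 else 0)"
      "\<And>b a. r b $ a \<noteq> 0 \<Longrightarrow> q a \<le> q b" by auto
  define R where "R = (\<chi> b. r b)"
  define U where "U = R ** W"
  have row: "U $ b = V *v r b" for b
    by (simp add: vec_eq_iff U_def R_def V_def matrix_matrix_mult_def matrix_vector_mult_def transpose_def mult.commute)
  have "U ** cadj U = mat 1"
    using r(1) by (simp add: vec_eq_iff matrix_matrix_mult_def mat_def row[symmetric] cinner_def)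
  then have "unitary U" by (metis cadj_cadj unitary_cadj unitary_def)
  moreover have "U ** M = R" by (simp add: U_def W flip: matrix_mul_assoc)
  ultimately show ?thesis using r(2) by (intro that[of U]) (auto simp: R_def)
qed

subsection \<open>Entropy of the spectrum\<close>

text \<open>Embedding scalars as constant polynomials is multiplicative and the scalar matrix X is
  central. The conjugation thus extends to X - A, and the two outer determinants multiply to
  one.\<close>

lemma charpoly_similar_diag:
  fixes A :: "complex ^ 'd ^ 'd"
  assumes U: "unitary U" and d: "U ** A ** cadj U = diag_mat l"
  shows "charpoly A = (\<Prod>a\<in>UNIV. [:- l a, 1:])"
proof -
  let ?C = "\<lambda>A :: complex ^ 'd ^ 'd. map_matrix (\<lambda>x. [:x:]) A"
  have C_sum: "[:sum f S:] = (\<Sum>i\<in>S. [:f i:])" for f :: "'d \<Rightarrow> complex" and S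
  proof (induction S rule: infinite_finite_induct)
    case (insert x F)
    have "[:f x + sum f F:] = [:f x:] + [:sum f F:]" by simp
    with insert show ?case by simp
  qed simp_all
  have C_mult: "?C (A ** B) = ?C A ** ?C B" for A B
  proof -
    have "[:\<Sum>k\<in>UNIV. A $ i $ k * B $ k $ j:] = (\<Sum>k\<in>UNIV. [:A $ i $ k:] * [:B $ k $ j:])" for i j
      unfolding C_sum by (simp add: mult.commute)
    then show ?thesis by (simp add: vec_eq_iff matrix_matrix_mult_def)
  qed
  have C_one: "?C (mat 1) = mat 1"
    by (auto simp: vec_eq_iff mat_def pCons_one)
  let ?X = "mat [:0, 1:] :: complex poly ^ 'd ^ 'd"
  have X: "?X ** B = (\<chi> i j. [:0, 1:] * B $ i $ j)" "B ** ?X = (\<chi> i j. [:0, 1:] * B $ i $ j)" for B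
    by (simp_all add: vec_eq_iff matrix_matrix_mult_def mat_def if_distrib[of "\<lambda>x. _ * x"] if_distrib[of "\<lambda>x. x * _"] mult.commute cong: if_cong)
  have diff: "B ** (D - E) = B ** D - B ** E" "(D - E) ** B = D ** B - E ** B" for B D E :: "complex poly ^ 'd ^ 'd"
    by (simp_all add: vec_eq_iff matrix_matrix_mult_def algebra_simps sum_subtractf)
  have "?C U ** (?X - ?C A) ** ?C (cadj U) = ?X - ?C (U ** A ** cadj U)"
  proof -
    have "?C U ** ?X ** ?C (cadj U) = ?X"
      by (metis X C_mult C_one unitaryD(2)[OF U] matrix_mul_assoc matrix_mul_rid)
    then show ?thesis by (simp add: diff C_mult)
  qed
  then have "det (?C U) * charpoly A * det (?C (cadj U)) = det (?X - ?C (U ** A ** cadj U))"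
    by (simp add: charpoly_def flip: det_mul)
  moreover have "det (?C U) * det (?C (cadj U)) = 1"
    by (simp add: unitaryD(2)[OF U] C_one flip: det_mul C_mult)
  ultimately have "charpoly A = det (?X - ?C (U ** A ** cadj U))"
    by (metis mult.assoc mult.commute mult.right_neutral)
  also have "\<dots> = (\<Prod>a\<in>UNIV. [:- l a, 1:])"
    unfolding d by (subst det_diagonal) (auto simp: mat_def intro!: prod.cong)
  finally show ?thesis .
qed

text \<open>The multiset of roots recovers the list up to order; this is the uniqueness behind the
  \<open>THE\<close> in \<open>spec\<close>.\<close>

lemma mset_eq_of_linear_factors:
  fixes p p' :: "real list"
  assumes "(\<Prod>x\<leftarrow>p. [:- complex_of_real x, 1:]) = (\<Prod>x\<leftarrow>p'. [:- complex_of_real x, 1:])"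
  shows "mset p = mset p'"
proof -
  have "proots (\<Prod>x\<leftarrow>p. [:- complex_of_real x, 1:]) = image_mset complex_of_real (mset p)" for p :: "real list"
  proof (induction p)
    case (Cons a p)
    have "(\<Prod>x\<leftarrow>p. [:- complex_of_real x, 1:]) \<noteq> 0"
      by (auto simp: prod_list_zero_iff)
    then have "proots ([:- complex_of_real a, 1:] * (\<Prod>x\<leftarrow>p. [:- complex_of_real x, 1:]))
        = proots [:- complex_of_real a, 1:] + proots (\<Prod>x\<leftarrow>p. [:- complex_of_real x, 1:])"
      by (intro proots_mult) simp
    with Cons show ?case by simp
  qed simp
  then have "image_mset complex_of_real (mset p) = image_mset complex_of_real (mset p')"
    using assms by metis
  then show ?thesis by (metis injD multiset.inj_map inj_of_real)
qed

text \<open>Sorting singles out one list among its permutations, so the description in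
  \<open>spec\<close> has exactly one solution. The entropy then depends on the multiset.\<close>

lemma mset_spec_diag:
  fixes A :: "complex ^ 'd ^ 'd"
  assumes U: "unitary U" and d: "U ** A ** cadj U = diag_mat (\<lambda>a. of_real (l a))"
  shows "mset (spec A) = image_mset l (mset_set UNIV)"
proof -
  let ?p = "rev (sorted_list_of_multiset (image_mset l (mset_set UNIV)))"
  let ?Q = "\<lambda>p. sorted_wrt (\<ge>) p \<and> charpoly A = (\<Prod>x\<leftarrow>p. [:- complex_of_real x, 1:])"
  have m: "mset ?p = image_mset l (mset_set UNIV)" by simp
  have "(\<Prod>x\<leftarrow>p. [:- complex_of_real x, 1:]) = (\<Prod>x\<in>#mset p. [:- complex_of_real x, 1:])" for p
    by (induction p) simp_all
  from this[of ?p] have "(\<Prod>x\<leftarrow>?p. [:- complex_of_real x, 1:]) = (\<Prod>x\<in>#mset ?p. [:- complex_of_real x, 1:])" .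
  also have "\<dots> = charpoly A"
    unfolding m charpoly_similar_diag[OF U d] by (simp add: image_mset.compositionality o_def prod_unfold_prod_mset)
  finally have c: "charpoly A = (\<Prod>x\<leftarrow>?p. [:- complex_of_real x, 1:])" ..
  have s: "sorted_wrt (\<ge>) ?p"
    by (simp add: sorted_wrt_rev)
  have "p = ?p" if "?Q p" for p
  proof -
    have "mset (rev p) = mset (rev ?p)"
      using mset_eq_of_linear_factors that c by (metis mset_rev)
    moreover have "sorted (rev p)" "sorted (rev ?p)"
      using that s by (simp_all add: sorted_wrt_rev)
    ultimately have "rev p = rev ?p" by (metis properties_for_sort)
    then show ?thesis by (metis rev_rev_ident)
  qed
  then have "spec A = ?p" unfolding spec_def using s c by (intro the_equality) blast+
  with m show ?thesis by metis
qed

lemma entropy_spec_diag: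
  fixes A :: "complex ^ 'd ^ 'd"
  assumes "unitary U" "U ** A ** cadj U = diag_mat (\<lambda>a. of_real (l a))"
  shows "shannon_entropy (spec A) = - (\<Sum>a\<in>UNIV. l a * log 2 (l a))"
proof -
  have "(\<Sum>x\<leftarrow>p. x * log 2 x) = (\<Sum>x\<in>#mset p. x * log 2 x)" for p
    by (induction p) simp_all
  from this[of "spec A"] have "(\<Sum>x\<leftarrow>spec A. x * log 2 x) = (\<Sum>x\<in>#mset (spec A). x * log 2 x)" .
  also have "\<dots> = (\<Sum>a\<in>UNIV. l a * log 2 (l a))"
    unfolding mset_spec_diag[OF assms] by (simp add: image_mset.compositionality o_def sum_unfold_sum_mset)
  finally show ?thesis by (simp add: shannon_entropy_def)
qed

text \<open>Gibbs' inequality for the joint distributions \<open>l b * \<bar>V a b\<bar>\<^sup>2\<close> and \<open>q a * \<bar>V a b\<bar>\<^sup>2\<close>.\<close>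

lemma entropy_spec_le_cross_entropy:
  fixes A :: "complex ^ 'd ^ 'd" and q :: "'d \<Rightarrow> real"
  assumes U: "unitary U" and d: "U ** A ** cadj U = diag_mat (\<lambda>a. of_real (l a))"
    and l: "\<And>a. l a \<ge> 0" "(\<Sum>a\<in>UNIV. l a) = 1"
    and q: "\<And>a. q a \<ge> 0" "(\<Sum>a\<in>UNIV. q a) \<le> 1" "\<And>a. q a = 0 \<Longrightarrow> A $ a $ a = 0"
  shows "shannon_entropy (spec A) \<le> - (\<Sum>a\<in>UNIV. Re (A $ a $ a) * log 2 (q a))"
proof -
  define w where "w a b = (cmod (U $ b $ a))\<^sup>2" for a b
  \<comment> \<open>Rows and columns of a unitary are unit vectors, so \<open>w\<close> is doubly
    stochastic. Both joint families therefore have the marginals needed to collapse the double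
    sums.\<close>
  have wr: "(\<Sum>b\<in>UNIV. w a b) = 1" "(\<Sum>a\<in>UNIV. w a b) = 1" for a b
  proof -
    have "(\<Sum>b\<in>UNIV. w a b) = (norm (cadj U $ a))\<^sup>2" "(\<Sum>a\<in>UNIV. w a b) = (norm (U $ b))\<^sup>2"
      by (simp_all add: w_def norm_vec_sq)
    then show "(\<Sum>b\<in>UNIV. w a b) = 1" "(\<Sum>a\<in>UNIV. w a b) = 1"
      using unitary_row_norm[OF U] unitary_row_norm[OF unitary_cadj[OF U]] by simp_all
  qed
  have "cadj U ** (U ** A ** cadj U) ** U = (cadj U ** U) ** A ** (cadj U ** U)"
    by (simp only: matrix_mul_assoc)
  then have A: "A = cadj U ** diag_mat (\<lambda>a. of_real (l a)) ** U"
    using unitaryD[OF U] d by simp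
  have Aa: "Re (A $ a $ a) = (\<Sum>b\<in>UNIV. l b * w a b)" for a
  proof -
    have "A $ a $ a = (\<Sum>b\<in>UNIV. cnj (U $ b $ a) * of_real (l b) * U $ b $ a)"
      by (subst A) (simp add: matrix_matrix_mult_def if_distrib[of "\<lambda>x. _ * x"] cong: if_cong)
    also have "\<dots> = of_real (\<Sum>b\<in>UNIV. l b * w a b)"
      by (simp add: w_def complex_norm_square mult_ac del: of_real_power)
    finally show ?thesis by simp
  qed
  have pt: "w a b * (l b * ln (l b)) - l b * w a b * ln (q a) \<ge> w a b * (l b - q a)" for a b
  proof (cases "l b = 0 \<or> w a b = 0")
    case True
    then show ?thesis using q(1)[of a] by (auto simp: w_def)
  next
    case False
    then have lb: "l b > 0" and wb: "w a b > 0" using l(1)[of b] by (auto simp: w_def less_le)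
    \<comment> \<open>Otherwise the hypothesis makes the diagonal entry of A at a zero, although it
      is a sum of nonnegative terms containing the positive term \<open>l b * w a b\<close>.\<close>
    have "q a \<noteq> 0"
    proof
      assume "q a = 0"
      then have "(\<Sum>b\<in>UNIV. l b * w a b) = 0" using q(3) Aa[of a] by simp
      then have "l b * w a b = 0"
        by (subst (asm) sum_nonneg_eq_0_iff) (auto simp: l w_def)
      with False show False by simp
    qed
    then have qa: "q a > 0" using q(1)[of a] by simp
    have "ln (q a / l b) \<le> q a / l b - 1" using qa lb by (intro ln_le_minus_one) simp
    then have "l b * (ln (q a) - ln (l b)) \<le> l b * (q a / l b - 1)"
      using qa lb by (intro mult_left_mono) (auto simp: ln_div)
    then have "l b - q a \<le> l b * ln (l b) - l b * ln (q a)"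
      using lb by (simp add: algebra_simps)
    then have "w a b * (l b - q a) \<le> w a b * (l b * ln (l b) - l b * ln (q a))"
      using wb by (intro mult_left_mono) auto
    then show ?thesis by (simp add: algebra_simps)
  qed
  have "0 \<le> (\<Sum>b\<in>UNIV. l b) - (\<Sum>a\<in>UNIV. q a)" using l q by simp
  also have "\<dots> = (\<Sum>b\<in>UNIV. l b * (\<Sum>a\<in>UNIV. w a b)) - (\<Sum>a\<in>UNIV. q a * (\<Sum>b\<in>UNIV. w a b))"
    by (simp add: wr)
  also have "(\<Sum>b\<in>UNIV. l b * (\<Sum>a\<in>UNIV. w a b)) = (\<Sum>a\<in>UNIV. \<Sum>b\<in>UNIV. w a b * l b)"
    unfolding sum_distrib_left by (subst sum.swap) (simp add: mult.commute)
  also have "\<dots> - (\<Sum>a\<in>UNIV. q a * (\<Sum>b\<in>UNIV. w a b)) = (\<Sum>a\<in>UNIV. \<Sum>b\<in>UNIV. w a b * (l b - q a))"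
    by (simp add: sum_distrib_left sum_subtractf algebra_simps)
  also have "\<dots> \<le> (\<Sum>a\<in>UNIV. \<Sum>b\<in>UNIV. w a b * (l b * ln (l b)) - l b * w a b * ln (q a))"
    by (intro sum_mono pt)
  also have "\<dots> = (\<Sum>a\<in>UNIV. \<Sum>b\<in>UNIV. w a b * (l b * ln (l b))) - (\<Sum>a\<in>UNIV. (\<Sum>b\<in>UNIV. l b * w a b) * ln (q a))"
    by (simp add: sum_subtractf sum_distrib_right)
  also have "(\<Sum>a\<in>UNIV. \<Sum>b\<in>UNIV. w a b * (l b * ln (l b))) = (\<Sum>b\<in>UNIV. (\<Sum>a\<in>UNIV. w a b) * (l b * ln (l b)))"
    unfolding sum_distrib_right by (rule sum.swap)
  finally have "- (\<Sum>b\<in>UNIV. l b * ln (l b)) \<le> - (\<Sum>a\<in>UNIV. Re (A $ a $ a) * ln (q a))"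
    by (simp add: wr Aa)
  then have "(- (\<Sum>b\<in>UNIV. l b * ln (l b))) / ln 2 \<le> (- (\<Sum>a\<in>UNIV. Re (A $ a $ a) * ln (q a))) / ln 2"
    by (intro divide_right_mono) auto
  then show ?thesis
    by (simp add: entropy_spec_diag[OF U d] log_def sum_divide_distrib)
qed

subsection \<open>Weak duality\<close>

lemma diag_mat_mult: "diag_mat l ** diag_mat m = diag_mat (\<lambda>a. l a * m a)"
  by (simp add: vec_eq_iff matrix_matrix_mult_def if_distrib[of "\<lambda>x. _ * x"] if_distrib[of "\<lambda>x. x * _"] cong: if_cong)

lemma invertible_diag_mat:
  assumes "\<And>a. l a \<noteq> 0"
  shows "invertible (diag_mat l)"
proof -
  show ?thesis unfolding invertible_def
    by (intro exI[of _ "diag_mat (\<lambda>a. 1 / l a)"]) (simp add: diag_mat_mult assms mat_def vec_eq_iff)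
qed

lemma sym_orbit_self: "f \<in> sym_orbit f"
  unfolding sym_orbit_def by (force intro: exI[of _ "mat 1"] simp: invertible_def)

lemma sym_orbit_tensor_power_map:
  assumes "s \<in> sym_orbit f" "invertible A"
  shows "tensor_power_map A s \<in> sym_orbit f"
  using assms by (auto simp: sym_orbit_def tensor_power_map_compose intro: invertible_mult)

lemma closure_orbit_tensor_power_map:
  assumes "s \<in> closure (sym_orbit f)" "invertible A"
  shows "tensor_power_map A s \<in> closure (sym_orbit f)"
proof -
  have "tensor_power_map A ` closure (sym_orbit f) \<subseteq> closure (sym_orbit f)"
    using closure_subset assms(2)
    by (intro image_closure_subset continuous_on_tensor_power_map)
       (auto intro: sym_orbit_tensor_power_map subsetD[OF closure_subset])
  with assms(1) show ?thesis by blast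
qed

text \<open>Degenerations compose, because every group element maps an orbit closure into
  itself.\<close>

lemma closure_orbit_trans:
  assumes "s \<in> closure (sym_orbit f)" "t \<in> closure (sym_orbit s)"
  shows "t \<in> closure (sym_orbit f)"
proof -
  have "sym_orbit s \<subseteq> closure (sym_orbit f)"
    using closure_orbit_tensor_power_map[OF assms(1)] by (auto simp: sym_orbit_def)
  then show ?thesis using assms(2) closure_minimal[of _ "closure (sym_orbit f)"] by auto
qed

text \<open>A scalar factor on tensors is the action of its k-th root on vectors. Positive multiples
  therefore stay in the orbit, which permits all later normalisations.\<close>

lemma tensor_power_map_scalar:
  "c \<ge> 0 \<Longrightarrow> tensor_power_map (diag_mat (\<lambda>_. of_real (root CARD('k) c))) f = (\<chi> \<iota>. of_real c * f $ \<iota>)"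
  for f :: "('k::finite, 'd::finite) tensor"
  by (simp add: tensor_power_map_diag of_real_power[symmetric] real_root_pow_pos2 del: of_real_power)

text \<open>Multiplicative form of the half-space \<Sum>_j log q(\<iota> j) \<ge> log w. The product
  form makes sense when q has zeros, and for w > 0 it forbids the indices where q vanishes.\<close>

definition supported :: "('d \<Rightarrow> real) \<Rightarrow> real \<Rightarrow> ('k::finite, 'd::finite) tensor \<Rightarrow> bool" where
  "supported q w t \<longleftrightarrow> (\<forall>\<iota>. t $ \<iota> \<noteq> 0 \<longrightarrow> w \<le> (\<Prod>j\<in>UNIV. q (\<iota> j)))"

lemma tensor_power_map_nonzeroE:
  assumes "tensor_power_map A t $ \<iota> \<noteq> 0"
  obtains \<kappa> where "t $ \<kappa> \<noteq> 0" "\<And>j. A $ \<iota> j $ \<kappa> j \<noteq> 0"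
proof -
  obtain \<kappa> where "(\<Prod>j\<in>UNIV. A $ \<iota> j $ \<kappa> j) * t $ \<kappa> \<noteq> 0"
    using assms by (auto simp: tensor_power_map_def elim: sum.not_neutral_contains_not_neutral)
  then show ?thesis using that[of \<kappa>] by simp
qed

text \<open>A matrix that sends coordinates only to levels at least as high cannot lower a product
  of q-values. Nonnegativity of q allows the comparison factor by factor.\<close>

lemma supported_triangular:
  assumes "supported q w t" "\<And>a. 0 \<le> q a" "\<And>b a. R $ b $ a \<noteq> 0 \<Longrightarrow> q a \<le> q b"
  shows "supported q w (tensor_power_map R t)"
  unfolding supported_def
proof (intro allI impI)
  fix \<iota> assume "tensor_power_map R t $ \<iota> \<noteq> 0"
  then obtain \<kappa> where "t $ \<kappa> \<noteq> 0" "\<And>j. R $ \<iota> j $ \<kappa> j \<noteq> 0"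
    using tensor_power_map_nonzeroE by metis
  then have "w \<le> (\<Prod>j\<in>UNIV. q (\<kappa> j))" "(\<Prod>j\<in>UNIV. q (\<kappa> j)) \<le> (\<Prod>j\<in>UNIV. q (\<iota> j))"
    using assms by (auto simp: supported_def intro!: prod_mono)
  then show "w \<le> (\<Prod>j\<in>UNIV. q (\<iota> j))" by simp
qed

lemma supported_closed:
  assumes "x \<longlonglongrightarrow> s" "\<And>n. supported q w (x n)"
  shows "supported q w s"
  unfolding supported_def
proof (intro allI impI)
  fix \<iota> assume "s $ \<iota> \<noteq> 0"
  then have "eventually (\<lambda>n. x n $ \<iota> \<noteq> 0) sequentially"
    by (intro tendsto_imp_eventually_ne[OF tendsto_vec_nth[OF assms(1)]])
  then obtain n where "x n $ \<iota> \<noteq> 0" by (auto simp: eventually_sequentially)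
  then show "w \<le> (\<Prod>j\<in>UNIV. q (\<iota> j))" using assms(2) by (auto simp: supported_def)
qed

definition dual_feasible ::
    "complex ^ 'd ^ 'd \<Rightarrow> ('d \<Rightarrow> real) \<Rightarrow> real \<Rightarrow> ('k::finite, 'd::finite) tensor \<Rightarrow> bool" where
  "dual_feasible B q w f \<longleftrightarrow> invertible B \<and> (\<forall>a. 0 \<le> q a) \<and> (\<Sum>a\<in>UNIV. q a) = 1 \<and> 0 < w
    \<and> supported q w (tensor_power_map B f)"

lemma unitary_subsequence:
  fixes U :: "nat \<Rightarrow> complex ^ 'd ^ 'd"
  assumes "\<And>n. unitary (U n) \<and> level_block q (U n)"
  obtains V r where "unitary V" "level_block q V" "strict_mono (r :: nat \<Rightarrow> nat)" "(\<lambda>n. U (r n)) \<longlonglongrightarrow> V"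
proof -
  have "seq_compact {U :: complex ^ 'd ^ 'd. unitary U \<and> level_block q U}"
    using compact_unitary compact_imp_seq_compact by blast
  then obtain V r where "V \<in> {U. unitary U \<and> level_block q U}" "strict_mono r" "(U \<circ> r) \<longlonglongrightarrow> V"
    using assms by (auto elim!: seq_compactE[where f = U])
  then show ?thesis using that by (auto simp: o_def)
qed

text \<open>For an orbit point a f, Gram--Schmidt is applied to a times the inverse of B, acting on
  B f. Passing to the closure uses compactness of the unitary group: the matrices a may diverge, but
  the unitaries have a convergent subsequence and the support condition is closed.\<close>

lemma supported_unitary:
  assumes feas: "dual_feasible B q w f" and s: "s \<in> closure (sym_orbit f)"
  obtains U where "unitary U" "supported q w (tensor_power_map U s)"
proof -
  obtain x where x: "\<And>n. x n \<in> sym_orbit f" "x \<longlonglongrightarrow> s"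
    using s by (auto simp: closure_sequential)
  obtain C where C: "C ** B = mat 1" "B ** C = mat 1"
    using feas by (auto simp: dual_feasible_def invertible_def)
  have "\<exists>U. unitary U \<and> supported q w (tensor_power_map U (x n))" for n
  proof -
    obtain a where a: "invertible a" "x n = tensor_power_map a f"
      using x(1)[of n] by (auto simp: sym_orbit_def)
    have "invertible C" using C by (auto simp: invertible_def)
    then have "invertible (a ** C)" using a by (intro invertible_mult)
    then obtain U where U: "unitary U" "\<And>b c. (U ** (a ** C)) $ b $ c \<noteq> 0 \<Longrightarrow> q c \<le> q b"
      using unitary_triangular by blast
    have "supported q w (tensor_power_map (U ** (a ** C)) (tensor_power_map B f))"
      using feas U(2) by (intro supported_triangular[where R = "U ** (a ** C)"]) (auto simp: dual_feasible_def)
    moreover have "U ** (a ** C) ** B = U ** a"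
      by (simp add: C flip: matrix_mul_assoc)
    ultimately show ?thesis using U(1) by (auto simp: tensor_power_map_compose a(2))
  qed
  then obtain U where U: "\<And>n. unitary (U n)" "\<And>n. supported q w (tensor_power_map (U n) (x n))"
    by metis
  have "level_block (\<lambda>_. 0) (U n)" for n by (simp add: level_block_def)
  then obtain V r where V: "unitary V" "strict_mono (r :: nat \<Rightarrow> nat)" "(\<lambda>n. U (r n)) \<longlonglongrightarrow> V"
    using unitary_subsequence[of U "\<lambda>_. 0"] U by metis
  have "(\<lambda>n. x (r n)) \<longlonglongrightarrow> s"
    using LIMSEQ_subseq_LIMSEQ[OF x(2) V(2)] by (simp add: o_def)
  then have "(\<lambda>n. tensor_power_map (U (r n)) (x (r n))) \<longlonglongrightarrow> tensor_power_map V s"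
    by (intro tendsto_tensor_power_map V)
  then have "supported q w (tensor_power_map V s)"
    by (rule supported_closed) (rule U)
  with V(1) that show ?thesis by blast
qed

text \<open>Diagonalising within the blocks keeps the rotation inside the group under which
  homogeneity and minimality are preserved. For constant \<open>q\<close> this is the plain spectral
  theorem.\<close>

lemma average_marginal_diagonalise:
  fixes s :: "('k::finite, 'd::finite) tensor"
  assumes "level_block q (average_marginal s)"
  obtains V where "unitary V" "level_block q V"
    "average_marginal (tensor_power_map V s) = diag_mat (\<lambda>a. of_real (diag_weight (tensor_power_map V s) a))"
proof -
  have "cadj (average_marginal s) = average_marginal s"
    by (simp add: vec_eq_iff cnj_average_marginal)
  then obtain V where V: "unitary V" "level_block q V"
    "\<And>a b. a \<noteq> b \<Longrightarrow> (V ** average_marginal s ** cadj V) $ a $ b = 0"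
    using hermitian_diagonalisable assms by blast
  then have "average_marginal (tensor_power_map V s) = diag_mat (\<lambda>a. of_real (diag_weight (tensor_power_map V s) a))"
    by (auto simp: vec_eq_iff average_marginal_unitary average_marginal_diag[symmetric])
  with V that show ?thesis by blast
qed

lemma log_prod_pos:
  fixes y :: "'k::finite \<Rightarrow> real"
  assumes "\<And>j. y j > 0"
  shows "log 2 (\<Prod>j\<in>UNIV. y j) = (\<Sum>j\<in>UNIV. log 2 (y j))"
  using assms by (simp add: log_def ln_prod less_imp_neq[THEN not_sym] flip: sum_divide_distrib)

lemma supported_pos:
  assumes "supported q w t" "0 < w" "\<And>a. 0 \<le> q a" "t $ \<iota> \<noteq> 0"
  shows "0 < q (\<iota> j)"
proof -
  have "0 < (\<Prod>j\<in>UNIV. q (\<iota> j))" using assms by (force simp: supported_def)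
  then have "q (\<iota> j) \<noteq> 0" by (metis UNIV_I finite less_irrefl prod_zero)
  then show ?thesis using assms(3)[of "\<iota> j"] by simp
qed

theorem entropy_le_dual:
  fixes f :: "('k::finite, 'd::finite) tensor"
  assumes feas: "dual_feasible B q w f" and s: "s \<in> closure (sym_orbit f)" "s \<noteq> 0"
  shows "shannon_entropy (spec (average_marginal s)) \<le> - log 2 w / real CARD('k)"
proof -
  note fe = feas[unfolded dual_feasible_def]
  obtain U where U: "unitary U" "supported q w (tensor_power_map U s)"
    using supported_unitary[OF feas s(1)] .
  define u where "u = tensor_power_map U s"
  have un: "norm u = norm s" unfolding u_def by (rule norm_tensor_power_map_unitary[OF U(1)])
  obtain V where V: "unitary V"
    "average_marginal (tensor_power_map V s) = diag_mat (\<lambda>a. of_real (diag_weight (tensor_power_map V s) a))"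
    by (rule average_marginal_diagonalise[of "\<lambda>_. 0" s]) (auto simp: level_block_def)
  define l where "l = diag_weight (tensor_power_map V s)"
  have l: "l a \<ge> 0" "(\<Sum>a\<in>UNIV. l a) = 1" for a
  proof -
    have "tensor_power_map V s \<noteq> 0"
      using s(2) norm_tensor_power_map_unitary[OF V(1), of s] by (metis norm_eq_zero)
    then show "l a \<ge> 0" "(\<Sum>a\<in>UNIV. l a) = 1"
      unfolding l_def by (simp_all add: diag_weight_nonneg sum_diag_weight_one)
  qed
  have d: "V ** average_marginal s ** cadj V = diag_mat (\<lambda>a. of_real (l a))"
    using V(2) by (simp only: average_marginal_unitary[OF V(1)] l_def)
  \<comment> \<open>Two bases are in play: V diagonalises the marginal, U controls the support. The
    change of basis between them diagonalises the marginal of \<open>u\<close> with the same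
    eigenvalues, so Gibbs' inequality can be applied to \<open>u\<close>.\<close>
  have "V ** cadj U ** average_marginal u ** cadj (V ** cadj U)
      = V ** (cadj U ** U) ** average_marginal s ** (cadj U ** U) ** cadj V"
    by (simp add: u_def average_marginal_unitary[OF U(1)] cadj_mult matrix_mul_assoc)
  then have d': "V ** cadj U ** average_marginal u ** cadj (V ** cadj U) = diag_mat (\<lambda>a. of_real (l a))"
    by (simp add: unitaryD[OF U(1)] d)
  have VU: "unitary (V ** cadj U)" by (intro unitary_mult V unitary_cadj U)
  have pos: "0 < q (\<iota> j)" if "u $ \<iota> \<noteq> 0" for \<iota> j
    using supported_pos[OF U(2)] fe that by (auto simp: u_def)
  \<comment> \<open>Absolute continuity, needed for Gibbs' inequality: an index with q a = 0 occurs
    in no multi-index of the support.\<close>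
  have z: "average_marginal u $ a $ a = 0" if "q a = 0" for a
  proof -
    have "(cmod (u $ \<iota>))\<^sup>2 * real (card {j. \<iota> j = a}) = 0" for \<iota>
    proof (cases "u $ \<iota> = 0")
      case False
      then have "{j. \<iota> j = a} = {}" using pos[OF False] that by (metis (mono_tags, lifting) empty_Collect_eq less_irrefl)
      then show ?thesis by simp
    qed simp
    then have "diag_weight u a = 0"
      unfolding diag_weight_def by (simp only: sum.neutral_const div_0)
    then show ?thesis by (simp add: average_marginal_diag)
  qed
  have "shannon_entropy (spec (average_marginal s)) = shannon_entropy (spec (average_marginal u))"
    using entropy_spec_diag[OF V(1) d] entropy_spec_diag[OF VU d'] by simp
  also have "\<dots> \<le> - (\<Sum>a\<in>UNIV. Re (average_marginal u $ a $ a) * log 2 (q a))"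
    using fe by (intro entropy_spec_le_cross_entropy[OF VU d' l] z) auto
  also have "\<dots> = - ((\<Sum>\<iota>\<in>UNIV. (cmod (u $ \<iota>))\<^sup>2 * (\<Sum>j\<in>UNIV. log 2 (q (\<iota> j)))) / (real CARD('k) * (norm u)\<^sup>2))"
    by (simp add: average_marginal_diag sum_diag_weight)
  also have "\<dots> \<le> - ((\<Sum>\<iota>\<in>UNIV. (cmod (u $ \<iota>))\<^sup>2 * log 2 w) / (real CARD('k) * (norm u)\<^sup>2))"
  proof -
    have "(cmod (u $ \<iota>))\<^sup>2 * log 2 w \<le> (cmod (u $ \<iota>))\<^sup>2 * (\<Sum>j\<in>UNIV. log 2 (q (\<iota> j)))" for \<iota>
    proof (cases "u $ \<iota> = 0")
      case False
      then have "w \<le> (\<Prod>j\<in>UNIV. q (\<iota> j))" using U(2) by (auto simp: supported_def u_def)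
      then have "log 2 w \<le> log 2 (\<Prod>j\<in>UNIV. q (\<iota> j))" using fe by simp
      then show ?thesis using log_prod_pos[of "\<lambda>j. q (\<iota> j)"] pos[OF False]
        by (intro mult_left_mono) auto
    qed simp
    then show ?thesis
      by (intro le_imp_neg_le divide_right_mono sum_mono) auto
  qed
  also have "\<dots> = - log 2 w / real CARD('k)"
    using s(2) un by (simp add: norm_vec_sq[of u, symmetric] flip: sum_distrib_right)
  finally show ?thesis .
qed

text \<open>A pair of optimal solutions of the two sides of the duality, with equal values.\<close>

definition certificate :: "('k::finite, 'd::finite) tensor \<Rightarrow> ('d \<Rightarrow> real) \<Rightarrow> real \<Rightarrow> bool" where
  "certificate f q w \<longleftrightarrow> (\<exists>B. dual_feasible B q w f) \<and>
    (\<exists>s \<in> closure (sym_orbit f) - {0}. average_marginal s = diag_mat (\<lambda>a. of_real (q a))) \<and>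
    - (\<Sum>a\<in>UNIV. q a * log 2 (q a)) = - log 2 w / real CARD('k)"

lemma entropy_spec_diag_mat:
  "shannon_entropy (spec (diag_mat (\<lambda>a. of_real (l a)))) = - (\<Sum>a\<in>UNIV. l a * log 2 (l a))"
  by (rule entropy_spec_diag[OF unitary_one]) simp

text \<open>The vector in a certificate attains the bound of weak duality, so the maximum required
  by \<open>GREATEST\<close> exists and is determined by w.\<close>

lemma certificate_value:
  fixes f :: "('k::finite, 'd::finite) tensor"
  assumes "certificate f q w"
  shows "log_sym_quantum_functional f = - log 2 w / real CARD('k)"
    and "sym_quantum_functional f = w powr (- 1 / real CARD('k))"
proof -
  obtain B s where B: "dual_feasible B q w f" and s: "s \<in> closure (sym_orbit f) - {0}"
    "average_marginal s = diag_mat (\<lambda>a. of_real (q a))"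
    and e: "- (\<Sum>a\<in>UNIV. q a * log 2 (q a)) = - log 2 w / real CARD('k)"
    using assms by (auto simp: certificate_def)
  show 1: "log_sym_quantum_functional f = - log 2 w / real CARD('k)"
    unfolding log_sym_quantum_functional_def
  proof (rule Greatest_equality)
    have "shannon_entropy (spec (average_marginal s)) = - log 2 w / real CARD('k)"
      unfolding s(2) entropy_spec_diag_mat e ..
    then show "- log 2 w / real CARD('k) \<in> shannon_entropy ` spectra f"
      using s(1) unfolding spectra_def by (metis (mono_tags, lifting) imageI mem_Collect_eq)
  next
    fix h assume "h \<in> shannon_entropy ` spectra f"
    then show "h \<le> - log 2 w / real CARD('k)"
      using entropy_le_dual[OF B] by (auto simp: spectra_def)
  qed
  have "w > 0" using B by (simp add: dual_feasible_def)
  then have "w powr (- 1 / real CARD('k)) = (2 powr log 2 w) powr (- 1 / real CARD('k))" by simp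
  then show "sym_quantum_functional f = w powr (- 1 / real CARD('k))"
    by (simp only: sym_quantum_functional_def 1 powr_powr) simp
qed

subsection \<open>Semistable tensors\<close>

text \<open>The block is padded by the identity to the full size instead of being cut out, since its
  size depends on the value \<theta>. For a block-diagonal matrix the determinant is that of the
  block.\<close>

definition block_restrict :: "('d \<Rightarrow> real) \<Rightarrow> real \<Rightarrow> complex ^ 'd ^ 'd \<Rightarrow> complex ^ 'd ^ 'd" where
  "block_restrict q \<theta> A = (\<chi> a c. if q a = \<theta> \<and> q c = \<theta> then A $ a $ c else if a = c then 1 else 0)"

lemma block_restrict_mult:
  assumes "level_block q A" "level_block q B"
  shows "block_restrict q \<theta> (A ** B) = block_restrict q \<theta> A ** block_restrict q \<theta> B"
proof -
  have "block_restrict q \<theta> (A ** B) $ a $ e = (block_restrict q \<theta> A ** block_restrict q \<theta> B) $ a $ e" for a e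
  proof (cases "q a = \<theta>")
    case True
    have "(block_restrict q \<theta> A ** block_restrict q \<theta> B) $ a $ e = (\<Sum>m\<in>UNIV. A $ a $ m * B $ m $ e)"
      unfolding matrix_matrix_mult_def
    proof (simp, intro sum.cong refl)
      fix m
      show "block_restrict q \<theta> A $ a $ m * block_restrict q \<theta> B $ m $ e = A $ a $ m * B $ m $ e"
        using True level_blockD[OF assms(1), of a m] level_blockD[OF assms(2), of m e]
        by (cases "q m = \<theta>"; cases "q e = \<theta>") (auto simp: block_restrict_def)
    qed
    moreover have "block_restrict q \<theta> (A ** B) $ a $ e = (A ** B) $ a $ e"
      using True level_blockD[OF level_block_mult[OF assms], of a e]
      by (cases "q e = \<theta>") (auto simp: block_restrict_def)
    ultimately show ?thesis by (simp add: matrix_matrix_mult_def)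
  next
    case False
    then show ?thesis
      by (auto simp: block_restrict_def matrix_matrix_mult_def mult_if_delta)
  qed
  then show ?thesis by (simp add: vec_eq_iff)
qed

lemma block_restrict_one: "block_restrict q \<theta> (mat 1) = mat 1"
  by (simp add: block_restrict_def mat_def vec_eq_iff)

lemma block_restrict_cadj: "block_restrict q \<theta> (cadj A) = cadj (block_restrict q \<theta> A)"
  by (auto simp: block_restrict_def vec_eq_iff)

lemma det_cadj: "det (cadj A) = cnj (det A)"
proof -
  have "cadj A = transpose (\<chi> i j. cnj (A $ i $ j))"
    by (simp add: vec_eq_iff transpose_def)
  then have "det (cadj A) = det (\<chi> i j. cnj (A $ i $ j))" by simp
  also have "\<dots> = cnj (det A)" by (simp add: det_def)
  finally show ?thesis .
qed

lemma cmod_det_unitary: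
  assumes "unitary U"
  shows "cmod (det U) = 1"
proof -
  have "det (cadj U ** U) = 1" by (simp add: unitaryD[OF assms])
  then have "cnj (det U) * det U = 1" by (simp add: det_mul det_cadj)
  then have "complex_of_real ((cmod (det U))\<^sup>2) = 1"
    unfolding complex_norm_square by (simp add: mult.commute)
  then have "(cmod (det U))\<^sup>2 = 1" by (simp only: of_real_eq_1_iff)
  then show ?thesis by (simp add: power2_eq_1_iff) (metis norm_ge_zero not_one_le_zero neg_0_le_iff_le)
qed

text \<open>The character of the block-diagonal group which is \<open>\<bar>det\<bar>\<close> to the power \<open>\<theta>\<close> on the block
  \<open>q = \<theta>\<close>.\<close>

definition block_character :: "('d \<Rightarrow> real) \<Rightarrow> complex ^ 'd ^ 'd \<Rightarrow> real" where
  "block_character q A = (\<Prod>\<theta>\<in>range q. cmod (det (block_restrict q \<theta> A)) powr \<theta>)"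

lemma block_character_mult:
  assumes "level_block q A" "level_block q B"
  shows "block_character q (A ** B) = block_character q A * block_character q B"
  by (simp add: block_character_def block_restrict_mult[OF assms] det_mul norm_mult powr_mult prod.distrib)

lemma block_character_pos:
  assumes "level_block q A" "level_block q B" "A ** B = mat 1"
  shows "block_character q A > 0"
proof -
  have "det (block_restrict q \<theta> A) \<noteq> 0" for \<theta>
  proof -
    have "det (block_restrict q \<theta> A) * det (block_restrict q \<theta> B) = 1"
      by (simp add: block_restrict_mult[OF assms(1,2), symmetric] assms(3) block_restrict_one flip: det_mul)
    then show ?thesis by auto
  qed
  then show ?thesis by (simp add: block_character_def prod_pos)
qed

text \<open>Unitaries change neither the norm nor the character, so the estimates reduce to positive
  diagonal matrices.\<close>

lemma block_character_unitary:
  assumes "unitary U" "level_block q U"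
  shows "block_character q U = 1"
proof -
  have "unitary (block_restrict q \<theta> U)" for \<theta>
    unfolding unitary_def block_restrict_cadj[symmetric]
    using assms by (simp add: unitaryD level_block_cadj block_restrict_one flip: block_restrict_mult)
  then show ?thesis by (simp add: block_character_def cmod_det_unitary)
qed

text \<open>On positive diagonal matrices the character is the exponential of \<Sum> q a ln (l a).
  Its logarithmic derivative is q, which is why this character produces the marginal
  \<open>diag q\<close>.\<close>

lemma block_character_diag:
  fixes l :: "'d::finite \<Rightarrow> real"
  assumes "\<And>a. l a > 0"
  shows "block_character q (diag_mat (\<lambda>a. of_real (l a))) = (\<Prod>a\<in>UNIV. l a powr q a)"
proof -
  have "cmod (det (block_restrict q \<theta> (diag_mat (\<lambda>a. of_real (l a))))) powr \<theta> = (\<Prod>a | q a = \<theta>. l a powr q a)" for \<theta>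
  proof -
    have "det (block_restrict q \<theta> (diag_mat (\<lambda>a. of_real (l a))))
        = (\<Prod>a\<in>UNIV. if q a = \<theta> then complex_of_real (l a) else 1)"
      by (subst det_diagonal) (auto simp: block_restrict_def intro!: prod.cong)
    also have "\<dots> = (\<Prod>a | q a = \<theta>. complex_of_real (l a))"
      by (simp add: prod.If_cases)
    finally have "cmod (det (block_restrict q \<theta> (diag_mat (\<lambda>a. of_real (l a))))) = (\<Prod>a | q a = \<theta>. l a)"
      using assms by (simp add: prod_norm[symmetric] abs_of_pos)
    then show ?thesis by (simp add: prod_powr_distrib)
  qed
  then show ?thesis
    using prod.group[of UNIV "range q" q "\<lambda>a. l a powr q a"] by (simp add: block_character_def)
qed

text \<open>Deleting the entries of B across levels leaves a right inverse of A, and inverses are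
  unique.\<close>

lemma level_block_inverse:
  fixes A B :: "complex ^ 'd ^ 'd"
  assumes "level_block q A" "A ** B = mat 1"
  shows "level_block q B"
proof -
  define C where "C = (\<chi> a c. if q a = q c then B $ a $ c else 0)"
  have "A ** C = mat 1"
  proof -
    have "(A ** C) $ a $ c = mat 1 $ a $ c" for a c
    proof (cases "q a = q c")
      case True
      have "(A ** C) $ a $ c = (\<Sum>m\<in>UNIV. A $ a $ m * B $ m $ c)"
        unfolding matrix_matrix_mult_def
      proof (simp, intro sum.cong refl)
        fix m show "A $ a $ m * C $ m $ c = A $ a $ m * B $ m $ c"
          using True level_blockD[OF assms(1), of a m] by (cases "q m = q a") (auto simp: C_def)
      qed
      then show ?thesis using assms(2) by (simp add: matrix_matrix_mult_def vec_eq_iff)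
    next
      case False
      have "A $ a $ m * C $ m $ c = 0" for m
        using False level_blockD[OF assms(1), of a m] by (cases "q m = q a") (auto simp: C_def)
      then have "(\<Sum>m\<in>UNIV. A $ a $ m * C $ m $ c) = 0" by (intro sum.neutral ballI)
      then show ?thesis using False by (auto simp: matrix_matrix_mult_def mat_def)
    qed
    then show ?thesis by (simp add: vec_eq_iff)
  qed
  moreover have "B ** A = mat 1" using assms(2) matrix_left_right_inverse by blast
  ultimately have "C = B" by (metis matrix_mul_assoc matrix_mul_lid matrix_mul_rid)
  then show ?thesis by (auto simp: level_block_def C_def vec_eq_iff split: if_splits)
qed

lemma invertible_level_blockE:
  fixes A :: "complex ^ 'd ^ 'd"
  assumes "invertible A" "level_block q A"
  obtains B where "A ** B = mat 1" "B ** A = mat 1" "level_block q B"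
  using assms level_block_inverse unfolding invertible_def by metis

text \<open>Singular value decomposition inside the block-diagonal group. V diagonalises
  \<open>cadj b ** b\<close>, so the columns of \<open>b ** cadj V\<close> are orthogonal;
  \<open>l\<close> collects their norms and normalising them gives U.\<close>

lemma cartan_decomposition:
  fixes b :: "complex ^ 'd ^ 'd"
  assumes inv: "invertible b" and blk: "level_block q b"
  obtains U V l where "unitary U" "level_block q U" "unitary V" "level_block q V" "\<And>a. 0 < l a"
    "b = U ** diag_mat (\<lambda>a. of_real (l a)) ** V"
proof -
  have "cadj (cadj b ** b) = cadj b ** b" by (simp add: cadj_mult)
  moreover have "level_block q (cadj b ** b)" by (intro level_block_mult level_block_cadj blk)
  ultimately obtain V where V: "unitary V" "level_block q V"
    and off: "\<And>a c. a \<noteq> c \<Longrightarrow> (V ** (cadj b ** b) ** cadj V) $ a $ c = 0"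
    using hermitian_diagonalisable by blast
  define c where "c = b ** cadj V"
  have cc: "cadj c ** c = V ** (cadj b ** b) ** cadj V"
    by (simp add: c_def cadj_mult matrix_mul_assoc)
  define l where "l a = norm (cadj c $ a)" for a
  have ldiag: "(cadj c ** c) $ a $ a = of_real ((l a)\<^sup>2)" for a
    unfolding l_def cinner_self[symmetric] by (simp add: cinner_def matrix_matrix_mult_def)
  then have ccd: "cadj c ** c = diag_mat (\<lambda>a. of_real ((l a)\<^sup>2))"
    using off by (auto simp: vec_eq_iff cc)
  obtain b' where b': "b ** b' = mat 1" "b' ** b = mat 1" using inv by (auto simp: invertible_def)
  have l: "l a > 0" for a
  proof -
    have "V ** b' ** c = V ** (b' ** b) ** cadj V" by (simp add: c_def matrix_mul_assoc)
    also have "\<dots> = mat 1" by (simp add: b' unitaryD[OF V(1)])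
    finally have "(V ** b' ** c) $ a $ a = 1" by (simp add: mat_def)
    moreover have "(V ** b' ** c) $ a $ a = 0" if "cadj c $ a = 0"
    proof -
      have "cnj (c $ m $ a) = 0" for m using that by (metis cadj_nth zero_index)
      then show ?thesis by (simp add: matrix_matrix_mult_def[of _ c])
    qed
    ultimately have "cadj c $ a \<noteq> 0" by auto
    then show ?thesis by (simp add: l_def)
  qed
  define U where "U = c ** diag_mat (\<lambda>a. of_real (1 / l a))"
  have cd: "cadj (diag_mat (\<lambda>a. of_real (r a))) = diag_mat (\<lambda>a. of_real (r a))" for r :: "'d \<Rightarrow> real"
    by (auto simp: vec_eq_iff)
  have "cadj U ** U = diag_mat (\<lambda>a. of_real (1 / l a)) ** (cadj c ** c) ** diag_mat (\<lambda>a. of_real (1 / l a))"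
    by (simp only: U_def cadj_mult cd matrix_mul_assoc)
  also have "\<dots> = diag_mat (\<lambda>a. 1)"
    unfolding ccd diag_mat_mult using l by (simp add: vec_eq_iff power2_eq_square less_imp_neq[THEN not_sym])
  finally have U: "unitary U" by (simp add: unitary_def mat_def)
  have Ub: "level_block q U"
    unfolding U_def c_def by (intro level_block_mult level_block_diag level_block_cadj blk V)
  have "U ** diag_mat (\<lambda>a. of_real (l a)) ** V = c ** (diag_mat (\<lambda>a. of_real (1 / l a)) ** diag_mat (\<lambda>a. of_real (l a))) ** V"
    by (simp only: U_def matrix_mul_assoc)
  also have "diag_mat (\<lambda>a. of_real (1 / l a)) ** diag_mat (\<lambda>a. of_real (l a)) = (mat 1 :: complex ^ 'd ^ 'd)"
    unfolding diag_mat_mult using l by (simp add: vec_eq_iff mat_def less_imp_neq[THEN not_sym])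
  also have "c ** mat 1 ** V = b"
    by (simp add: c_def unitaryD[OF V(1)] flip: matrix_mul_assoc)
  finally have "b = U ** diag_mat (\<lambda>a. of_real (l a)) ** V" by simp
  then show ?thesis using U Ub V l by (intro that[of U V l])
qed

text \<open>The Hilbert--Mumford numerical criterion, twisted by the k-th power of
  \<open>block_character q\<close>: in no unitary frame does the flow of exp(\<tau> x) let all
  coordinates decay relative to the character. Directions x are real rather than integral, and
  unitary frames are enough by the Cartan decomposition.\<close>

definition semistable :: "('d \<Rightarrow> real) \<Rightarrow> ('k::finite, 'd::finite) tensor \<Rightarrow> bool" where
  "semistable q t \<longleftrightarrow> (\<forall>A x. unitary A \<longrightarrow> level_block q A \<longrightarrow>
     (\<exists>\<iota>. tensor_power_map A t $ \<iota> \<noteq> 0 \<and> real CARD('k) * (\<Sum>a\<in>UNIV. q a * x a) \<le> (\<Sum>j\<in>UNIV. x (\<iota> j))))"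

text \<open>The coordinate that semistability supplies in the direction ln l keeps up with the
  character, and one coordinate already bounds the norm.\<close>

lemma norm_ge_diag_term:
  fixes z :: "('k::finite, 'd::finite) tensor"
  assumes l: "\<And>a. 0 < l a"
    and \<iota>: "real CARD('k) * (\<Sum>a\<in>UNIV. q a * ln (l a)) \<le> (\<Sum>j\<in>UNIV. ln (l (\<iota> j)))"
  shows "(\<Prod>a\<in>UNIV. l a powr q a) ^ CARD('k) * cmod (z $ \<iota>)
    \<le> norm (tensor_power_map (diag_mat (\<lambda>a. of_real (l a))) z)"
proof -
  have l0: "l a \<noteq> 0" for a using l[of a] by simp
  have "(\<Prod>a\<in>UNIV. l a powr q a) ^ CARD('k) = exp (real CARD('k) * (\<Sum>a\<in>UNIV. q a * ln (l a)))"
    using l0 by (simp add: powr_def exp_of_nat_mult exp_sum)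
  also have "\<dots> \<le> exp (\<Sum>j\<in>UNIV. ln (l (\<iota> j)))" using \<iota> by simp
  also have "\<dots> = (\<Prod>j\<in>UNIV. l (\<iota> j))" using l by (simp add: exp_sum)
  finally have "(\<Prod>a\<in>UNIV. l a powr q a) ^ CARD('k) * cmod (z $ \<iota>) \<le> (\<Prod>j\<in>UNIV. l (\<iota> j)) * cmod (z $ \<iota>)"
    by (intro mult_right_mono) auto
  also have "\<dots> = cmod (tensor_power_map (diag_mat (\<lambda>a. of_real (l a))) z $ \<iota>)"
    using l by (simp add: tensor_power_map_diag norm_mult prod_norm[symmetric] abs_of_pos)
  also have "\<dots> \<le> norm (tensor_power_map (diag_mat (\<lambda>a. of_real (l a))) z)"
    by (rule Finite_Cartesian_Product.norm_nth_le)
  finally show ?thesis .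
qed

text \<open>By the Cartan decomposition it suffices to bound diagonal matrices acting on the compact
  orbit under unitaries; near each point of that orbit the support can only grow.\<close>

lemma semistable_lower_bound:
  fixes t :: "('k::finite, 'd::finite) tensor"
  assumes ss: "semistable q t"
  obtains \<nu> where "0 < \<nu>"
    "\<And>b. invertible b \<Longrightarrow> level_block q b \<Longrightarrow> \<nu> * block_character q b ^ CARD('k) \<le> norm (tensor_power_map b t)"
proof -
  let ?D = "\<lambda>l. diag_mat (\<lambda>a. complex_of_real (l a))"
  let ?c = "\<lambda>l. (\<Prod>a\<in>UNIV. l a powr q a) ^ CARD('k)"
  have "\<exists>\<nu>>0. \<forall>U l. unitary U \<and> level_block q U \<and> (\<forall>a. 0 < l a) \<longrightarrow>
      \<nu> * ?c l \<le> norm (tensor_power_map (?D l) (tensor_power_map U t))"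
  proof (rule ccontr)
    assume neg: "\<not> ?thesis"
    define P where "P n U l \<longleftrightarrow> unitary U \<and> level_block q U \<and> (\<forall>a. 0 < l a) \<and>
        norm (tensor_power_map (?D l) (tensor_power_map U t)) < inverse (real (Suc n)) * ?c l" for n U l
    have "\<exists>U l. P n U l" for n
    proof -
      have "inverse (real (Suc n)) > 0" by simp
      with neg show ?thesis unfolding P_def by (meson not_le)
    qed
    then obtain U l where "\<And>n. P n (U n) (l n)" by metis
    then have U: "\<And>n. unitary (U n) \<and> level_block q (U n)" and l: "\<And>n a. 0 < l n a"
      and small: "\<And>n. norm (tensor_power_map (?D (l n)) (tensor_power_map (U n) t)) < inverse (real (Suc n)) * ?c (l n)"
      unfolding P_def by blast+
    obtain V r where V: "unitary V" "level_block q V" "strict_mono (r :: nat \<Rightarrow> nat)" "(\<lambda>n. U (r n)) \<longlonglongrightarrow> V"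
      using unitary_subsequence[OF U] .
    define z where "z = tensor_power_map V t"
    have "(\<lambda>n. tensor_power_map (U (r n)) t) \<longlonglongrightarrow> z"
      unfolding z_def by (intro tendsto_tensor_power_map V tendsto_const)
    then have lim: "(\<lambda>n. cmod (tensor_power_map (U (r n)) t $ \<iota>)) \<longlonglongrightarrow> cmod (z $ \<iota>)" for \<iota>
      by (intro tendsto_norm tendsto_vec_nth)
    \<comment> \<open>Coordinates that are nonzero in the limit stay away from zero along the
      subsequence, so they eventually exceed 1/(n+1), the order of the supposed violation.\<close>
    have ev: "\<forall>\<^sub>F n in sequentially. z $ \<iota> \<noteq> 0 \<longrightarrow> inverse (real (Suc n)) < cmod (tensor_power_map (U (r n)) t $ \<iota>)" for \<iota>
    proof (cases "z $ \<iota> = 0")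
      case False
      then have "\<forall>\<^sub>F n in sequentially. cmod (z $ \<iota>) / 2 < cmod (tensor_power_map (U (r n)) t $ \<iota>)"
        by (intro order_tendstoD(1)[OF lim]) simp
      moreover have "\<forall>\<^sub>F n in sequentially. inverse (real (Suc n)) < cmod (z $ \<iota>) / 2"
        using False by (intro order_tendstoD(2)[OF LIMSEQ_inverse_real_of_nat]) simp
      ultimately show ?thesis by eventually_elim simp
    qed simp
    have "\<forall>\<^sub>F n in sequentially. \<forall>\<iota>. z $ \<iota> \<noteq> 0 \<longrightarrow> inverse (real (Suc n)) < cmod (tensor_power_map (U (r n)) t $ \<iota>)"
      using ev by (rule eventually_all_finite)
    then obtain n where n: "\<And>\<iota>. z $ \<iota> \<noteq> 0 \<Longrightarrow> inverse (real (Suc n)) < cmod (tensor_power_map (U (r n)) t $ \<iota>)"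
      by (auto simp: eventually_sequentially)
    \<comment> \<open>Semistability is applied in the limiting frame V but in the direction of the
      n-th violating diagonal matrix. By the choice of n, the coordinate it yields is also large in
      the frame \<open>U (r n)\<close>.\<close>
    obtain \<iota> where \<iota>: "z $ \<iota> \<noteq> 0"
      "real CARD('k) * (\<Sum>a\<in>UNIV. q a * ln (l (r n) a)) \<le> (\<Sum>j\<in>UNIV. ln (l (r n) (\<iota> j)))"
      using ss[unfolded semistable_def, rule_format, OF V(1,2), of "\<lambda>a. ln (l (r n) a)"]
      unfolding z_def by blast
    have c: "?c (l (r n)) > 0"
      using l[of "r n"] by (intro zero_less_power prod_pos) (auto simp: less_imp_neq[THEN not_sym])
    have "?c (l (r n)) * inverse (real (Suc n)) \<le> ?c (l (r n)) * cmod (tensor_power_map (U (r n)) t $ \<iota>)"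
      using n[OF \<iota>(1)] c by (intro mult_left_mono) auto
    also have "\<dots> \<le> norm (tensor_power_map (?D (l (r n))) (tensor_power_map (U (r n)) t))"
      by (rule norm_ge_diag_term[OF l \<iota>(2)])
    also have "\<dots> < inverse (real (Suc (r n))) * ?c (l (r n))" by (rule small)
    finally have "inverse (real (Suc n)) < inverse (real (Suc (r n)))"
      using c by (simp add: mult.commute)
    moreover have "n \<le> r n" using V(3) by (rule seq_suble)
    ultimately show False by (simp add: field_simps)
  qed
  then obtain \<nu> where \<nu>: "\<nu> > 0" "\<And>U l. unitary U \<Longrightarrow> level_block q U \<Longrightarrow> (\<And>a. 0 < l a) \<Longrightarrow>
      \<nu> * ?c l \<le> norm (tensor_power_map (?D l) (tensor_power_map U t))"
    by blast
  have "\<nu> * block_character q b ^ CARD('k) \<le> norm (tensor_power_map b t)"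
    if b: "invertible b" "level_block q b" for b
  proof -
    have "\<exists>U V l. unitary U \<and> level_block q U \<and> unitary V \<and> level_block q V \<and> (\<forall>a. 0 < l a) \<and> b = U ** ?D l ** V"
      by (rule cartan_decomposition[OF b]) blast
    then obtain U V l where UV: "unitary U" "level_block q U" "unitary V" "level_block q V" "\<And>a. 0 < l a"
      "b = U ** ?D l ** V"
      by blast
    have "norm (tensor_power_map b t) = norm (tensor_power_map (?D l) (tensor_power_map V t))"
      by (simp only: UV(6) tensor_power_map_compose[symmetric] norm_tensor_power_map_unitary[OF UV(1)])
    moreover have "block_character q b = (\<Prod>a\<in>UNIV. l a powr q a)"
      using UV by (simp add: block_character_mult level_block_mult level_block_diag
          block_character_unitary block_character_diag)
    ultimately show ?thesis using \<nu>(2)[OF UV(3,4,5)] by simp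
  qed
  with \<nu>(1) that show ?thesis by blast
qed

lemma closure_orbit_scaleR:
  fixes f :: "('k::finite, 'd::finite) tensor"
  assumes "s \<in> closure (sym_orbit f)" "0 < c"
  shows "c *\<^sub>R s \<in> closure (sym_orbit f)"
proof -
  have "invertible (diag_mat (\<lambda>_::'d. complex_of_real (root CARD('k) c)))"
    using assms(2) by (intro invertible_diag_mat) simp
  from closure_orbit_tensor_power_map[OF assms(1) this]
  have "(\<chi> \<iota>. of_real c * s $ \<iota>) \<in> closure (sym_orbit f)"
    using assms(2) by (simp only: tensor_power_map_scalar less_imp_le)
  moreover have "(\<chi> \<iota>. of_real c * s $ \<iota>) = c *\<^sub>R s"
    unfolding vec_eq_iff vector_scaleR_component by (simp add: scaleR_conv_of_real)
  ultimately show ?thesis by simp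
qed

lemma tensor_power_map_scaleR: "tensor_power_map A (c *\<^sub>R f) = c *\<^sub>R tensor_power_map A f"
proof -
  have "c *\<^sub>R g = (\<chi> \<iota>. of_real c * g $ \<iota>)" for g :: "('a::finite, 'b::finite) tensor"
    unfolding vec_eq_iff vector_scaleR_component by (simp add: scaleR_conv_of_real)
  moreover have "c *\<^sub>R g = (\<chi> \<iota>. of_real c * g $ \<iota>)" for g :: "('a::finite, 'c::finite) tensor"
    unfolding vec_eq_iff vector_scaleR_component by (simp add: scaleR_conv_of_real)
  ultimately show ?thesis by (simp only: tensor_power_map_scaleC)
qed

section \<open>Homogeneous tensors and vectors of minimal norm\<close>

definition homogeneous :: "('d \<Rightarrow> real) \<Rightarrow> real \<Rightarrow> ('k::finite, 'd::finite) tensor \<Rightarrow> bool" where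
  "homogeneous q w t \<longleftrightarrow> (\<forall>\<iota>. t $ \<iota> \<noteq> 0 \<longrightarrow> (\<Prod>j\<in>UNIV. q (\<iota> j)) = w)"

lemma homogeneous_closed:
  assumes "x \<longlonglongrightarrow> s" "\<And>n. homogeneous q w (x n)"
  shows "homogeneous q w s"
  unfolding homogeneous_def
proof (intro allI impI)
  fix \<iota> assume "s $ \<iota> \<noteq> 0"
  then have "eventually (\<lambda>n. x n $ \<iota> \<noteq> 0) sequentially"
    by (intro tendsto_imp_eventually_ne[OF tendsto_vec_nth[OF assms(1)]])
  then obtain n where "x n $ \<iota> \<noteq> 0" by (auto simp: eventually_sequentially)
  then show "(\<Prod>j\<in>UNIV. q (\<iota> j)) = w" using assms(2) by (auto simp: homogeneous_def)
qed

lemma homogeneous_level_block: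
  assumes "homogeneous q w t" "level_block q A"
  shows "homogeneous q w (tensor_power_map A t)"
  unfolding homogeneous_def
proof (intro allI impI)
  fix \<iota> assume "tensor_power_map A t $ \<iota> \<noteq> 0"
  then obtain \<kappa> where "t $ \<kappa> \<noteq> 0" "\<And>j. A $ \<iota> j $ \<kappa> j \<noteq> 0"
    using tensor_power_map_nonzeroE by metis
  then have "q (\<iota> j) = q (\<kappa> j)" "(\<Prod>j\<in>UNIV. q (\<kappa> j)) = w" for j
    using assms by (auto simp: homogeneous_def level_block_def)
  then show "(\<Prod>j\<in>UNIV. q (\<iota> j)) = w" by simp
qed

text \<open>A nonzero entry (a, b) requires two multi-indices of the support that differ only by a
  against b in one place. Both products equal w, and the common factors are nonzero because w is, so
  they cancel.\<close>

lemma homogeneous_level_block_average_marginal: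
  fixes s :: "('k::finite, 'd::finite) tensor"
  assumes "homogeneous q w s" "w \<noteq> 0"
  shows "level_block q (average_marginal s)"
  unfolding level_block_def
proof (intro allI impI)
  fix a b assume "average_marginal s $ a $ b \<noteq> 0"
  then obtain j where "marginal j s $ a $ b \<noteq> 0"
    by (auto simp: average_marginal_nth elim: sum.not_neutral_contains_not_neutral)
  then have "(\<Sum>\<iota> | \<iota> j = a. s $ \<iota> * cnj (s $ (\<iota>(j := b)))) \<noteq> 0"
    unfolding marginal_nth by (metis div_0)
  then obtain \<iota> where \<iota>: "\<iota> j = a" "s $ \<iota> * cnj (s $ (\<iota>(j := b))) \<noteq> 0"
    by (elim sum.not_neutral_contains_not_neutral) simp
  then have "s $ \<iota> \<noteq> 0" "s $ (\<iota>(j := b)) \<noteq> 0"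
    by (simp_all del: fun_upd_apply)
  then have "(\<Prod>i\<in>UNIV. q (\<iota> i)) = w" "(\<Prod>i\<in>UNIV. q ((\<iota>(j := b)) i)) = w"
    using assms(1) by (simp_all add: homogeneous_def del: fun_upd_apply)
  moreover have "(\<Prod>i\<in>UNIV. q (\<iota> i)) = q a * (\<Prod>i\<in>UNIV - {j}. q (\<iota> i))"
    by (subst prod.remove[of _ j]) (simp_all add: \<iota>)
  moreover have "(\<Prod>i\<in>UNIV. q ((\<iota>(j := b)) i)) = q b * (\<Prod>i\<in>UNIV - {j}. q (\<iota> i))"
    by (subst prod.remove[of _ j]) (auto intro!: prod.cong)
  ultimately show "q a = q b" using assms(2) by (metis mult_cancel_right mult_zero_right)
qed

text \<open>Kempf--Ness: a point of minimal norm, relative to the character, has marginal \<open>q\<close>.\<close>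

lemma semistable_minimal_vector:
  fixes t :: "('k::finite, 'd::finite) tensor"
  assumes ss: "semistable q t" and hom: "homogeneous q w t"
  obtains s where "s \<in> closure (sym_orbit t)" "norm s = 1" "homogeneous q w s"
    "\<And>b. invertible b \<Longrightarrow> level_block q b \<Longrightarrow> block_character q b ^ CARD('k) \<le> norm (tensor_power_map b s)"
proof -
  let ?c = "\<lambda>b. block_character q b ^ CARD('k)"
  let ?L = "{b. invertible b \<and> level_block q b}"
  obtain \<nu> where \<nu>: "0 < \<nu>" "\<And>b. b \<in> ?L \<Longrightarrow> \<nu> * ?c b \<le> norm (tensor_power_map b t)"
    using semistable_lower_bound[OF ss] by (metis mem_Collect_eq)
  have cpos: "0 < ?c b" if "b \<in> ?L" for b
    using that invertible_level_blockE[of b q] block_character_pos[of q b] by (metis mem_Collect_eq zero_less_power)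
  define X where "X = (\<lambda>b. norm (tensor_power_map b t) / ?c b) ` ?L"
  have one: "mat 1 \<in> ?L" by (auto simp: level_block_one invertible_def)
  have X: "X \<noteq> {}" using one by (auto simp: X_def)
  have lb: "\<nu> \<le> x" if "x \<in> X" for x
    using that \<nu>(2) cpos by (auto simp: X_def pos_le_divide_eq)
  define m where "m = Inf X"
  have m: "0 < m" using cInf_greatest[OF X lb] \<nu>(1) by (simp add: m_def)
  have mle: "m * ?c b \<le> norm (tensor_power_map b t)" if "b \<in> ?L" for b
  proof -
    have "m \<le> norm (tensor_power_map b t) / ?c b"
      unfolding m_def using that lb by (intro cInf_lower) (auto simp: X_def bdd_below_def)
    then show ?thesis using cpos[OF that] by (simp add: pos_le_divide_eq)
  qed
  have "\<exists>b\<in>?L. norm (tensor_power_map b t) < (m + inverse (real (Suc n))) * ?c b" for n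
  proof -
    have "Inf X < m + inverse (real (Suc n))" by (simp add: m_def)
    then obtain x where "x \<in> X" "x < m + inverse (real (Suc n))"
      using cInf_lessD[OF X] by blast
    then show ?thesis using cpos by (auto simp: X_def pos_divide_less_eq)
  qed
  then obtain b where b: "\<And>n. b n \<in> ?L"
    "\<And>n. norm (tensor_power_map (b n) t) < (m + inverse (real (Suc n))) * ?c (b n)"
    by metis
  define N where "N n = norm (tensor_power_map (b n) t)" for n
  have N: "0 < N n" for n
    using mle[OF b(1)[of n]] m cpos[OF b(1)[of n]] unfolding N_def by (meson less_le_trans mult_pos_pos)
  \<comment> \<open>The matrices \<open>b n\<close> of a minimising sequence may diverge, but the
    normalised tensors stay on the unit sphere and have a limit point.\<close>
  define x where "x n = (1 / N n) *\<^sub>R tensor_power_map (b n) t" for n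
  have xn: "norm (x n) = 1" for n using N[of n] by (simp add: x_def N_def)
  have xo: "x n \<in> closure (sym_orbit t)" for n
    unfolding x_def using N[of n] b(1)[of n]
    by (intro closure_orbit_scaleR closure_orbit_tensor_power_map subsetD[OF closure_subset sym_orbit_self]) auto
  have xh: "homogeneous q w (x n)" for n
    using homogeneous_level_block[OF hom, of "b n"] b(1)[of n] by (auto simp: x_def homogeneous_def)
  have "compact (sphere (0 :: ('k, 'd) tensor) 1)" by simp
  then obtain s r where s: "s \<in> sphere 0 1" "strict_mono (r :: nat \<Rightarrow> nat)" "(x \<circ> r) \<longlonglongrightarrow> s"
    using xn by (auto simp: compact_def dest!: spec[of _ x])
  have lim: "(\<lambda>n. x (r n)) \<longlonglongrightarrow> s" using s(3) by (simp add: o_def)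
  show thesis
  proof (rule that)
    show "s \<in> closure (sym_orbit t)"
      using closed_sequentially[OF closed_closure xo lim] .
    show "norm s = 1" using s(1) by simp
    show "homogeneous q w s" by (rule homogeneous_closed[OF lim xh])
    fix c assume "invertible c" "level_block q c"
    then have c: "c \<in> ?L" by simp
    \<comment> \<open>Near-minimality is inherited: \<open>c ** b n\<close> competes in the infimum
      m, \<open>b n\<close> comes within 1/(n+1) of it, and by multiplicativity the character of
      \<open>b n\<close> cancels.\<close>
    have le: "m * ?c c / (m + inverse (real (Suc n))) \<le> norm (tensor_power_map c (x n))" for n
    proof -
      have cb: "c ** b n \<in> ?L" using c b(1)[of n] by (auto intro: invertible_mult level_block_mult)
      have p: "0 < m + inverse (real (Suc n))" using m by (simp add: add_pos_pos)
      have "m * ?c c * N n \<le> m * ?c c * ((m + inverse (real (Suc n))) * ?c (b n))"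
        using b(2)[of n] m cpos[OF c] by (intro mult_left_mono) (auto simp: N_def)
      also have "\<dots> = (m + inverse (real (Suc n))) * (m * ?c (c ** b n))"
        using c b(1)[of n] by (simp add: block_character_mult power_mult_distrib mult_ac)
      also have "\<dots> \<le> (m + inverse (real (Suc n))) * norm (tensor_power_map (c ** b n) t)"
        using mle[OF cb] p by (intro mult_left_mono) auto
      also have "norm (tensor_power_map (c ** b n) t) = N n * norm (tensor_power_map c (x n))"
        using N[of n] by (simp add: x_def tensor_power_map_scaleR tensor_power_map_compose)
      finally have "N n * (m * ?c c) \<le> N n * (norm (tensor_power_map c (x n)) * (m + inverse (real (Suc n))))"
        by (simp only: mult_ac)
      then have "m * ?c c \<le> norm (tensor_power_map c (x n)) * (m + inverse (real (Suc n)))"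
        using N[of n] by (simp only: mult_le_cancel_left_pos)
      then show ?thesis using p by (simp only: pos_divide_le_eq)
    qed
    have "(\<lambda>n. m * ?c c / (m + inverse (real (Suc (r n))))) \<longlonglongrightarrow> m * ?c c / (m + 0)"
      using m LIMSEQ_subseq_LIMSEQ[OF LIMSEQ_inverse_real_of_nat s(2)]
      by (intro tendsto_divide tendsto_add tendsto_const) (auto simp: o_def)
    moreover have "(\<lambda>n. norm (tensor_power_map c (x (r n)))) \<longlonglongrightarrow> norm (tensor_power_map c s)"
      by (intro tendsto_norm tendsto_tensor_power_map lim tendsto_const)
    ultimately have "m * ?c c / (m + 0) \<le> norm (tensor_power_map c s)"
      by (rule LIMSEQ_le) (use le in blast)
    then show "?c c \<le> norm (tensor_power_map c s)" using m by simp
  qed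
qed

lemma prod_one_coordinate:
  fixes \<iota> :: "'k::finite \<Rightarrow> 'd"
  shows "(\<Prod>j\<in>UNIV. if \<iota> j = a then x else 1) = (x::real) ^ card {j. \<iota> j = a}"
  by (simp add: prod.If_cases)

text \<open>Off-diagonal entries are removed by a unitary rotation inside the blocks, which keeps
  minimality. What remains is one first-order condition per basis index.\<close>

lemma semistable_diagonal_marginal:
  fixes t :: "('k::finite, 'd::finite) tensor"
  assumes ss: "semistable q t" and hom: "homogeneous q w t" and w: "w \<noteq> 0"
  obtains s where "s \<in> closure (sym_orbit t)" "s \<noteq> 0" "homogeneous q w s"
    "average_marginal s = diag_mat (\<lambda>a. of_real (q a))"
proof -
  obtain u where u: "u \<in> closure (sym_orbit t)" "norm u = 1" "homogeneous q w u"
    and min: "\<And>b. invertible b \<Longrightarrow> level_block q b \<Longrightarrow> block_character q b ^ CARD('k) \<le> norm (tensor_power_map b u)"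
    using semistable_minimal_vector[OF ss hom] by metis
  obtain V where V: "unitary V" "level_block q V"
    "average_marginal (tensor_power_map V u) = diag_mat (\<lambda>a. of_real (diag_weight (tensor_power_map V u) a))"
    using average_marginal_diagonalise[OF homogeneous_level_block_average_marginal[OF u(3) w]] .
  define s where "s = tensor_power_map V u"
  have sn: "norm s = 1" unfolding s_def using norm_tensor_power_map_unitary[OF V(1)] u(2) by metis
  have "diag_weight s a = q a" for a
  proof -
    \<comment> \<open>The squared norm minus the matching power of the character, along the
      rescaling of coordinate a by exp \<tau>. It is nonnegative by minimality and zero at \<tau> =
      0, so its derivative vanishes there, which says that the diagonal weight at a is q a.\<close>
    define g where "g \<tau> = (\<Sum>\<iota>\<in>UNIV. (cmod (s $ \<iota>))\<^sup>2 * exp (2 * real (card {j. \<iota> j = a}) * \<tau>))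
        - exp (2 * real CARD('k) * q a * \<tau>)" for \<tau> :: real
    have g0: "g 0 = 0" using norm_vec_sq[of s] sn by (simp add: g_def)
    have "g \<tau> \<ge> 0" for \<tau>
    proof -
      define l where "l c = (if c = a then exp \<tau> else 1)" for c
      have l: "l c > 0" for c by (simp add: l_def)
      let ?D = "diag_mat (\<lambda>c. complex_of_real (l c))"
      have "invertible ?D" using l by (intro invertible_diag_mat) (simp add: less_imp_neq[THEN not_sym])
      then have "block_character q (?D ** V) ^ CARD('k) \<le> norm (tensor_power_map (?D ** V) u)"
        using V by (intro min invertible_mult level_block_mult level_block_diag) (auto intro: unitary_invertible)
      moreover have "block_character q (?D ** V) = exp (\<tau> * q a)"
      proof -
        have "block_character q (?D ** V) = (\<Prod>c\<in>UNIV. l c powr q c)"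
          using V l by (simp add: block_character_mult level_block_diag block_character_unitary block_character_diag)
        also have "\<dots> = (\<Prod>c\<in>UNIV. if c = a then exp (\<tau> * q a) else 1)"
          by (intro prod.cong) (auto simp: l_def powr_def mult.commute)
        finally show ?thesis by simp
      qed
      ultimately have "exp (\<tau> * q a) ^ CARD('k) \<le> norm (tensor_power_map ?D s)"
        by (simp add: s_def tensor_power_map_compose)
      then have "(exp (\<tau> * q a) ^ CARD('k))\<^sup>2 \<le> (norm (tensor_power_map ?D s))\<^sup>2"
        by (intro power_mono) auto
      also have "(norm (tensor_power_map ?D s))\<^sup>2 = (\<Sum>\<iota>\<in>UNIV. (cmod (s $ \<iota>))\<^sup>2 * exp (2 * real (card {j. \<iota> j = a}) * \<tau>))"
      proof -
        have "(cmod (tensor_power_map ?D s $ \<iota>))\<^sup>2 = (cmod (s $ \<iota>))\<^sup>2 * exp (2 * real (card {j. \<iota> j = a}) * \<tau>)" for \<iota>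
        proof -
          have "cmod (tensor_power_map ?D s $ \<iota>) = (\<Prod>j\<in>UNIV. l (\<iota> j)) * cmod (s $ \<iota>)"
            using l by (simp add: tensor_power_map_diag norm_mult prod_norm[symmetric] abs_of_pos)
          also have "\<dots> = (\<Prod>j\<in>UNIV. if \<iota> j = a then exp \<tau> else 1) * cmod (s $ \<iota>)"
            by (simp add: l_def)
          also have "\<dots> = exp (real (card {j. \<iota> j = a}) * \<tau>) * cmod (s $ \<iota>)"
            unfolding prod_one_coordinate by (simp add: exp_of_nat_mult)
          finally show ?thesis by (simp add: power_mult_distrib mult_ac flip: exp_double)
        qed
        then show ?thesis by (simp add: norm_vec_sq)
      qed
      also have "(exp (\<tau> * q a) ^ CARD('k))\<^sup>2 = exp (2 * real CARD('k) * q a * \<tau>)"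
        by (simp add: exp_of_nat_mult[symmetric] mult_ac flip: exp_double)
      finally show ?thesis by (simp add: g_def)
    qed
    moreover have "(g has_real_derivative ((\<Sum>\<iota>\<in>UNIV. (cmod (s $ \<iota>))\<^sup>2 * (2 * real (card {j. \<iota> j = a})))
        - 2 * real CARD('k) * q a)) (at 0)"
      unfolding g_def by (auto intro!: derivative_eq_intros sum.cong)
    ultimately have "(\<Sum>\<iota>\<in>UNIV. (cmod (s $ \<iota>))\<^sup>2 * (2 * real (card {j. \<iota> j = a}))) - 2 * real CARD('k) * q a = 0"
      using g0 by (intro DERIV_local_min[of g _ 0 1]) auto
    then have "2 * (\<Sum>\<iota>\<in>UNIV. (cmod (s $ \<iota>))\<^sup>2 * real (card {j. \<iota> j = a})) = 2 * (real CARD('k) * q a)"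
      by (simp add: sum_distrib_left mult_ac)
    then show ?thesis by (simp add: diag_weight_def sn)
  qed
  then have eq: "diag_weight s = q" by (rule ext)
  have "average_marginal s = diag_mat (\<lambda>a. of_real (q a))"
    unfolding V(3)[folded s_def] eq ..
  moreover have "s \<in> closure (sym_orbit t)"
    unfolding s_def by (intro closure_orbit_tensor_power_map u unitary_invertible V)
  moreover have "s \<noteq> 0" using sn by auto
  moreover have "homogeneous q w s" unfolding s_def by (intro homogeneous_level_block u V)
  ultimately show thesis by (intro that[of s])
qed

subsection \<open>Strong duality\<close>

lemma tensor_power_map_eq_0_iff:
  assumes "invertible A"
  shows "tensor_power_map A f = 0 \<longleftrightarrow> f = 0"
  using assms unfolding invertible_def
  by (metis tensor_power_map_compose tensor_power_map_one tensor_power_map_zero)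

lemma dual_feasible_le_one:
  fixes f :: "('k::finite, 'd::finite) tensor"
  assumes "dual_feasible B q w f" "f \<noteq> 0"
  shows "w \<le> 1"
proof -
  note fe = assms(1)[unfolded dual_feasible_def]
  have "tensor_power_map B f \<noteq> 0" using fe assms(2) by (simp add: tensor_power_map_eq_0_iff)
  then obtain \<iota> where "tensor_power_map B f $ \<iota> \<noteq> 0" by (auto simp: vec_eq_iff)
  then have "w \<le> (\<Prod>j\<in>UNIV. q (\<iota> j))" using fe by (auto simp: supported_def)
  moreover have "q a \<le> 1" for a
    using fe member_le_sum[of a UNIV q] by simp
  then have "(\<Prod>j\<in>UNIV. q (\<iota> j)) \<le> 1" using fe by (intro prod_le_1) auto
  ultimately show ?thesis by simp
qed

text \<open>The invertible matrices are not compact, but B matters only through the support of B f,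
  one of finitely many sets of multi-indices. For each support the admissible pairs (q, w) with 0
  \<le> w \<le> 1 form a compact set.\<close>

lemma dual_optimum_exists:
  fixes f :: "('k::finite, 'd::finite) tensor"
  assumes "f \<noteq> 0"
  obtains B q w where "dual_feasible B q w f" "\<And>B' q' w'. dual_feasible B' q' w' f \<Longrightarrow> w' \<le> w"
proof -
  define supp where "supp B = {\<iota>. tensor_power_map B f $ \<iota> \<noteq> 0}" for B :: "complex ^ 'd ^ 'd"
  define K where "K S = (cbox 0 1 \<times> {0..1}) \<inter>
    {p :: (real ^ 'd) \<times> real. (\<Sum>a\<in>UNIV. fst p $ a) = 1 \<and> (\<forall>\<iota>\<in>S. snd p \<le> (\<Prod>j\<in>UNIV. fst p $ \<iota> j))}"
    for S :: "('k \<Rightarrow> 'd) set"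
  have "compact (K S)" for S
  proof -
    have "{p :: (real ^ 'd) \<times> real. (\<Sum>a\<in>UNIV. fst p $ a) = 1 \<and> (\<forall>\<iota>\<in>S. snd p \<le> (\<Prod>j\<in>UNIV. fst p $ \<iota> j))}
      = {p. (\<Sum>a\<in>UNIV. fst p $ a) = 1} \<inter> (\<Inter>\<iota>\<in>S. {p. snd p \<le> (\<Prod>j\<in>UNIV. fst p $ \<iota> j)})"
      by auto
    moreover have "closed {p :: (real ^ 'd) \<times> real. (\<Sum>a\<in>UNIV. fst p $ a) = 1}"
      by (intro closed_Collect_eq continuous_intros)
    moreover have "closed {p :: (real ^ 'd) \<times> real. snd p \<le> (\<Prod>j\<in>UNIV. fst p $ \<iota> j)}" for \<iota> :: "'k \<Rightarrow> 'd"
      by (intro closed_Collect_le continuous_intros)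
    ultimately show ?thesis unfolding K_def
      by (simp only:) (intro compact_Int_closed compact_Times compact_cbox compact_Icc closed_Int closed_INT ballI)
  qed
  define KK where "KK = (\<Union>S\<in>supp ` Collect invertible. K S)"
  have cpt: "compact KK"
    unfolding KK_def using \<open>\<And>S. compact (K S)\<close> by (intro compact_UN) auto
  have memK: "p \<in> K (supp B) \<longleftrightarrow> (\<forall>a. 0 \<le> fst p $ a) \<and> (\<Sum>a\<in>UNIV. fst p $ a) = 1 \<and> 0 \<le> snd p \<and> snd p \<le> 1 \<and>
      supported (\<lambda>a. fst p $ a) (snd p) (tensor_power_map B f)" for p B
  proof -
    have "fst p $ a \<le> 1" if "\<forall>a. 0 \<le> fst p $ a" "(\<Sum>a\<in>UNIV. fst p $ a) = 1" for a
      using that member_le_sum[of a UNIV "\<lambda>a. fst p $ a"] by simp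
    then show ?thesis
      by (auto simp: K_def supp_def supported_def mem_box_cart mem_Times_iff)
  qed
  \<comment> \<open>The uniform distribution is feasible for every tensor, with threshold d to the
    power -k. The compact sets contain pairs with w = 0, and comparison with \<open>u\<close> shows
    that the maximum is positive.\<close>
  define u :: "(real ^ 'd) \<times> real" where "u = ((\<chi> a. 1 / real CARD('d)), (1 / real CARD('d)) ^ CARD('k))"
  have inv1: "invertible (mat 1 :: complex ^ 'd ^ 'd)" by (auto simp: invertible_def)
  have u: "u \<in> K (supp (mat 1))" "0 < snd u"
    unfolding memK by (auto simp: u_def supported_def power_le_one)
  then have ne: "KK \<noteq> {}" using inv1 by (auto simp: KK_def)
  have "continuous_on KK snd"
    by (intro continuous_on_snd continuous_on_id)
  then obtain p where p: "p \<in> KK"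
    and max: "\<And>p'. p' \<in> KK \<Longrightarrow> snd p' \<le> snd p"
    using continuous_attains_sup[OF cpt ne, of snd] by blast
  obtain B where B: "invertible B" "p \<in> K (supp B)" using p by (auto simp: KK_def)
  have "u \<in> KK" using u inv1 by (auto simp: KK_def)
  then have "0 < snd p" using max[of u] u(2) by simp
  then have "dual_feasible B (\<lambda>a. fst p $ a) (snd p) f"
    using B by (auto simp: memK dual_feasible_def)
  moreover have "w' \<le> snd p" if "dual_feasible B' q' w' f" for B' q' w'
  proof -
    have "((\<chi> a. q' a), w') \<in> K (supp B')" "invertible B'"
      using that dual_feasible_le_one[OF that assms] by (auto simp: memK dual_feasible_def)
    then have "((\<chi> a. q' a), w') \<in> KK" by (auto simp: KK_def)
    then show ?thesis using max by fastforce
  qed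
  ultimately show thesis by (rule that)
qed

definition face :: "('d \<Rightarrow> real) \<Rightarrow> real \<Rightarrow> ('k::finite, 'd::finite) tensor \<Rightarrow> ('k, 'd) tensor" where
  "face q w t = (\<chi> \<iota>. if (\<Prod>j\<in>UNIV. q (\<iota> j)) = w then t $ \<iota> else 0)"

text \<open>The diagonal matrix with entries root w / q a, raised to the power n, multiplies the
  coordinate at \<iota> by the n-th power of w / \<Prod>_j q(\<iota> j). This is 1 on the face and
  tends to 0 at the other points of the support.\<close>

lemma face_in_closure:
  fixes t :: "('k::finite, 'd::finite) tensor"
  assumes sup: "supported q w t" and w: "0 < w" and q: "\<And>a. 0 \<le> q a"
  shows "face q w t \<in> closure (sym_orbit t)"
proof -
  \<comment> \<open>Where q vanishes the entry is set to 1 to keep the matrix invertible; since w >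
    0, such an index occurs in no multi-index of the support.\<close>
  define l where "l n a = (if q a = 0 then 1 else complex_of_real ((root CARD('k) w / q a) ^ n))" for n :: nat and a
  have inv: "invertible (diag_mat (l n))" for n
    using w by (intro invertible_diag_mat) (auto simp: l_def)
  have val: "tensor_power_map (diag_mat (l n)) t $ \<iota> = complex_of_real ((w / (\<Prod>j\<in>UNIV. q (\<iota> j))) ^ n) * t $ \<iota>" for n \<iota>
  proof (cases "t $ \<iota> = 0")
    case False
    then have pos: "0 < q (\<iota> j)" for j using supported_pos[OF sup w q] by blast
    have "(\<Prod>j\<in>UNIV. l n (\<iota> j)) = complex_of_real (\<Prod>j\<in>UNIV. (root CARD('k) w / q (\<iota> j)) ^ n)"
      unfolding of_real_prod using pos by (intro prod.cong) (auto simp: l_def less_imp_neq[THEN not_sym])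
    also have "(\<Prod>j\<in>UNIV. (root CARD('k) w / q (\<iota> j)) ^ n) = (w / (\<Prod>j\<in>UNIV. q (\<iota> j))) ^ n"
      using w by (simp add: prod_power_distrib[symmetric] prod_dividef real_root_pow_pos2)
    finally show ?thesis by (simp add: tensor_power_map_diag)
  qed (simp add: tensor_power_map_diag)
  have "(\<lambda>n. complex_of_real ((w / (\<Prod>j\<in>UNIV. q (\<iota> j))) ^ n) * t $ \<iota>) \<longlonglongrightarrow> face q w t $ \<iota>" for \<iota>
  proof (cases "t $ \<iota> = 0")
    case True
    then show ?thesis by (simp add: face_def)
  next
    case False
    then have le: "w \<le> (\<Prod>j\<in>UNIV. q (\<iota> j))" using sup by (auto simp: supported_def)
    show ?thesis
    proof (cases "(\<Prod>j\<in>UNIV. q (\<iota> j)) = w")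
      case True
      then show ?thesis using w by (simp add: face_def)
    next
      case False
      have "(\<lambda>n. (w / (\<Prod>j\<in>UNIV. q (\<iota> j))) ^ n) \<longlonglongrightarrow> 0"
        using le w False by (intro LIMSEQ_realpow_zero) auto
      then have "(\<lambda>n. complex_of_real ((w / (\<Prod>j\<in>UNIV. q (\<iota> j))) ^ n) * t $ \<iota>) \<longlonglongrightarrow> of_real 0 * t $ \<iota>"
        by (intro tendsto_mult tendsto_of_real tendsto_const)
      then show ?thesis using False by (simp add: face_def)
    qed
  qed
  then have "(\<lambda>n. tensor_power_map (diag_mat (l n)) t) \<longlonglongrightarrow> face q w t"
    by (intro vec_tendstoI) (simp add: val)
  then show ?thesis
    using sym_orbit_tensor_power_map[OF sym_orbit_self inv] unfolding closure_sequential
    by (intro exI[of _ "\<lambda>n. tensor_power_map (diag_mat (l n)) t"]) blast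
qed

text \<open>If the face were destabilised by a direction \<open>x\<close>, moving \<open>q\<close> in that direction would
  improve the optimum.\<close>

lemma dual_optimum_semistable:
  fixes f :: "('k::finite, 'd::finite) tensor"
  assumes nz: "f \<noteq> 0" and feas: "dual_feasible B q w f"
    and opt: "\<And>B' q' w'. dual_feasible B' q' w' f \<Longrightarrow> w' \<le> w"
  shows "semistable q (face q w (tensor_power_map B f))"
proof (rule ccontr)
  note fe = feas[unfolded dual_feasible_def]
  define t where "t = tensor_power_map B f"
  assume "\<not> ?thesis"
  then obtain A x where A: "unitary A" "level_block q A"
    and x: "\<And>\<iota>. tensor_power_map A (face q w t) $ \<iota> \<noteq> 0 \<Longrightarrow>
      (\<Sum>j\<in>UNIV. x (\<iota> j)) < real CARD('k) * (\<Sum>a\<in>UNIV. q a * x a)"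
    by (auto simp: semistable_def t_def not_le)
  define m where "m = (\<Sum>a\<in>UNIV. q a * x a)"
  define y where "y a = x a - m" for a
  have "(\<Sum>a\<in>UNIV. q a * y a) = (\<Sum>a\<in>UNIV. q a * x a) - (\<Sum>a\<in>UNIV. q a) * m"
    by (simp add: y_def right_diff_distrib sum_subtractf sum_distrib_right)
  then have qy: "(\<Sum>a\<in>UNIV. q a * y a) = 0" using fe by (simp add: m_def)
  \<comment> \<open>Since y has mean zero under q, \<open>p e\<close> keeps total mass one. The
    minus sign fits the destabilising direction: on the face the sums of y are negative, so the
    products increase with e.\<close>
  define p where "p e a = q a * (1 - e * y a)" for e a
  have psum: "(\<Sum>a\<in>UNIV. p e a) = 1" for e
  proof -
    have "(\<Sum>a\<in>UNIV. p e a) = (\<Sum>a\<in>UNIV. q a) - e * (\<Sum>a\<in>UNIV. q a * y a)"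
      by (simp add: p_def algebra_simps sum_subtractf sum_distrib_left)
    then show ?thesis using fe qy by simp
  qed
  have AB: "invertible (A ** B)" using fe A by (intro invertible_mult) (auto intro: unitary_invertible)
  define z where "z = tensor_power_map A t"
  have zsup: "supported q w z"
    unfolding z_def t_def using fe A(2) by (intro supported_triangular[where R = A]) (auto simp: level_block_def)
  \<comment> \<open>A mixes only coordinates with equal q, so it preserves the product of q along a
    multi-index. Hence applying A commutes with passing to the face.\<close>
  have zface: "tensor_power_map A (face q w t) $ \<iota> = z $ \<iota>" if "(\<Prod>j\<in>UNIV. q (\<iota> j)) = w" for \<iota>
  proof -
    have "(\<Prod>j\<in>UNIV. A $ \<iota> j $ \<kappa> j) * face q w t $ \<kappa> = (\<Prod>j\<in>UNIV. A $ \<iota> j $ \<kappa> j) * t $ \<kappa>" for \<kappa>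
    proof (cases "\<forall>j. A $ \<iota> j $ \<kappa> j \<noteq> 0")
      case True
      then have "q (\<kappa> j) = q (\<iota> j)" for j using A(2) unfolding level_block_def by metis
      then show ?thesis using that by (simp add: face_def)
    next
      case False
      then have "(\<Prod>j\<in>UNIV. A $ \<iota> j $ \<kappa> j) = 0" by auto
      then show ?thesis by simp
    qed
    then show ?thesis unfolding z_def tensor_power_map_def by (simp only: vec_lambda_beta)
  qed
  \<comment> \<open>On the face the derivative of the product at e = 0 is - w \<Sum>_j y(\<iota> j)
    > 0. Off the face the product exceeds w strictly, and by continuity small e preserves that
    gap.\<close>
  have improve: "\<forall>\<^sub>F e in at_right 0. z $ \<iota> \<noteq> 0 \<longrightarrow> w < (\<Prod>j\<in>UNIV. p e (\<iota> j))" for \<iota>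
  proof (cases "z $ \<iota> = 0")
    case False
    then have le: "w \<le> (\<Prod>j\<in>UNIV. q (\<iota> j))" using zsup by (auto simp: supported_def)
    show ?thesis
    proof (cases "(\<Prod>j\<in>UNIV. q (\<iota> j)) = w")
      case True
      have "(\<Sum>j\<in>UNIV. y (\<iota> j)) < 0"
        using x[of \<iota>] zface[OF True] False by (simp add: y_def sum_subtractf m_def)
      then have neg: "0 < (\<Sum>j\<in>UNIV. - y (\<iota> j))" by (simp add: sum_negf)
      define h where "h e = (\<Prod>j\<in>UNIV. 1 - e * y (\<iota> j))" for e
      have "(h has_real_derivative (\<Sum>j\<in>UNIV. - y (\<iota> j) * (\<Prod>i\<in>UNIV - {j}. 1 - 0 * y (\<iota> i)))) (at 0)"
        unfolding h_def by (rule has_field_derivative_prod) (auto intro!: derivative_eq_intros)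
      then have "(h has_real_derivative (\<Sum>j\<in>UNIV. - y (\<iota> j))) (at 0)" by simp
      then obtain d where "d > 0" "\<And>e. 0 < e \<Longrightarrow> e < d \<Longrightarrow> h 0 < h (0 + e)"
        using DERIV_pos_inc_right[OF _ neg] by blast
      then have "\<forall>\<^sub>F e in at_right 0. 1 < h e"
        by (auto simp: eventually_at_right_field h_def intro!: exI[of _ d])
      moreover have "(\<Prod>j\<in>UNIV. p e (\<iota> j)) = w * h e" for e
        by (simp add: p_def h_def prod.distrib True)
      ultimately show ?thesis using fe by (auto elim!: eventually_mono)
    next
      case neq: False
      have "((\<lambda>e. \<Prod>j\<in>UNIV. p e (\<iota> j)) \<longlongrightarrow> (\<Prod>j\<in>UNIV. q (\<iota> j) * (1 - 0 * y (\<iota> j)))) (at_right 0)"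
        unfolding p_def by (intro tendsto_intros)
      then have "\<forall>\<^sub>F e in at_right 0. w < (\<Prod>j\<in>UNIV. p e (\<iota> j))"
        using le neq by (intro order_tendstoD) auto
      then show ?thesis by (auto elim!: eventually_mono)
    qed
  qed simp
  have "\<forall>\<^sub>F e in at_right 0. 0 \<le> p e a" for a
  proof -
    have "((\<lambda>e. 1 - e * y a) \<longlongrightarrow> 1 - 0 * y a) (at_right 0)" by (intro tendsto_intros)
    then have "\<forall>\<^sub>F e in at_right 0. 0 < 1 - e * y a" by (intro order_tendstoD) auto
    then show ?thesis using fe by (auto simp: p_def elim!: eventually_mono)
  qed
  then have "\<forall>\<^sub>F e in at_right (0::real). \<forall>a. 0 \<le> p e a" by (rule eventually_all_finite)
  moreover have "\<forall>\<^sub>F e in at_right (0::real). \<forall>\<iota>. z $ \<iota> \<noteq> 0 \<longrightarrow> w < (\<Prod>j\<in>UNIV. p e (\<iota> j))"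
    using improve by (rule eventually_all_finite)
  ultimately have "\<forall>\<^sub>F e in at_right (0::real). (\<forall>a. 0 \<le> p e a) \<and> (\<forall>\<iota>. z $ \<iota> \<noteq> 0 \<longrightarrow> w < (\<Prod>j\<in>UNIV. p e (\<iota> j)))"
    by (rule eventually_conj)
  then have "\<exists>e. (\<forall>a. 0 \<le> p e a) \<and> (\<forall>\<iota>. z $ \<iota> \<noteq> 0 \<longrightarrow> w < (\<Prod>j\<in>UNIV. p e (\<iota> j)))"
    by (intro eventually_happens'[of "at_right (0::real)"]) simp_all
  then obtain e where e: "\<And>a. 0 \<le> p e a" "\<And>\<iota>. z $ \<iota> \<noteq> 0 \<Longrightarrow> w < (\<Prod>j\<in>UNIV. p e (\<iota> j))"
    by blast
  \<comment> \<open>The support is finite, so the strict improvements have a least value, which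
    serves as a larger threshold.\<close>
  define S where "S = (\<lambda>\<iota>. \<Prod>j\<in>UNIV. p e (\<iota> j)) ` {\<iota>. z $ \<iota> \<noteq> 0}"
  have zAB: "z = tensor_power_map (A ** B) f" by (simp add: z_def t_def tensor_power_map_compose)
  then have znz: "z \<noteq> 0" using nz AB by (simp add: tensor_power_map_eq_0_iff)
  from znz have S: "finite S" "S \<noteq> {}" by (auto simp: S_def vec_eq_iff)
  then have "w < Min S" using e(2) by (auto simp: S_def)
  moreover have "supported (p e) (Min S) z"
    using S unfolding supported_def S_def by (auto intro!: Min_le)
  ultimately have "dual_feasible (A ** B) (p e) (Min S) f"
    using AB e(1) psum fe zAB by (auto simp: dual_feasible_def)
  then show False using opt \<open>w < Min S\<close> by fastforce
qed

theorem certificate_exists: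
  fixes f :: "('k::finite, 'd::finite) tensor"
  assumes "f \<noteq> 0"
  obtains q w where "certificate f q w"
proof -
  obtain B q w where feas: "dual_feasible B q w f" and opt: "\<And>B' q' w'. dual_feasible B' q' w' f \<Longrightarrow> w' \<le> w"
    by (rule dual_optimum_exists[OF assms]) blast
  note fe = feas[unfolded dual_feasible_def]
  define t where "t = tensor_power_map B f"
  have ss: "semistable q (face q w t)"
    unfolding t_def by (rule dual_optimum_semistable[OF assms feas opt])
  have hom: "homogeneous q w (face q w t)" by (simp add: homogeneous_def face_def)
  have w0: "w \<noteq> 0" using fe by simp
  obtain s where s: "s \<in> closure (sym_orbit (face q w t))" "s \<noteq> 0" "homogeneous q w s"
    "average_marginal s = diag_mat (\<lambda>a. of_real (q a))"
    using semistable_diagonal_marginal[OF ss hom w0] by blast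
  have "t \<in> closure (sym_orbit f)"
    unfolding t_def using fe by (intro subsetD[OF closure_subset] sym_orbit_tensor_power_map sym_orbit_self) auto
  moreover have "face q w t \<in> closure (sym_orbit t)"
    using fe by (intro face_in_closure) (auto simp: t_def)
  ultimately have sf: "s \<in> closure (sym_orbit f)"
    using s(1) closure_orbit_trans by blast
  have dw: "q a = diag_weight s a" for a
  proof -
    have "complex_of_real (diag_weight s a) = of_real (q a)"
      by (simp add: average_marginal_diag[symmetric] s(4))
    then show ?thesis by simp
  qed
  \<comment> \<open>On the support of s the sum of the log q(\<iota> j) is the constant log w, so
    its expectation is the same for whatever weights s puts there.\<close>
  have "(\<Sum>a\<in>UNIV. q a * log 2 (q a))
      = (\<Sum>\<iota>\<in>UNIV. (cmod (s $ \<iota>))\<^sup>2 * (\<Sum>j\<in>UNIV. log 2 (q (\<iota> j)))) / (real CARD('k) * (norm s)\<^sup>2)"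
    using sum_diag_weight[of s "\<lambda>a. log 2 (q a)"] by (simp add: dw[symmetric])
  also have "(\<Sum>\<iota>\<in>UNIV. (cmod (s $ \<iota>))\<^sup>2 * (\<Sum>j\<in>UNIV. log 2 (q (\<iota> j)))) = (\<Sum>\<iota>\<in>UNIV. (cmod (s $ \<iota>))\<^sup>2 * log 2 w)"
  proof (intro sum.cong refl)
    fix \<iota>
    show "(cmod (s $ \<iota>))\<^sup>2 * (\<Sum>j\<in>UNIV. log 2 (q (\<iota> j))) = (cmod (s $ \<iota>))\<^sup>2 * log 2 w"
    proof (cases "s $ \<iota> = 0")
      case False
      have "supported q w s" using s(3) by (auto simp: supported_def homogeneous_def)
      then have "0 < q (\<iota> j)" for j using supported_pos False fe by metis
      then have "(\<Sum>j\<in>UNIV. log 2 (q (\<iota> j))) = log 2 (\<Prod>j\<in>UNIV. q (\<iota> j))"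
        using log_prod_pos[of "\<lambda>j. q (\<iota> j)"] by simp
      then show ?thesis using s(3) False by (simp add: homogeneous_def)
    qed simp
  qed
  also have "\<dots> / (real CARD('k) * (norm s)\<^sup>2) = log 2 w / real CARD('k)"
    using s(2) by (simp add: norm_vec_sq[of s, symmetric] flip: sum_distrib_right)
  finally have "- (\<Sum>a\<in>UNIV. q a * log 2 (q a)) = - log 2 w / real CARD('k)" by simp
  then have "certificate f q w"
    unfolding certificate_def using feas sf s by blast
  then show thesis by (rule that)
qed

subsection \<open>Direct sums\<close>

lemma all_left_iff: "(\<forall>j. isl (\<iota> j)) \<longleftrightarrow> \<iota> \<in> range (\<lambda>\<kappa>. Inl \<circ> \<kappa>)"
proof
  assume "\<forall>j. isl (\<iota> j)"
  then have "\<iota> = Inl \<circ> (projl \<circ> \<iota>)" by (auto simp: fun_eq_iff)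
  then show "\<iota> \<in> range (\<lambda>\<kappa>. Inl \<circ> \<kappa>)" by blast
qed auto

lemma all_right_iff: "(\<forall>j. \<not> isl (\<iota> j)) \<longleftrightarrow> \<iota> \<in> range (\<lambda>\<kappa>. Inr \<circ> \<kappa>)"
proof
  assume "\<forall>j. \<not> isl (\<iota> j)"
  then have "\<iota> = Inr \<circ> (projr \<circ> \<iota>)" by (auto simp: fun_eq_iff)
  then show "\<iota> \<in> range (\<lambda>\<kappa>. Inr \<circ> \<kappa>)" by blast
qed auto

lemma inj_comp_left: "inj h \<Longrightarrow> inj (\<lambda>\<kappa>. h \<circ> \<kappa>)"
  by (auto simp: inj_def fun_eq_iff)

lemma sum_range_comp:
  fixes F :: "('k::finite \<Rightarrow> 'a::finite) \<Rightarrow> 'b::comm_monoid_add"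
  assumes "inj h" "\<And>\<iota>. \<iota> \<in> I \<Longrightarrow> \<iota> \<notin> range (\<lambda>\<kappa>. h \<circ> \<kappa>) \<Longrightarrow> F \<iota> = 0"
  shows "sum F I = (\<Sum>\<kappa> | h \<circ> \<kappa> \<in> I. F (h \<circ> \<kappa>))"
proof -
  have "sum F I = sum F ((\<lambda>\<kappa>. h \<circ> \<kappa>) ` {\<kappa>. h \<circ> \<kappa> \<in> I})"
    by (rule sum.mono_neutral_right) (use assms(2) in auto)
  also have "\<dots> = (\<Sum>\<kappa> | h \<circ> \<kappa> \<in> I. F (h \<circ> \<kappa>))"
    by (subst sum.reindex) (auto intro: inj_on_subset[OF inj_comp_left[OF assms(1)]])
  finally show ?thesis .
qed

lemma sum_sum_range:
  fixes F :: "('k::finite \<Rightarrow> 'd::finite + 'e::finite) \<Rightarrow> 'b::comm_monoid_add"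
  assumes "\<And>\<iota>. \<iota> \<notin> range (\<lambda>\<kappa>. Inl \<circ> \<kappa>) \<Longrightarrow> \<iota> \<notin> range (\<lambda>\<kappa>. Inr \<circ> \<kappa>) \<Longrightarrow> F \<iota> = 0"
  shows "sum F UNIV = (\<Sum>\<kappa>\<in>UNIV. F (Inl \<circ> \<kappa>)) + (\<Sum>\<kappa>\<in>UNIV. F (Inr \<circ> \<kappa>))"
proof -
  let ?L = "range (\<lambda>\<kappa> :: 'k \<Rightarrow> 'd. Inl \<circ> \<kappa> :: 'k \<Rightarrow> 'd + 'e)"
  let ?R = "range (\<lambda>\<kappa> :: 'k \<Rightarrow> 'e. Inr \<circ> \<kappa> :: 'k \<Rightarrow> 'd + 'e)"
  have disj: "?L \<inter> ?R = {}" by (auto simp: fun_eq_iff)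
  have "sum F UNIV = sum F (?L \<union> ?R)"
    by (rule sum.mono_neutral_right) (use assms in auto)
  also have "\<dots> = sum F ?L + sum F ?R" by (rule sum.union_disjoint) (use disj in auto)
  finally show ?thesis by (simp add: sum.reindex inj_comp_left)
qed

lemma tensor_direct_sum_Inl [simp]: "tensor_direct_sum f g $ (Inl \<circ> \<kappa>) = f $ \<kappa>"
  by (simp add: tensor_direct_sum_def o_def)

lemma tensor_direct_sum_Inr [simp]: "tensor_direct_sum f g $ (Inr \<circ> \<kappa>) = g $ \<kappa>"
  by (simp add: tensor_direct_sum_def o_def)

lemma tensor_direct_sum_mixed:
  "\<iota> \<notin> range (\<lambda>\<kappa>. Inl \<circ> \<kappa>) \<Longrightarrow> \<iota> \<notin> range (\<lambda>\<kappa>. Inr \<circ> \<kappa>) \<Longrightarrow> tensor_direct_sum f g $ \<iota> = 0"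
  unfolding all_left_iff[symmetric] all_right_iff[symmetric] by (simp add: tensor_direct_sum_def) blast

lemma tensor_sum_eqI:
  fixes x y :: "('k::finite, 'd::finite + 'e::finite) tensor"
  assumes "\<And>\<kappa>. x $ (Inl \<circ> \<kappa>) = y $ (Inl \<circ> \<kappa>)" "\<And>\<kappa>. x $ (Inr \<circ> \<kappa>) = y $ (Inr \<circ> \<kappa>)"
    "\<And>\<iota>. \<iota> \<notin> range (\<lambda>\<kappa>. Inl \<circ> \<kappa>) \<Longrightarrow> \<iota> \<notin> range (\<lambda>\<kappa>. Inr \<circ> \<kappa>) \<Longrightarrow> x $ \<iota> = y $ \<iota>"
  shows "x = y"
  unfolding vec_eq_iff using assms by (metis rangeE)

definition block_sum :: "complex ^ 'd ^ 'd \<Rightarrow> complex ^ 'e ^ 'e \<Rightarrow> complex ^ ('d + 'e) ^ ('d + 'e)" where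
  "block_sum A B = (\<chi> i j. case i of
      Inl a \<Rightarrow> (case j of Inl b \<Rightarrow> A $ a $ b | Inr b \<Rightarrow> 0)
    | Inr a \<Rightarrow> (case j of Inl b \<Rightarrow> 0 | Inr b \<Rightarrow> B $ a $ b))"

lemma block_sum_nth [simp]:
  "block_sum A B $ Inl a $ Inl b = A $ a $ b" "block_sum A B $ Inl a $ Inr d = 0"
  "block_sum A B $ Inr c $ Inl b = 0" "block_sum A B $ Inr c $ Inr d = B $ c $ d"
  by (simp_all add: block_sum_def)

lemma all_sum_iff: "(\<forall>i. P i) \<longleftrightarrow> (\<forall>a. P (Inl a)) \<and> (\<forall>b. P (Inr b))"
  by (metis sum.exhaust)

lemma sum_UNIV_sum_type:
  fixes F :: "'d::finite + 'e::finite \<Rightarrow> 'b::comm_monoid_add"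
  shows "sum F UNIV = (\<Sum>a\<in>UNIV. F (Inl a)) + (\<Sum>b\<in>UNIV. F (Inr b))"
  unfolding UNIV_Plus_UNIV[symmetric] by (subst sum.Plus) (simp_all add: o_def)

lemma block_sum_mult: "block_sum A B ** block_sum C D = block_sum (A ** C) (B ** D)"
  by (simp add: vec_eq_iff all_sum_iff matrix_matrix_mult_def sum_UNIV_sum_type)

lemma block_sum_one: "block_sum (mat 1) (mat 1) = mat 1"
  by (simp add: vec_eq_iff all_sum_iff mat_def)

lemma invertible_block_sum:
  assumes "invertible A" "invertible B"
  shows "invertible (block_sum A B)"
  using assms unfolding invertible_def by (metis block_sum_mult block_sum_one)

text \<open>At a mixed multi-index, and against the wrong summand, each product over the factors
  contains an entry of a zero block.\<close>

lemma tensor_power_map_block_sum: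
  fixes f :: "('k::finite, 'd::finite) tensor" and g :: "('k, 'e::finite) tensor"
  shows "tensor_power_map (block_sum A B) (tensor_direct_sum f g)
    = tensor_direct_sum (tensor_power_map A f) (tensor_power_map B g)"
proof -
  let ?M = "block_sum A B"
  let ?s = "tensor_direct_sum f g"
  have exp: "tensor_power_map ?M ?s $ \<iota>
      = (\<Sum>\<kappa>\<in>UNIV. (\<Prod>j\<in>UNIV. ?M $ \<iota> j $ Inl (\<kappa> j)) * f $ \<kappa>)
        + (\<Sum>\<kappa>\<in>UNIV. (\<Prod>j\<in>UNIV. ?M $ \<iota> j $ Inr (\<kappa> j)) * g $ \<kappa>)" for \<iota>
    unfolding tensor_power_map_def vec_lambda_beta
    by (subst sum_sum_range) (simp_all add: tensor_direct_sum_mixed)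
  have z: "prod F UNIV = 0" if "F j = 0" for F :: "'k \<Rightarrow> complex" and j
    using that by (intro prod_zero) auto
  show ?thesis
  proof (rule tensor_sum_eqI)
    fix \<kappa>
    show "tensor_power_map ?M ?s $ (Inl \<circ> \<kappa>) = tensor_direct_sum (tensor_power_map A f) (tensor_power_map B g) $ (Inl \<circ> \<kappa>)"
      unfolding exp tensor_direct_sum_Inl by (simp add: tensor_power_map_def power_0_left)
  next
    fix \<kappa>
    show "tensor_power_map ?M ?s $ (Inr \<circ> \<kappa>) = tensor_direct_sum (tensor_power_map A f) (tensor_power_map B g) $ (Inr \<circ> \<kappa>)"
      unfolding exp tensor_direct_sum_Inr by (simp add: tensor_power_map_def power_0_left)
  next
    fix \<iota> :: "'k \<Rightarrow> 'd + 'e"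
    assume n: "\<iota> \<notin> range (\<lambda>\<kappa>. Inl \<circ> \<kappa>)" "\<iota> \<notin> range (\<lambda>\<kappa>. Inr \<circ> \<kappa>)"
    obtain j j' where "\<not> isl (\<iota> j)" "isl (\<iota> j')"
      using n unfolding all_left_iff[symmetric] all_right_iff[symmetric] by blast
    then obtain a b where ab: "\<iota> j = Inr b" "\<iota> j' = Inl a" by (metis isl_def sum.exhaust)
    have "(\<Prod>i\<in>UNIV. ?M $ \<iota> i $ Inl (\<kappa> i)) = 0" for \<kappa>
      by (rule z[where j = j]) (simp add: ab)
    moreover have "(\<Prod>i\<in>UNIV. ?M $ \<iota> i $ Inr (\<mu> i)) = 0" for \<mu>
      by (rule z[where j = j']) (simp add: ab)
    ultimately have "tensor_power_map ?M ?s $ \<iota> = 0"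
      unfolding exp by (simp only: mult_zero_left sum.neutral_const add_0)
    then show "tensor_power_map ?M ?s $ \<iota> = tensor_direct_sum (tensor_power_map A f) (tensor_power_map B g) $ \<iota>"
      by (simp add: tensor_direct_sum_mixed[OF n])
  qed
qed

lemma tendsto_tensor_direct_sum:
  assumes "x \<longlonglongrightarrow> s" "y \<longlonglongrightarrow> t"
  shows "(\<lambda>n. tensor_direct_sum (x n) (y n)) \<longlonglongrightarrow> tensor_direct_sum s t"
proof (rule vec_tendstoI)
  fix \<iota>
  show "(\<lambda>n. tensor_direct_sum (x n) (y n) $ \<iota>) \<longlonglongrightarrow> tensor_direct_sum s t $ \<iota>"
  proof -
    consider (left) \<kappa> where "\<iota> = Inl \<circ> \<kappa>" | (right) \<kappa> where "\<iota> = Inr \<circ> \<kappa>"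
      | (mixed) "\<iota> \<notin> range (\<lambda>\<kappa>. Inl \<circ> \<kappa>)" "\<iota> \<notin> range (\<lambda>\<kappa>. Inr \<circ> \<kappa>)"
      by blast
    then show ?thesis
      using tendsto_vec_nth[OF assms(1)] tendsto_vec_nth[OF assms(2)]
      by cases (simp_all add: tensor_direct_sum_mixed)
  qed
qed

lemma closure_orbit_direct_sum:
  assumes "s \<in> closure (sym_orbit f)" "t \<in> closure (sym_orbit g)"
  shows "tensor_direct_sum s t \<in> closure (sym_orbit (tensor_direct_sum f g))"
proof -
  obtain x y where x: "\<And>n. x n \<in> sym_orbit f" "x \<longlonglongrightarrow> s" and y: "\<And>n. y n \<in> sym_orbit g" "y \<longlonglongrightarrow> t"
    using assms by (auto simp: closure_sequential)
  have "tensor_direct_sum (x n) (y n) \<in> sym_orbit (tensor_direct_sum f g)" for n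
  proof -
    obtain A B where "invertible A" "x n = tensor_power_map A f" "invertible B" "y n = tensor_power_map B g"
      using x(1)[of n] y(1)[of n] by (auto simp: sym_orbit_def)
    then show ?thesis unfolding sym_orbit_def mem_Collect_eq
      by (intro exI[of _ "block_sum A B"]) (simp add: tensor_power_map_block_sum invertible_block_sum)
  qed
  then show ?thesis unfolding closure_sequential
    using tendsto_tensor_direct_sum[OF x(2) y(2)]
    by (intro exI[of _ "\<lambda>n. tensor_direct_sum (x n) (y n)"]) blast
qed

lemma norm_tensor_direct_sum: "(norm (tensor_direct_sum s t))\<^sup>2 = (norm s)\<^sup>2 + (norm t)\<^sup>2"
  unfolding norm_vec_sq by (subst sum_sum_range) (simp_all add: tensor_direct_sum_mixed)

lemma exists_other_index:
  assumes "CARD('k::finite) \<ge> 2"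
  shows "\<exists>j'. j' \<noteq> (j :: 'k)"
proof (rule ccontr)
  assume "\<not> ?thesis"
  then have "(UNIV :: 'k set) = {j}" by auto
  then have "CARD('k) = 1" by (metis card_1_singleton_iff One_nat_def)
  then show False using assms by simp
qed

text \<open>An entry between the two summands would need multi-indices that differ in one place only
  and lie in different summands. A second factor makes at least one of them mixed, so its coordinate
  is zero. The condition on t is stated for nonzero t so that t = 0 is covered, as restrictions
  require.\<close>

lemma average_marginal_direct_sum:
  fixes s :: "('k::finite, 'd::finite) tensor" and t :: "('k, 'e::finite) tensor"
  assumes k: "CARD('k) \<ge> 2" and n: "(norm s)\<^sup>2 + (norm t)\<^sup>2 = 1"
    and s: "average_marginal s = diag_mat (\<lambda>a. of_real (q a))"
    and t: "t \<noteq> 0 \<Longrightarrow> average_marginal t = diag_mat (\<lambda>a. of_real (r a))"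
    and s0: "s \<noteq> 0"
  shows "average_marginal (tensor_direct_sum s t)
    = diag_mat (\<lambda>i. of_real (case i of Inl a \<Rightarrow> (norm s)\<^sup>2 * q a | Inr b \<Rightarrow> (norm t)\<^sup>2 * r b))"
proof -
  let ?u = "tensor_direct_sum s t"
  have nu: "(norm ?u)\<^sup>2 = 1" using n by (simp add: norm_tensor_direct_sum)
  have m: "marginal j ?u $ a $ b = (\<Sum>\<iota> | \<iota> j = a. ?u $ \<iota> * cnj (?u $ (\<iota>(j := b))))" for j a b
    unfolding marginal_nth nu by simp
  have upd: "(h \<circ> \<kappa>)(j := h b) = h \<circ> (\<kappa>(j := b))" for h :: "'a \<Rightarrow> 'b" and \<kappa> and j :: 'k and b
    by (simp add: fun_eq_iff)
  have LL: "marginal j ?u $ Inl a $ Inl b = of_real ((norm s)\<^sup>2) * marginal j s $ a $ b" for j a b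
  proof -
    define F where "F \<iota> = ?u $ \<iota> * cnj (?u $ (\<iota>(j := Inl b)))" for \<iota>
    define I where "I = {\<iota> :: 'k \<Rightarrow> 'd + 'e. \<iota> j = Inl a}"
    have "sum F I = (\<Sum>\<kappa> | Inl \<circ> \<kappa> \<in> I. F (Inl \<circ> \<kappa>))"
    proof (rule sum_range_comp)
      fix \<iota> :: "'k \<Rightarrow> 'd + 'e"
      assume "\<iota> \<in> I" "\<iota> \<notin> range (\<lambda>\<kappa>. Inl \<circ> \<kappa>)"
      moreover from this have "\<iota> \<notin> range (\<lambda>\<kappa>. Inr \<circ> \<kappa>)" by (auto simp: I_def)
      ultimately show "F \<iota> = 0" by (simp add: F_def tensor_direct_sum_mixed)
    qed simp
    then have "marginal j ?u $ Inl a $ Inl b = (\<Sum>\<kappa> | \<kappa> j = a. s $ \<kappa> * cnj (s $ (\<kappa>(j := b))))"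
      unfolding m by (simp add: F_def I_def upd)
    then show ?thesis using s0 by (simp add: marginal_nth)
  qed
  have RR: "marginal j ?u $ Inr a $ Inr b = of_real ((norm t)\<^sup>2) * marginal j t $ a $ b" for j a b
  proof -
    define F where "F \<iota> = ?u $ \<iota> * cnj (?u $ (\<iota>(j := Inr b)))" for \<iota>
    define I where "I = {\<iota> :: 'k \<Rightarrow> 'd + 'e. \<iota> j = Inr a}"
    have "sum F I = (\<Sum>\<kappa> | Inr \<circ> \<kappa> \<in> I. F (Inr \<circ> \<kappa>))"
    proof (rule sum_range_comp)
      fix \<iota> :: "'k \<Rightarrow> 'd + 'e"
      assume "\<iota> \<in> I" "\<iota> \<notin> range (\<lambda>\<kappa>. Inr \<circ> \<kappa>)"
      moreover from this have "\<iota> \<notin> range (\<lambda>\<kappa>. Inl \<circ> \<kappa>)" by (auto simp: I_def)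
      ultimately show "F \<iota> = 0" by (simp add: F_def tensor_direct_sum_mixed)
    qed simp
    then have "marginal j ?u $ Inr a $ Inr b = (\<Sum>\<kappa> | \<kappa> j = a. t $ \<kappa> * cnj (t $ (\<kappa>(j := b))))"
      unfolding m by (simp add: F_def I_def upd)
    then show ?thesis by (cases "t = 0") (simp_all add: marginal_nth)
  qed
  have LR: "marginal j ?u $ Inl a $ Inr b = 0" for j a b
    unfolding m
  proof (rule sum.neutral, rule ballI)
    fix \<iota> :: "'k \<Rightarrow> 'd + 'e" assume i: "\<iota> \<in> {\<iota>. \<iota> j = Inl a}"
    obtain j' where j': "j' \<noteq> j" using exists_other_index[OF k] by blast
    show "?u $ \<iota> * cnj (?u $ (\<iota>(j := Inr b))) = 0"
    proof (cases "isl (\<iota> j')")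
      case True
      have "isl ((\<iota>(j := Inr b)) j')" "\<not> isl ((\<iota>(j := Inr b)) j)" using True j' by auto
      then have "?u $ (\<iota>(j := Inr b)) = 0"
        by (intro tensor_direct_sum_mixed) (metis all_left_iff, metis all_right_iff)
      then show ?thesis by simp
    next
      case False
      have "isl (\<iota> j)" using i by simp
      then have "?u $ \<iota> = 0" using False
        by (intro tensor_direct_sum_mixed) (metis all_left_iff, metis all_right_iff)
      then show ?thesis by simp
    qed
  qed
  have RL: "marginal j ?u $ Inr b $ Inl a = 0" for j a b
    using cnj_marginal[of j ?u "Inl a" "Inr b"] LR by simp
  have "average_marginal ?u $ Inl a $ Inl b = of_real ((norm s)\<^sup>2) * average_marginal s $ a $ b" for a b
    by (simp add: average_marginal_nth LL sum_distrib_left)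
  then have "average_marginal ?u $ Inl a $ Inl b = (if a = b then of_real ((norm s)\<^sup>2 * q a) else 0)" for a b
    by (simp add: s)
  moreover have "average_marginal ?u $ Inr a $ Inr b = (if a = b then of_real ((norm t)\<^sup>2 * r a) else 0)" for a b
  proof -
    have 1: "average_marginal ?u $ Inr a $ Inr b = of_real ((norm t)\<^sup>2) * average_marginal t $ a $ b"
      by (simp add: average_marginal_nth RR sum_distrib_left)
    show ?thesis
    proof (cases "t = 0")
      case True
      then have "(norm t)\<^sup>2 = 0" by simp
      then show ?thesis unfolding 1 by simp
    next
      case False
      then show ?thesis unfolding 1 t[OF False] by simp
    qed
  qed
  moreover have "average_marginal ?u $ Inl a $ Inr b = 0" "average_marginal ?u $ Inr b $ Inl a = 0" for a b
    by (simp_all add: average_marginal_nth LR RL)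
  ultimately show ?thesis by (simp add: vec_eq_iff all_sum_iff)
qed

section \<open>Evaluating the functional by a certificate\<close>

lemma certificateD:
  fixes f :: "('k::finite, 'd::finite) tensor"
  assumes "certificate f q w"
  shows "0 < sym_quantum_functional f" "w = (1 / sym_quantum_functional f) ^ CARD('k)"
    "- (\<Sum>a\<in>UNIV. q a * log 2 (q a)) = log 2 (sym_quantum_functional f)"
proof -
  have w: "w > 0" using assms by (auto simp: certificate_def dual_feasible_def)
  have F: "sym_quantum_functional f = w powr (- 1 / real CARD('k))" by (rule certificate_value[OF assms])
  then show "0 < sym_quantum_functional f" using w by simp
  have "(1 / sym_quantum_functional f) ^ CARD('k) = (w powr (1 / real CARD('k))) ^ CARD('k)"
    by (simp add: F powr_minus_divide)
  also have "\<dots> = w" using w by (simp add: powr_powr flip: powr_realpow)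
  finally show "w = (1 / sym_quantum_functional f) ^ CARD('k)" by simp
  have "log 2 (sym_quantum_functional f) = - log 2 w / real CARD('k)"
    using w by (simp add: F log_powr)
  then show "- (\<Sum>a\<in>UNIV. q a * log 2 (q a)) = log 2 (sym_quantum_functional f)"
    using assms by (simp add: certificate_def)
qed

text \<open>Reduces an evaluation to exhibiting a certificate for a guessed value F, whose threshold
  has to be F to the power -k.\<close>

lemma sym_quantum_functional_eqI:
  fixes f :: "('k::finite, 'd::finite) tensor"
  assumes "dual_feasible B q ((1 / F) ^ CARD('k)) f" "s \<in> closure (sym_orbit f)" "s \<noteq> 0"
    "average_marginal s = diag_mat (\<lambda>a. of_real (q a))" "0 < F"
    "- (\<Sum>a\<in>UNIV. q a * log 2 (q a)) = log 2 F"
  shows "sym_quantum_functional f = F"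
proof -
  have "- log 2 ((1 / F) ^ CARD('k)) / real CARD('k) = log 2 F"
    using assms(5) by (simp add: log_nat_power log_divide)
  then have "certificate f q ((1 / F) ^ CARD('k))"
    unfolding certificate_def using assms by auto
  from certificateD[OF this] have "(1 / F) ^ CARD('k) = (1 / sym_quantum_functional f) ^ CARD('k)"
    "0 < sym_quantum_functional f" by blast+
  then have "1 / F = 1 / sym_quantum_functional f"
    using assms(5) by (simp add: power_eq_iff_eq_base)
  then show ?thesis by simp
qed

lemma average_marginal_scaleR:
  assumes "c \<noteq> 0"
  shows "average_marginal (c *\<^sub>R s) = average_marginal s"
proof -
  have "marginal j (c *\<^sub>R s) $ a $ b = marginal j s $ a $ b" for j a b
  proof -
    have "(\<Sum>\<iota> | \<iota> j = a. (c *\<^sub>R s) $ \<iota> * cnj ((c *\<^sub>R s) $ (\<iota>(j := b))))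
        = of_real (c\<^sup>2) * (\<Sum>\<iota> | \<iota> j = a. s $ \<iota> * cnj (s $ (\<iota>(j := b))))"
      unfolding vector_scaleR_component sum_distrib_left
      by (intro sum.cong refl) (simp add: scaleR_conv_of_real power2_eq_square)
    then show ?thesis using assms by (simp add: marginal_nth power_mult_distrib del: fun_upd_apply)
  qed
  then show ?thesis by (simp add: vec_eq_iff average_marginal_nth)
qed

text \<open>Marginals are invariant under scaling while orbit closures admit it, so the summands of
  a direct sum can be given prescribed weights.\<close>

lemma closure_orbit_norm:
  assumes "s \<in> closure (sym_orbit f)" "s \<noteq> 0" "0 < p" "average_marginal s = M"
  obtains s' where "s' \<in> closure (sym_orbit f)" "s' \<noteq> 0" "(norm s')\<^sup>2 = p" "average_marginal s' = M"
proof (rule that)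
  let ?c = "sqrt p / norm s"
  have c: "?c > 0" using assms by simp
  show "?c *\<^sub>R s \<in> closure (sym_orbit f)" by (rule closure_orbit_scaleR[OF assms(1) c])
  show "?c *\<^sub>R s \<noteq> 0" using assms(2,3) by simp
  show "(norm (?c *\<^sub>R s))\<^sup>2 = p" using assms by simp
  show "average_marginal (?c *\<^sub>R s) = M" using average_marginal_scaleR[of ?c s] assms by simp
qed

lemma supported_direct_sum:
  fixes x :: "('k::finite, 'd::finite) tensor" and y :: "('k, 'e::finite) tensor"
  assumes "supported q w x" "supported r w y"
  shows "supported (case_sum q r) w (tensor_direct_sum x y)"
  unfolding supported_def
proof (intro allI impI)
  fix \<iota> :: "'k \<Rightarrow> 'd + 'e"
  assume nz: "tensor_direct_sum x y $ \<iota> \<noteq> 0"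
  then consider (left) \<kappa> where "\<iota> = Inl \<circ> \<kappa>" | (right) \<kappa> where "\<iota> = Inr \<circ> \<kappa>"
    using tensor_direct_sum_mixed by blast
  then show "w \<le> (\<Prod>j\<in>UNIV. case_sum q r (\<iota> j))"
    using assms nz by cases (auto simp: supported_def)
qed

lemma supported_scale:
  fixes x :: "('k::finite, 'd::finite) tensor"
  assumes "supported q w x" "0 \<le> c"
  shows "supported (\<lambda>a. c * q a) (c ^ CARD('k) * w) x"
  using assms by (auto simp: supported_def prod.distrib intro!: mult_left_mono)

text \<open>The grouping rule for entropy, for a single block of total mass p.\<close>

lemma sum_scaled_entropy:
  fixes q :: "'d::finite \<Rightarrow> real"
  assumes "\<And>a. 0 \<le> q a" "(\<Sum>a\<in>UNIV. q a) = 1" "0 < p"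
  shows "(\<Sum>a\<in>UNIV. p * q a * log 2 (p * q a)) = p * log 2 p + p * (\<Sum>a\<in>UNIV. q a * log 2 (q a))"
proof -
  have "p * q a * log 2 (p * q a) = p * log 2 p * q a + p * (q a * log 2 (q a))" for a
    using assms(1)[of a] assms(3) by (cases "q a = 0") (simp_all add: log_mult algebra_simps)
  then have "(\<Sum>a\<in>UNIV. p * q a * log 2 (p * q a)) = (\<Sum>a\<in>UNIV. p * log 2 p * q a + p * (q a * log 2 (q a)))" by simp
  also have "\<dots> = p * log 2 p * (\<Sum>a\<in>UNIV. q a) + p * (\<Sum>a\<in>UNIV. q a * log 2 (q a))"
    by (simp add: sum.distrib sum_distrib_left)
  finally show ?thesis using assms(2) by simp
qed

theorem sym_quantum_functional_direct_sum:
  fixes f :: "('k::finite, 'd::finite) tensor" and g :: "('k, 'e::finite) tensor"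
  assumes k: "CARD('k) \<ge> 2" and fg: "f \<noteq> 0" "g \<noteq> 0"
  shows "sym_quantum_functional (tensor_direct_sum f g) = sym_quantum_functional f + sym_quantum_functional g"
proof -
  obtain q w where qw: "certificate f q w" by (rule certificate_exists[OF fg(1)])
  obtain r v where rv: "certificate g r v" by (rule certificate_exists[OF fg(2)])
  define F G where "F = sym_quantum_functional f" "G = sym_quantum_functional g"
  note cf = certificateD[OF qw, folded F_G_def] and cg = certificateD[OF rv, folded F_G_def]
  obtain B s where B: "dual_feasible B q w f" and s: "s \<in> closure (sym_orbit f)" "s \<noteq> 0"
    "average_marginal s = diag_mat (\<lambda>a. of_real (q a))"
    using qw by (auto simp: certificate_def)
  obtain C t where C: "dual_feasible C r v g" and t: "t \<in> closure (sym_orbit g)" "t \<noteq> 0"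
    "average_marginal t = diag_mat (\<lambda>a. of_real (r a))"
    using rv by (auto simp: certificate_def)
  \<comment> \<open>This p maximises the binary entropy of p plus p log F + (1 - p) log G, with
    maximum log (F + G). Since w and v are the k-th powers of 1/F and 1/G, the same p makes the two
    scaled thresholds equal.\<close>
  define p where "p = F / (F + G)"
  have p: "0 < p" "0 < 1 - p" "1 - p = G / (F + G)"
    using cf cg by (simp_all add: p_def field_simps)
  define R where "R = case_sum (\<lambda>a. p * q a) (\<lambda>b. (1 - p) * r b)"
  obtain s' where s': "s' \<in> closure (sym_orbit f)" "s' \<noteq> 0" "(norm s')\<^sup>2 = p"
    "average_marginal s' = diag_mat (\<lambda>a. of_real (q a))"
    by (rule closure_orbit_norm[OF s(1,2) p(1) s(3)])
  obtain t' where t': "t' \<in> closure (sym_orbit g)" "t' \<noteq> 0" "(norm t')\<^sup>2 = 1 - p"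
    "average_marginal t' = diag_mat (\<lambda>a. of_real (r a))"
    by (rule closure_orbit_norm[OF t(1,2) p(2) t(3)])
  have w1: "p ^ CARD('k) * w = (1 / (F + G)) ^ CARD('k)" "(1 - p) ^ CARD('k) * v = (1 / (F + G)) ^ CARD('k)"
    unfolding cf(2) cg(2) p(3) using cf(1) cg(1) by (simp_all add: p_def flip: power_mult_distrib)
  have "dual_feasible (block_sum B C) R ((1 / (F + G)) ^ CARD('k)) (tensor_direct_sum f g)"
    unfolding dual_feasible_def tensor_power_map_block_sum
  proof (intro conjI allI)
    show "invertible (block_sum B C)" using B C by (intro invertible_block_sum) (auto simp: dual_feasible_def)
    show "0 \<le> R i" for i using B C p(1,2) by (cases i) (auto simp: R_def dual_feasible_def intro!: mult_nonneg_nonneg)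
    show "sum R UNIV = 1" using B C by (simp add: R_def sum_UNIV_sum_type dual_feasible_def flip: sum_distrib_left)
    show "0 < (1 / (F + G)) ^ CARD('k)" using cf(1) cg(1) by simp
    show "supported R ((1 / (F + G)) ^ CARD('k)) (tensor_direct_sum (tensor_power_map B f) (tensor_power_map C g))"
      unfolding R_def
    proof (rule supported_direct_sum)
      show "supported (\<lambda>a. p * q a) ((1 / (F + G)) ^ CARD('k)) (tensor_power_map B f)"
        unfolding w1(1)[symmetric] using B p(1) by (intro supported_scale) (auto simp: dual_feasible_def)
      show "supported (\<lambda>b. (1 - p) * r b) ((1 / (F + G)) ^ CARD('k)) (tensor_power_map C g)"
        unfolding w1(2)[symmetric] using C p(2) by (intro supported_scale) (auto simp: dual_feasible_def)
    qed
  qed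
  moreover have "tensor_direct_sum s' t' \<in> closure (sym_orbit (tensor_direct_sum f g))"
    by (rule closure_orbit_direct_sum[OF s'(1) t'(1)])
  moreover have n1: "(norm s')\<^sup>2 + (norm t')\<^sup>2 = 1" using s'(3) t'(3) by simp
  then have "tensor_direct_sum s' t' \<noteq> 0"
    using norm_tensor_direct_sum[of s' t'] by auto
  moreover have "average_marginal (tensor_direct_sum s' t') = diag_mat (\<lambda>i. of_real (R i))"
    using average_marginal_direct_sum[OF k n1 s'(4) t'(4) s'(2)] unfolding R_def s'(3) t'(3) .
  moreover have "0 < F + G" using cf(1) cg(1) by simp
  moreover have "- (\<Sum>i\<in>UNIV. R i * log 2 (R i)) = log 2 (F + G)"
  proof -
    have "(\<Sum>i\<in>UNIV. R i * log 2 (R i)) = (\<Sum>a\<in>UNIV. p * q a * log 2 (p * q a))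
        + (\<Sum>b\<in>UNIV. (1 - p) * r b * log 2 ((1 - p) * r b))"
      by (simp add: sum_UNIV_sum_type R_def)
    also have "\<dots> = p * log 2 p + p * (\<Sum>a\<in>UNIV. q a * log 2 (q a))
        + ((1 - p) * log 2 (1 - p) + (1 - p) * (\<Sum>b\<in>UNIV. r b * log 2 (r b)))"
      using B C p sum_scaled_entropy[of q p] sum_scaled_entropy[of r "1 - p"] by (simp add: dual_feasible_def)
    also have "(\<Sum>a\<in>UNIV. q a * log 2 (q a)) = - log 2 F" using cf(3) by simp
    also have "(\<Sum>b\<in>UNIV. r b * log 2 (r b)) = - log 2 G" using cg(3) by simp
    also have "log 2 (1 - p) = log 2 G - log 2 (F + G)" unfolding p(3) using cf(1) cg(1) by (simp add: log_divide)
    also have "log 2 p = log 2 F - log 2 (F + G)" unfolding p_def using cf(1) cg(1) by (simp add: log_divide)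
    finally show ?thesis by (simp add: algebra_simps)
  qed
  ultimately show ?thesis unfolding F_G_def[symmetric] by (rule sym_quantum_functional_eqI)
qed

subsection \<open>Restrictions\<close>

text \<open>The block matrix with c times the identity on the diagonal and A in the upper corner:
  invertible for c \<noteq> 0, and at c = 0 the map taking (u, v) to (A v, 0).\<close>

definition shear :: "complex \<Rightarrow> complex ^ 'e ^ 'd \<Rightarrow> complex ^ ('d + 'e) ^ ('d + 'e)" where
  "shear c A = (\<chi> i j. case i of
      Inl a \<Rightarrow> (case j of Inl b \<Rightarrow> if a = b then c else 0 | Inr b \<Rightarrow> A $ a $ b)
    | Inr a \<Rightarrow> (case j of Inl b \<Rightarrow> 0 | Inr b \<Rightarrow> if a = b then c else 0))"

lemma invertible_shear:
  fixes A :: "complex ^ 'e::finite ^ 'd::finite"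
  assumes "c \<noteq> 0"
  shows "invertible (shear c A)"
proof -
  have "shear c A ** shear (1 / c) (\<chi> a b. - A $ a $ b / c\<^sup>2) = mat 1"
    using assms by (simp add: vec_eq_iff all_sum_iff matrix_matrix_mult_def sum_UNIV_sum_type shear_def mat_def
        mult_if_delta if_distrib[of "\<lambda>x. _ * x"] if_distrib[of "\<lambda>x. x * _"] power2_eq_square sum_negf sum_divide_distrib[symmetric] cong: if_cong)
  then show ?thesis using invertible_right_inverse by blast
qed

text \<open>Letting c tend to 0 in the invertible shears realises the restriction as a degeneration.
  The enlarged space is the place for this, since A may be singular or not even square.\<close>

lemma restriction_in_closure:
  fixes g :: "('k::finite, 'e::finite) tensor" and A :: "complex ^ 'e ^ 'd::finite"
  shows "tensor_direct_sum (tensor_power_map A g) (0 :: ('k, 'e) tensor)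
    \<in> closure (sym_orbit (tensor_direct_sum (0 :: ('k, 'd) tensor) g))"
proof -
  let ?z = "tensor_direct_sum (0 :: ('k, 'd) tensor) g"
  have "tensor_power_map (shear 0 A) ?z = tensor_direct_sum (tensor_power_map A g) (0 :: ('k, 'e) tensor)"
  proof -
    have exp: "tensor_power_map (shear 0 A) ?z $ \<iota>
        = (\<Sum>\<kappa>\<in>UNIV. (\<Prod>j\<in>UNIV. shear 0 A $ \<iota> j $ Inr (\<kappa> j)) * g $ \<kappa>)" for \<iota>
      unfolding tensor_power_map_def vec_lambda_beta
      by (subst sum_sum_range) (simp_all add: tensor_direct_sum_mixed)
    have zero: "tensor_power_map (shear 0 A) ?z $ \<iota> = 0" if nl: "\<not> isl (\<iota> j)" for \<iota> j
    proof -
      obtain b where "\<iota> j = Inr b" using nl by (cases "\<iota> j") auto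
      then have "shear 0 A $ \<iota> j $ Inr (\<kappa> j) = 0" for \<kappa>
        by (simp add: shear_def)
      then have "(\<Prod>j\<in>UNIV. shear 0 A $ \<iota> j $ Inr (\<kappa> j)) = 0" for \<kappa>
        by (metis UNIV_I finite prod_zero)
      then show ?thesis unfolding exp by (simp only: mult_zero_left sum.neutral_const)
    qed
    show ?thesis
    proof (rule tensor_sum_eqI)
      fix \<kappa>
      show "tensor_power_map (shear 0 A) ?z $ (Inl \<circ> \<kappa>) = tensor_direct_sum (tensor_power_map A g) (0 :: ('k, 'e) tensor) $ (Inl \<circ> \<kappa>)"
        unfolding exp by (simp add: tensor_power_map_def shear_def)
    next
      fix \<kappa>
      show "tensor_power_map (shear 0 A) ?z $ (Inr \<circ> \<kappa>) = tensor_direct_sum (tensor_power_map A g) (0 :: ('k, 'e) tensor) $ (Inr \<circ> \<kappa>)"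
        by (simp add: zero)
    next
      fix \<iota> :: "'k \<Rightarrow> 'd + 'e"
      assume n: "\<iota> \<notin> range (\<lambda>\<kappa>. Inl \<circ> \<kappa>)" "\<iota> \<notin> range (\<lambda>\<kappa>. Inr \<circ> \<kappa>)"
      then obtain j where "\<not> isl (\<iota> j)" unfolding all_left_iff[symmetric] by blast
      then show "tensor_power_map (shear 0 A) ?z $ \<iota> = tensor_direct_sum (tensor_power_map A g) (0 :: ('k, 'e) tensor) $ \<iota>"
        by (simp add: zero tensor_direct_sum_mixed[OF n])
    qed
  qed
  moreover define c where "c n = complex_of_real (inverse (real (Suc n)))" for n
  have c: "c \<longlonglongrightarrow> 0"
    using tendsto_of_real[OF LIMSEQ_inverse_real_of_nat, where ?'a = complex] by (simp add: c_def[abs_def])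
  have "(\<lambda>n. tensor_power_map (shear (c n) A) ?z) \<longlonglongrightarrow> tensor_power_map (shear 0 A) ?z"
  proof (intro tendsto_tensor_power_map tendsto_const vec_tendstoI)
    fix i j
    have "(\<lambda>n. if P then c n else 0) \<longlonglongrightarrow> 0" for P
      using c by (cases P) simp_all
    then show "(\<lambda>n. shear (c n) A $ i $ j) \<longlonglongrightarrow> shear 0 A $ i $ j"
      unfolding shear_def vec_lambda_beta by (cases i; cases j) simp_all
  qed
  moreover have "tensor_power_map (shear (c n) A) ?z \<in> sym_orbit ?z" for n
    by (intro sym_orbit_tensor_power_map sym_orbit_self invertible_shear) (simp add: c_def del: of_nat_Suc)
  ultimately show ?thesis unfolding closure_sequential
    by (intro exI[of _ "\<lambda>n. tensor_power_map (shear (c n) A) ?z"]) simp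
qed

theorem sym_quantum_functional_mono:
  fixes f :: "('k::finite, 'd::finite) tensor" and g :: "('k, 'e::finite) tensor"
  assumes k: "CARD('k) \<ge> 2" and fg: "f \<noteq> 0" "g \<noteq> 0" and le: "f \<le>\<^sub>s g"
  shows "sym_quantum_functional f \<le> sym_quantum_functional g"
proof -
  obtain A :: "complex ^ 'e ^ 'd" where A: "f = tensor_power_map A g" using le by (auto simp: sym_restriction_def)
  obtain q w where qw: "certificate f q w" by (rule certificate_exists[OF fg(1)])
  obtain r v where rv: "certificate g r v" by (rule certificate_exists[OF fg(2)])
  obtain s where s: "s \<in> closure (sym_orbit f)" "s \<noteq> 0"
    "average_marginal s = diag_mat (\<lambda>a. of_real (q a))"
    using qw by (auto simp: certificate_def)
  obtain C where C: "dual_feasible C r v g" using rv by (auto simp: certificate_def)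
  obtain s' where s': "s' \<in> closure (sym_orbit f)" "s' \<noteq> 0" "(norm s')\<^sup>2 = 1"
    "average_marginal s' = diag_mat (\<lambda>a. of_real (q a))"
    by (rule closure_orbit_norm[OF s(1,2) zero_less_one s(3)])
  let ?u = "tensor_direct_sum s' (0 :: ('k, 'e) tensor)"
  let ?g = "tensor_direct_sum (0 :: ('k, 'd) tensor) g"
  have "?u \<in> closure (sym_orbit (tensor_direct_sum f (0 :: ('k, 'e) tensor)))"
    by (intro closure_orbit_direct_sum s'(1) subsetD[OF closure_subset sym_orbit_self])
  then have u: "?u \<in> closure (sym_orbit ?g)"
    using restriction_in_closure[of A g] closure_orbit_trans unfolding A by blast
  have unz: "?u \<noteq> 0" using norm_tensor_direct_sum[of s' "0 :: ('k, 'e) tensor"] s'(3) by auto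
  \<comment> \<open>The first summand receives probability zero, and the zero tensor there puts
    nothing into the support, so the threshold v of g is kept.\<close>
  have feas: "dual_feasible (block_sum (mat 1) C) (case_sum (\<lambda>_. 0) r) v ?g"
    unfolding dual_feasible_def tensor_power_map_block_sum
  proof (intro conjI allI)
    show "invertible (block_sum (mat 1 :: complex ^ 'd ^ 'd) C)"
      using C by (intro invertible_block_sum) (auto simp: dual_feasible_def invertible_def)
    show "0 \<le> case_sum (\<lambda>_. 0) r i" for i :: "'d + 'e" using C by (cases i) (auto simp: dual_feasible_def)
    show "sum (case_sum (\<lambda>_ :: 'd. 0) r) UNIV = 1" using C by (simp add: sum_UNIV_sum_type dual_feasible_def)
    show "0 < v" using C by (simp add: dual_feasible_def)
    show "supported (case_sum (\<lambda>_. 0) r) v (tensor_direct_sum (tensor_power_map (mat 1) (0 :: ('k, 'd) tensor)) (tensor_power_map C g))"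
      using C by (intro supported_direct_sum) (auto simp: dual_feasible_def supported_def)
  qed
  have "average_marginal ?u = diag_mat (\<lambda>i. of_real (case i of Inl a \<Rightarrow> (norm s')\<^sup>2 * q a | Inr b \<Rightarrow> (norm (0 :: ('k, 'e) tensor))\<^sup>2 * 0))"
    by (rule average_marginal_direct_sum[OF k _ s'(4) _ s'(2)]) (simp_all add: s'(3))
  then have "shannon_entropy (spec (average_marginal ?u)) = - (\<Sum>a\<in>UNIV. q a * log 2 (q a))"
    by (simp only: entropy_spec_diag_mat) (simp add: sum_UNIV_sum_type s'(3))
  also have "\<dots> = log 2 (sym_quantum_functional f)" by (rule certificateD[OF qw])
  finally have "log 2 (sym_quantum_functional f) \<le> - log 2 v / real CARD('k)"
    using entropy_le_dual[OF feas u unz] by simp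
  also have "\<dots> = log 2 (sym_quantum_functional g)"
    using rv certificateD(3)[OF rv] by (simp add: certificate_def)
  finally show ?thesis using certificateD(1)[OF qw] certificateD(1)[OF rv] by simp
qed

subsection \<open>Kronecker products\<close>

lemma sum_fun_pair:
  fixes F :: "('k::finite \<Rightarrow> 'd::finite \<times> 'e::finite) \<Rightarrow> 'b::comm_monoid_add"
  shows "(\<Sum>\<iota> | P (fst \<circ> \<iota>) \<and> Q (snd \<circ> \<iota>). F \<iota>) = (\<Sum>x | P x. \<Sum>y | Q y. F (\<lambda>j. (x j, y j)))"
proof -
  have "(\<Sum>\<iota> | P (fst \<circ> \<iota>) \<and> Q (snd \<circ> \<iota>). F \<iota>) = (\<Sum>(x, y) \<in> {x. P x} \<times> {y. Q y}. F (\<lambda>j. (x j, y j)))"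
    by (rule sum.reindex_bij_witness[where i = "\<lambda>(x, y) j. (x j, y j)" and j = "\<lambda>\<iota>. (fst \<circ> \<iota>, snd \<circ> \<iota>)"])
       (auto simp: o_def)
  then show ?thesis by (simp add: sum.cartesian_product)
qed

lemma sum_fun_pair_UNIV:
  fixes F :: "('k::finite \<Rightarrow> 'd::finite \<times> 'e::finite) \<Rightarrow> 'b::comm_monoid_add"
  shows "sum F UNIV = (\<Sum>x\<in>UNIV. \<Sum>y\<in>UNIV. F (\<lambda>j. (x j, y j)))"
  using sum_fun_pair[where P = "\<lambda>_. True" and Q = "\<lambda>_. True" and F = F] by simp

lemma sum_UNIV_pair:
  fixes F :: "'d::finite \<times> 'e::finite \<Rightarrow> 'b::comm_monoid_add"
  shows "sum F UNIV = (\<Sum>a\<in>UNIV. \<Sum>b\<in>UNIV. F (a, b))"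
  by (simp add: sum.cartesian_product flip: UNIV_Times_UNIV)

lemma tensor_kronecker_pair [simp]: "tensor_kronecker f g $ (\<lambda>j. (x j, y j)) = f $ x * g $ y"
  by (simp add: tensor_kronecker_def o_def)

definition matrix_kronecker :: "complex ^ 'd ^ 'd \<Rightarrow> complex ^ 'e ^ 'e \<Rightarrow> complex ^ ('d \<times> 'e) ^ ('d \<times> 'e)" where
  "matrix_kronecker A B = (\<chi> i j. A $ fst i $ fst j * B $ snd i $ snd j)"

lemma matrix_kronecker_mult:
  "matrix_kronecker A B ** matrix_kronecker C D = matrix_kronecker (A ** C) (B ** D)"
  by (simp add: vec_eq_iff matrix_kronecker_def matrix_matrix_mult_def sum_UNIV_pair sum_product mult_ac)

lemma matrix_kronecker_one: "matrix_kronecker (mat 1) (mat 1) = mat 1"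
  by (auto simp: vec_eq_iff matrix_kronecker_def mat_def prod_eq_iff)

lemma invertible_matrix_kronecker:
  assumes "invertible A" "invertible B"
  shows "invertible (matrix_kronecker A B)"
  using assms unfolding invertible_def by (metis matrix_kronecker_mult matrix_kronecker_one)

lemma tensor_power_map_kronecker:
  "tensor_power_map (matrix_kronecker A B) (tensor_kronecker f g)
    = tensor_kronecker (tensor_power_map A f) (tensor_power_map B g)"
proof -
  have "(\<Sum>x\<in>UNIV. \<Sum>y\<in>UNIV. (\<Prod>j\<in>UNIV. A $ fst (\<iota> j) $ x j * B $ snd (\<iota> j) $ y j) * (f $ x * g $ y))
     = (\<Sum>x\<in>UNIV. (\<Prod>j\<in>UNIV. A $ fst (\<iota> j) $ x j) * f $ x) * (\<Sum>y\<in>UNIV. (\<Prod>j\<in>UNIV. B $ snd (\<iota> j) $ y j) * g $ y)" for \<iota>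
    unfolding sum_product by (simp add: prod.distrib mult_ac)
  then show ?thesis
    by (simp add: vec_eq_iff tensor_power_map_def sum_fun_pair_UNIV matrix_kronecker_def)
       (simp add: tensor_kronecker_def)
qed

lemma closure_orbit_kronecker:
  assumes "s \<in> closure (sym_orbit f)" "t \<in> closure (sym_orbit g)"
  shows "tensor_kronecker s t \<in> closure (sym_orbit (tensor_kronecker f g))"
proof -
  obtain x y where x: "\<And>n. x n \<in> sym_orbit f" "x \<longlonglongrightarrow> s" and y: "\<And>n. y n \<in> sym_orbit g" "y \<longlonglongrightarrow> t"
    using assms by (auto simp: closure_sequential)
  have "tensor_kronecker (x n) (y n) \<in> sym_orbit (tensor_kronecker f g)" for n
  proof -
    obtain A B where "invertible A" "x n = tensor_power_map A f" "invertible B" "y n = tensor_power_map B g"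
      using x(1)[of n] y(1)[of n] by (auto simp: sym_orbit_def)
    then show ?thesis unfolding sym_orbit_def mem_Collect_eq
      by (intro exI[of _ "matrix_kronecker A B"]) (simp add: tensor_power_map_kronecker invertible_matrix_kronecker)
  qed
  moreover have "(\<lambda>n. tensor_kronecker (x n) (y n)) \<longlonglongrightarrow> tensor_kronecker s t"
    unfolding tensor_kronecker_def by (intro tendsto_vec_lambda tendsto_mult tendsto_vec_nth x y)
  ultimately show ?thesis unfolding closure_sequential
    by (intro exI[of _ "\<lambda>n. tensor_kronecker (x n) (y n)"]) blast
qed

lemma norm_tensor_kronecker: "(norm (tensor_kronecker s t))\<^sup>2 = (norm s)\<^sup>2 * (norm t)\<^sup>2"
  by (simp add: norm_vec_sq sum_fun_pair_UNIV norm_mult power_mult_distrib sum_product)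

lemma marginal_kronecker:
  "marginal j (tensor_kronecker s t) $ (a, a') $ (b, b') = marginal j s $ a $ b * marginal j t $ a' $ b'"
proof -
  have upd: "(\<lambda>i. (x i, y i))(j := (b, b')) = (\<lambda>i. ((x(j := b)) i, (y(j := b')) i))" for x y
    by (simp add: fun_eq_iff)
  have "{\<iota>. \<iota> j = (a, a')} = {\<iota>. (fst \<circ> \<iota>) j = a \<and> (snd \<circ> \<iota>) j = a'}"
    by (auto simp: prod_eq_iff)
  then have "(\<Sum>\<iota> | \<iota> j = (a, a'). tensor_kronecker s t $ \<iota> * cnj (tensor_kronecker s t $ (\<iota>(j := (b, b')))))
      = (\<Sum>x | x j = a. \<Sum>y | y j = a'. (s $ x * t $ y) * cnj (s $ (x(j := b)) * t $ (y(j := b'))))"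
    using sum_fun_pair[where P = "\<lambda>x. x j = a" and Q = "\<lambda>y. y j = a'"
        and F = "\<lambda>\<iota>. tensor_kronecker s t $ \<iota> * cnj (tensor_kronecker s t $ (\<iota>(j := (b, b'))))"]
    by (simp add: upd del: fun_upd_apply)
  also have "\<dots> = (\<Sum>x | x j = a. s $ x * cnj (s $ (x(j := b)))) * (\<Sum>y | y j = a'. t $ y * cnj (t $ (y(j := b'))))"
    unfolding sum_product by (simp add: mult_ac del: fun_upd_apply)
  finally show ?thesis
    by (simp add: marginal_nth norm_tensor_kronecker)
qed

lemma symmetric_tensor_power_map:
  fixes f :: "('k::finite, 'e::finite) tensor" and A :: "complex ^ 'e ^ 'd::finite"
  assumes "symmetric_tensor f"
  shows "symmetric_tensor (tensor_power_map A f)"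
  unfolding symmetric_tensor_def
proof (intro allI impI)
  fix \<pi> :: "'k \<Rightarrow> 'k" assume \<pi>: "bij \<pi>"
  have f: "f $ (\<kappa> \<circ> \<pi>) = f $ \<kappa>" for \<kappa>
    using assms \<pi> unfolding symmetric_tensor_def vec_eq_iff by simp
  have "(\<Sum>\<kappa>\<in>UNIV. (\<Prod>j\<in>UNIV. A $ (\<iota> \<circ> \<pi>) j $ \<kappa> j) * f $ \<kappa>) = (\<Sum>\<kappa>\<in>UNIV. (\<Prod>j\<in>UNIV. A $ \<iota> j $ \<kappa> j) * f $ \<kappa>)" for \<iota>
  proof -
    have bij: "bij (\<lambda>\<kappa> :: 'k \<Rightarrow> 'e. \<kappa> \<circ> \<pi>)"
      by (rule o_bij[of "\<lambda>\<kappa>. \<kappa> \<circ> inv \<pi>"])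
         (use \<pi> in \<open>simp_all add: fun_eq_iff bij_is_inj bij_is_surj surj_f_inv_f\<close>)
    have "(\<Sum>\<kappa>\<in>UNIV. (\<Prod>j\<in>UNIV. A $ (\<iota> \<circ> \<pi>) j $ \<kappa> j) * f $ \<kappa>)
        = (\<Sum>\<kappa>\<in>UNIV. (\<Prod>j\<in>UNIV. A $ (\<iota> \<circ> \<pi>) j $ (\<kappa> \<circ> \<pi>) j) * f $ (\<kappa> \<circ> \<pi>))"
      by (rule sum.reindex_bij_betw[OF bij, symmetric])
    also have "\<dots> = (\<Sum>\<kappa>\<in>UNIV. (\<Prod>j\<in>UNIV. A $ \<iota> j $ \<kappa> j) * f $ \<kappa>)"
      unfolding f using prod.reindex_bij_betw[OF \<pi>, of "\<lambda>j. A $ _ j $ _ j"] by simp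
    finally show ?thesis .
  qed
  then show "(\<chi> \<iota>. tensor_power_map A f $ (\<iota> \<circ> \<pi>)) = tensor_power_map A f"
    by (simp add: vec_eq_iff tensor_power_map_def)
qed

lemma symmetric_tensor_closure_orbit:
  fixes f :: "('k::finite, 'd::finite) tensor"
  assumes "symmetric_tensor f" "s \<in> closure (sym_orbit f)"
  shows "symmetric_tensor s"
proof -
  obtain x where x: "\<And>n. x n \<in> sym_orbit f" "x \<longlonglongrightarrow> s"
    using assms(2) by (auto simp: closure_sequential)
  have "symmetric_tensor (x n)" for n
    using x(1)[of n] assms(1) by (auto simp: sym_orbit_def intro: symmetric_tensor_power_map)
  then have "x n $ (\<iota> \<circ> \<pi>) = x n $ \<iota>" if "bij \<pi>" for n \<iota> and \<pi> :: "'k \<Rightarrow> 'k"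
    using that unfolding symmetric_tensor_def vec_eq_iff by simp
  then have "s $ (\<iota> \<circ> \<pi>) = s $ \<iota>" if "bij \<pi>" for \<iota> and \<pi> :: "'k \<Rightarrow> 'k"
    using that tendsto_vec_nth[OF x(2), of "\<iota> \<circ> \<pi>"] tendsto_vec_nth[OF x(2), of \<iota>]
    by (simp add: LIMSEQ_unique)
  then show ?thesis by (simp add: symmetric_tensor_def vec_eq_iff)
qed

text \<open>The transposition of two factors exchanges the corresponding partial traces and fixes s,
  so all marginals equal their average.\<close>

lemma marginal_symmetric:
  fixes s :: "('k::finite, 'd::finite) tensor"
  assumes "symmetric_tensor s"
  shows "marginal j s = average_marginal s"
proof -
  have "marginal i s $ a $ b = marginal j s $ a $ b" for i j a b
  proof -
    define \<pi> where "\<pi> = Transposition.transpose i j"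
    have \<pi>: "bij \<pi>" "\<pi> \<circ> \<pi> = id" "\<pi> i = j" "\<pi> j = i" by (simp_all add: \<pi>_def)
    have s: "s $ (\<iota> \<circ> \<pi>) = s $ \<iota>" for \<iota>
      using assms \<pi>(1) unfolding symmetric_tensor_def vec_eq_iff by simp
    have pp: "(\<iota> \<circ> \<pi>) \<circ> \<pi> = \<iota>" for \<iota> :: "'k \<Rightarrow> 'd"
      by (simp add: \<pi>(2) comp_assoc)
    have upd: "(\<iota> \<circ> \<pi>)(i := b) = (\<iota>(j := b)) \<circ> \<pi>" for \<iota> :: "'k \<Rightarrow> 'd"
      using \<pi> by (auto simp: fun_eq_iff) (metis \<pi>(2) comp_apply id_apply)
    have su: "s $ ((\<iota> \<circ> \<pi>)(j := b)) = s $ (\<iota>(i := b))" for \<iota>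
      by (metis upd pp s)
    have "(\<Sum>\<iota> | \<iota> i = a. s $ \<iota> * cnj (s $ (\<iota>(i := b)))) = (\<Sum>\<iota> | \<iota> j = a. s $ \<iota> * cnj (s $ (\<iota>(j := b))))"
      by (rule sum.reindex_bij_witness[where i = "\<lambda>\<iota>. \<iota> \<circ> \<pi>" and j = "\<lambda>\<iota>. \<iota> \<circ> \<pi>"])
         (use \<pi> pp s su in \<open>auto simp del: fun_upd_apply\<close>)
    then show ?thesis by (simp add: marginal_nth)
  qed
  then have "(\<Sum>i\<in>UNIV. marginal i s $ a $ b) = of_nat CARD('k) * marginal j s $ a $ b" for a b
    by (metis (no_types, lifting) sum.cong sum_constant)
  then show ?thesis by (simp add: vec_eq_iff average_marginal_nth)
qed

text \<open>Marginals of a product multiply for each factor \<open>j\<close> separately. Symmetry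
  passes to the orbit closures and makes the marginals independent of \<open>j\<close>, so the
  average marginals multiply as well; entropies and logarithms of thresholds then add.\<close>

theorem sym_quantum_functional_kronecker:
  fixes f :: "('k::finite, 'd::finite) tensor" and g :: "('k, 'e::finite) tensor"
  assumes fg: "f \<noteq> 0" "g \<noteq> 0" and sym: "symmetric_tensor f" "symmetric_tensor g"
  shows "sym_quantum_functional (tensor_kronecker f g) = sym_quantum_functional f * sym_quantum_functional g"
proof -
  obtain q w where qw: "certificate f q w" by (rule certificate_exists[OF fg(1)])
  obtain r v where rv: "certificate g r v" by (rule certificate_exists[OF fg(2)])
  define F G where "F = sym_quantum_functional f" "G = sym_quantum_functional g"
  note cf = certificateD[OF qw, folded F_G_def] and cg = certificateD[OF rv, folded F_G_def]
  obtain B s where B: "dual_feasible B q w f" and s: "s \<in> closure (sym_orbit f)" "s \<noteq> 0"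
    "average_marginal s = diag_mat (\<lambda>a. of_real (q a))"
    using qw by (auto simp: certificate_def)
  obtain C t where C: "dual_feasible C r v g" and t: "t \<in> closure (sym_orbit g)" "t \<noteq> 0"
    "average_marginal t = diag_mat (\<lambda>a. of_real (r a))"
    using rv by (auto simp: certificate_def)
  define R where "R i = q (fst i) * r (snd i)" for i
  have ms: "marginal j s = diag_mat (\<lambda>a. of_real (q a))" "marginal j t = diag_mat (\<lambda>a. of_real (r a))" for j
    using symmetric_tensor_closure_orbit[OF sym(1) s(1)] symmetric_tensor_closure_orbit[OF sym(2) t(1)] s(3) t(3)
    by (simp_all add: marginal_symmetric)
  have vw: "w * v = (1 / (F * G)) ^ CARD('k)"
    unfolding cf(2) cg(2) by (simp flip: power_mult_distrib)
  have "dual_feasible (matrix_kronecker B C) R ((1 / (F * G)) ^ CARD('k)) (tensor_kronecker f g)"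
    unfolding dual_feasible_def tensor_power_map_kronecker vw[symmetric]
  proof (intro conjI allI)
    show "invertible (matrix_kronecker B C)" using B C by (intro invertible_matrix_kronecker) (auto simp: dual_feasible_def)
    show "0 \<le> R i" for i using B C by (auto simp: R_def dual_feasible_def)
    show "sum R UNIV = 1" using B C by (simp add: R_def sum_UNIV_pair dual_feasible_def flip: sum_product)
    show "0 < w * v" using B C by (simp add: dual_feasible_def)
    show "supported R (w * v) (tensor_kronecker (tensor_power_map B f) (tensor_power_map C g))"
      unfolding supported_def
    proof (intro allI impI)
      fix \<iota>
      assume "tensor_kronecker (tensor_power_map B f) (tensor_power_map C g) $ \<iota> \<noteq> 0"
      then have "w \<le> (\<Prod>j\<in>UNIV. q (fst (\<iota> j)))" "v \<le> (\<Prod>j\<in>UNIV. r (snd (\<iota> j)))"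
        using B C by (auto simp: tensor_kronecker_def dual_feasible_def supported_def)
      then show "w * v \<le> (\<Prod>j\<in>UNIV. R (\<iota> j))"
        using B C by (auto simp: R_def prod.distrib dual_feasible_def intro!: mult_mono prod_nonneg)
    qed
  qed
  moreover have "tensor_kronecker s t \<in> closure (sym_orbit (tensor_kronecker f g))"
    by (rule closure_orbit_kronecker[OF s(1) t(1)])
  moreover have "tensor_kronecker s t \<noteq> 0"
    using norm_tensor_kronecker[of s t] s(2) t(2) by auto
  moreover have "average_marginal (tensor_kronecker s t) = diag_mat (\<lambda>i. of_real (R i))"
    by (auto simp: vec_eq_iff average_marginal_nth marginal_kronecker ms R_def)
  moreover have "0 < F * G" using cf(1) cg(1) by simp
  moreover have "- (\<Sum>i\<in>UNIV. R i * log 2 (R i)) = log 2 (F * G)"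
  proof -
    have pt: "q a * r b * log 2 (q a * r b) = q a * log 2 (q a) * r b + q a * (r b * log 2 (r b))" for a b
    proof (cases "q a = 0 \<or> r b = 0")
      case False
      then have "0 < q a" "0 < r b" using B C by (auto simp: dual_feasible_def less_le)
      then show ?thesis by (simp add: log_mult algebra_simps)
    qed auto
    have "(\<Sum>i\<in>UNIV. R i * log 2 (R i))
        = (\<Sum>a\<in>UNIV. \<Sum>b\<in>UNIV. q a * log 2 (q a) * r b + q a * (r b * log 2 (r b)))"
      by (simp add: sum_UNIV_pair R_def pt)
    also have "\<dots> = (\<Sum>a\<in>UNIV. q a * log 2 (q a)) * (\<Sum>b\<in>UNIV. r b) + (\<Sum>a\<in>UNIV. q a) * (\<Sum>b\<in>UNIV. r b * log 2 (r b))"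
      unfolding sum_product by (simp add: sum.distrib)
    also have "\<dots> = - log 2 F - log 2 G" using B C cf(3) cg(3) by (simp add: dual_feasible_def)
    finally show ?thesis using cf(1) cg(1) by (simp add: log_mult)
  qed
  ultimately show ?thesis unfolding F_G_def[symmetric] by (rule sym_quantum_functional_eqI)
qed

subsection \<open>Unit tensors\<close>

lemma unit_tensor_nth:
  "(unit_tensor :: ('k::finite, 'r::finite) tensor) $ \<iota> = (if \<exists>i. \<iota> = (\<lambda>_. i) then 1 else 0)"
proof -
  have "(unit_tensor :: ('k, 'r) tensor) $ \<iota> = (\<Sum>i\<in>UNIV. \<Prod>j\<in>UNIV. if \<iota> j = i then 1 else 0)"
    by (simp add: unit_tensor_def vec_tensor_power_def axis_def eq_commute)
  also have "\<dots> = (\<Sum>i\<in>UNIV. if \<iota> = (\<lambda>_. i) then 1 else 0)"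
  proof (intro sum.cong refl)
    fix i
    show "(\<Prod>j\<in>UNIV. if \<iota> j = i then 1 else 0) = (if \<iota> = (\<lambda>_. i) then 1 else (0 :: complex))"
    proof (cases "\<iota> = (\<lambda>_. i)")
      case False
      then obtain j where "\<iota> j \<noteq> i" by (metis ext)
      then have "(\<Prod>j\<in>UNIV. if \<iota> j = i then 1 else (0 :: complex)) = 0" by (intro prod_zero) auto
      with False show ?thesis by simp
    qed simp
  qed
  also have "\<dots> = (if \<exists>i. \<iota> = (\<lambda>_. i) then 1 else 0)"
  proof (cases "\<exists>i. \<iota> = (\<lambda>_. i)")
    case True
    then obtain i where i: "\<iota> = (\<lambda>_. i)" by blast
    then have "(\<iota> = (\<lambda>_. i')) = (i' = i)" for i' by (auto simp: fun_eq_iff)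
    then show ?thesis using True by simp
  qed simp
  finally show ?thesis .
qed

text \<open>The unit tensor is its own optimal vector, with the identity and the uniform
  distribution as optimal feasible data. Its marginals are diagonal because changing one entry of a
  constant multi-index leaves a non-constant one as soon as there is a second factor.\<close>

theorem sym_quantum_functional_unit:
  assumes k: "CARD('k::finite) \<ge> 2"
  shows "sym_quantum_functional (unit_tensor :: ('k, 'r::finite) tensor) = real CARD('r)"
proof -
  let ?u = "unit_tensor :: ('k, 'r) tensor"
  let ?r = "real CARD('r)"
  have const: "((\<lambda>_ :: 'k. i) = (\<lambda>_. i')) = (i = i')" for i i' :: 'r by (auto simp: fun_eq_iff)
  have sum_const: "(\<Sum>\<iota>\<in>UNIV. if \<exists>i. \<iota> = (\<lambda>_. i) then F \<iota> else 0) = (\<Sum>i\<in>UNIV. F (\<lambda>_. i))"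
    for F :: "('k \<Rightarrow> 'r) \<Rightarrow> real"
  proof -
    have "(\<Sum>\<iota>\<in>UNIV. if \<exists>i. \<iota> = (\<lambda>_. i) then F \<iota> else 0) = sum F (range (\<lambda>i _. i))"
      by (rule sum.mono_neutral_cong_right) auto
    also have "\<dots> = (\<Sum>i\<in>UNIV. F (\<lambda>_. i))" by (subst sum.reindex) (auto simp: inj_def const)
    finally show ?thesis .
  qed
  have norm: "(norm ?u)\<^sup>2 = ?r"
  proof -
    have "(norm ?u)\<^sup>2 = (\<Sum>\<iota> :: 'k \<Rightarrow> 'r\<in>UNIV. if \<exists>i. \<iota> = (\<lambda>_. i) then 1 else 0)"
      unfolding norm_vec_sq by (intro sum.cong) (auto simp: unit_tensor_nth)
    also have "\<dots> = ?r" by (simp add: sum_const)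
    finally show ?thesis .
  qed
  have diag: "diag_weight ?u a = 1 / ?r" for a
  proof -
    have "(\<Sum>\<iota>\<in>UNIV. (cmod (?u $ \<iota>))\<^sup>2 * real (card {j. \<iota> j = a}))
        = (\<Sum>\<iota> :: 'k \<Rightarrow> 'r\<in>UNIV. if \<exists>i. \<iota> = (\<lambda>_. i) then real (card {j. \<iota> j = a}) else 0)"
      by (intro sum.cong) (auto simp: unit_tensor_nth)
    also have "\<dots> = (\<Sum>i\<in>UNIV. real (card {j :: 'k. i = a}))" by (simp add: sum_const)
    also have "\<dots> = (\<Sum>i\<in>UNIV. if i = a then real CARD('k) else 0)"
      by (intro sum.cong) auto
    finally show ?thesis by (simp add: diag_weight_def norm)
  qed
  have off: "average_marginal ?u $ a $ b = 0" if ab: "a \<noteq> b" for a b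
  proof -
    have "?u $ \<iota> * cnj (?u $ (\<iota>(j := b))) = 0" if ij: "\<iota> j = a" for \<iota> and j :: 'k
    proof (rule ccontr)
      assume "\<not> ?thesis"
      then have "?u $ \<iota> \<noteq> 0" "?u $ (\<iota>(j := b)) \<noteq> 0" by (simp_all del: fun_upd_apply)
      then obtain i i' where i: "\<iota> = (\<lambda>_. i)" "\<iota>(j := b) = (\<lambda>_. i')"
        by (auto simp: unit_tensor_nth split: if_splits)
      obtain j' where "j' \<noteq> j" using exists_other_index[OF k] by blast
      then have "i' = i" using i by (metis fun_upd_other)
      moreover have "i' = b" using i by (metis fun_upd_same)
      moreover have "i = a" using i ij by simp
      ultimately show False using ab by simp
    qed
    then have "(\<Sum>\<iota> | \<iota> j = a. ?u $ \<iota> * cnj (?u $ (\<iota>(j := b)))) = 0" for j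
      by (intro sum.neutral) blast
    then have "marginal j ?u $ a $ b = 0" for j
      unfolding marginal_nth by (simp only: div_0)
    then show ?thesis by (simp add: average_marginal_nth)
  qed
  have av: "average_marginal ?u = diag_mat (\<lambda>a. of_real (1 / ?r))"
    using off by (auto simp: vec_eq_iff average_marginal_diag diag)
  have feas: "dual_feasible (mat 1) (\<lambda>_. 1 / ?r) ((1 / ?r) ^ CARD('k)) ?u"
    by (auto simp: dual_feasible_def supported_def invertible_def)
  have cl: "?u \<in> closure (sym_orbit ?u)" by (rule subsetD[OF closure_subset sym_orbit_self])
  have nz: "?u \<noteq> 0" using norm by auto
  have ent: "- (\<Sum>a\<in>(UNIV :: 'r set). 1 / ?r * log 2 (1 / ?r)) = log 2 ?r"
    by (simp add: log_divide)
  show ?thesis by (rule sym_quantum_functional_eqI[OF feas cl nz av _ ent]) simp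
qed

theorem corollary5p9:
  fixes f :: "('k::finite, 'd::finite) tensor"
    and g :: "('k, 'e::finite) tensor"
  assumes "CARD('k) \<ge> 2"
    and "f \<noteq> 0" and "symmetric_tensor f"
    and "g \<noteq> 0" and "symmetric_tensor g"
  shows "sym_quantum_functional (unit_tensor :: ('k, 'r::finite) tensor) = real CARD('r) \<and>
    sym_quantum_functional (tensor_direct_sum f g) =
      sym_quantum_functional f + sym_quantum_functional g \<and>
    sym_quantum_functional (tensor_kronecker f g) =
      sym_quantum_functional f * sym_quantum_functional g \<and>
    (f \<le>\<^sub>s g \<longrightarrow> sym_quantum_functional f \<le> sym_quantum_functional g)"
  using assms sym_quantum_functional_unit[OF assms(1)] sym_quantum_functional_direct_sum[of f g]
    sym_quantum_functional_kronecker[of f g] sym_quantum_functional_mono[of f g]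
  by blast

end
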